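(* Let $m\ge 2$ be an integer and let $\mathcal G$ be a metric graph. Let $\mathfrak U=(\mathcal U_i)_{1\le i\le k}$ be an $m$-fold cover of $\mathcal G$ with associated vicinity graph $\Gamma$. Let $$\eta:=\min_{1\le j\le k}\lambda_2(\mathcal U_j)$$ be the minimal spectral gap of the Laplacian with natural conditions on the metric graphs $\mathcal U_1,\dots,\mathcal U_k$. Then the $k$ lowest eigenvalues of the Laplacian with natural conditions on $\mathcal G$ satisfy $$\lambda_i(\mathcal G)\ \ge\ \frac{m-1}{m}\,\eta\,\alpha_i(\Gamma),\qquad i=1,\dots,k .$$
   Context: Metric graphs. A metric graph $\mathcal G$ is obtained from finitely many intervals $(0,\ell_1),\dots,(0,\ell_E)$, with $E<\infty$ and $0<\ell_j<\infty$, by identifying endpoints in a graph-like fashion: each interval is an edge and the identified endpoints are the vertices. It carries the Lebesgue measure (denoted $|\cdot|$) and the natural path metric, and $L^2(\mathcal G)=\bigoplus_j L^2(0,\ell_j)$. Throughout, $\mathcal G$ has no loops (this is harmless, since dummy vertices may be inserted in the interior of edges); parallel edges are allowed. Laplacian with natural conditions (standard Laplacian). The operator $\Delta:(f_1,\dots,f_E)\mapsto(-f_1'',\dots,-f_E'')$ on $L^2(\mathcal G)$ whose domain consists of those $f\in\bigoplus_j H^2(0,\ell_j)$ that are continuous across the vertices and satisfy the Kirchhoff condition (at each vertex the sum of all normal derivatives along the incident edges vanishes). It is self-adjoint and positive semidefinite with pure point spectrum; its eigenvalues, counted with multiplicity in increasing order, are $0=\lambda_1(\mathcal G)\le\lambda_2(\mathcal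 G)\le\dots$. The same notation is used for subgraphs, regarded as metric graphs in their own right. $m$-fold cover. An $m$-fold cover of $\mathcal G$ is a finite family $\mathfrak U=(\mathcal U_i)_{1\le i\le k}$ of connected metric subgraphs of $\mathcal G$ (each being a union of edges of positive length) such that for almost every $x\in\mathcal G$ there exist $m$ distinct indices $1\le i_1<\dots<i_m\le k$ with $x\in\mathcal U_{i_1}\cap\dots\cap\mathcal U_{i_m}$ and $x\notin\mathcal U_i$ for $i\notin\{i_1,\dots,i_m\}$. (The same set may occur several times in the family.) Vicinity graph. The associated vicinity graph $\Gamma$ is the simple unoriented weighted graph with vertex set $\{1,\dots,k\}$ and edge weights $\mu_{ij}:=|\mathcal U_i\cap\mathcal U_j|$ for $i\ne j$, $\mu_{ii}:=0$; vertices $i\neq j$ are adjacent iff $\mu_{ij}>0$. Normalized Laplacian. For a simple weighted graph $G$ with edge weights $\mu_e>0$ and weighted degrees $d_v=\sum_{e\sim v}\mu_e$, the normalized Laplacian is $\Lambda=D^{-1}\mathcal I M\mathcal I^T$, where $\mathcal I$ is the signed (vertex-by-edge) incidence matrix of an arbitrary orientation, $M=\mathrm{diag}(\mu_e)$ and $D=\mathrm{diag}(d_v)$; i.e. $(\Lambda f)(v)=\frac1{d_v}\sum_{w}\mu_{vw}(f(v)-f(w))$. Its (real) eigenvalues in increasing order with multiplicity are $0=\alpha_1(G)\le\alpha_2(G)\le\dots$. *)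

theory Defs
  imports "HOL-Analysis.Analysis" "HOL-Library.Function_Algebras"
begin

instantiation "fun" :: (type, real_vector) real_vector
begin

definition scaleR_fun :: "real \<Rightarrow> ('a \<Rightarrow> 'b) \<Rightarrow> 'a \<Rightarrow> 'b"
  where "scaleR_fun c f = (\<lambda>x. c *\<^sub>R f x)"

instance
  by standard (simp_all add: scaleR_fun_def fun_eq_iff scaleR_add_right scaleR_add_left)

end


section \<open>Eigenvalues counted with multiplicity\<close>

text \<open>A (possibly unbounded, partially defined) linear operator is given by its graph.\<close>

type_synonym 'a operator = "('a \<times> 'a) set"

definition eigenspace :: "'a::real_vector operator \<Rightarrow> real \<Rightarrow> 'a set"
  where "eigenspace T t = {f. (f, t *\<^sub>R f) \<in> T}"

definition is_eigenvalue :: "'a::real_vector operator \<Rightarrow> real \<Rightarrow> bool"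
  where "is_eigenvalue T t \<longleftrightarrow> (\<exists>f\<in>eigenspace T t. f \<noteq> 0)"

definition eigenvalue_count :: "'a::real_vector operator \<Rightarrow> real \<Rightarrow> nat"
  where "eigenvalue_count T t = (\<Sum>s | is_eigenvalue T s \<and> s \<le> t. dim (eigenspace T s))"

text \<open>
  The \<open>n\<close>-th eigenvalue (\<open>n = 1, 2, \<dots>\<close>) in the increasing enumeration with multiplicity. It is
  meant for operators having only finitely many eigenvalues below each bound, all of finite
  multiplicity, and at least \<open>n\<close> eigenvalues in total; the infimum is then a minimum. Both
  operators below are self-adjoint, so the multiplicity of an eigenvalue is the dimension of its
  eigenspace.
\<close>

definition nth_eigenvalue :: "'a::real_vector operator \<Rightarrow> nat \<Rightarrow> real"
  where "nth_eigenvalue T n = Inf {t. n \<le> eigenvalue_count T t}"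


section \<open>Metric graphs\<close>

text \<open>
  Edge \<open>e\<close> is the interval \<open>(0, elen e)\<close>; its endpoints \<open>0\<close> and \<open>elen e\<close> are glued to the vertices
  \<open>src e\<close> and \<open>tgt e\<close>. The orientation is only a parametrisation.
\<close>

record ('v, 'e) metric_graph =
  edges :: "'e set"
  elen :: "'e \<Rightarrow> real"
  src :: "'e \<Rightarrow> 'v"
  tgt :: "'e \<Rightarrow> 'v"

definition is_metric_graph :: "('v, 'e) metric_graph \<Rightarrow> bool"
  where "is_metric_graph G \<longleftrightarrow>
    finite (edges G) \<and> edges G \<noteq> {} \<and> (\<forall>e\<in>edges G. 0 < elen G e \<and> src G e \<noteq> tgt G e)"

definition vertices :: "('v, 'e) metric_graph \<Rightarrow> 'v set"
  where "vertices G = src G ` edges G \<union> tgt G ` edges G"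

definition connected_graph :: "('v, 'e) metric_graph \<Rightarrow> bool"
  where "connected_graph G \<longleftrightarrow>
    (let A = (\<lambda>e. (src G e, tgt G e)) ` edges G
     in \<forall>u\<in>vertices G. \<forall>v\<in>vertices G. (u, v) \<in> (A \<union> A\<inverse>)\<^sup>*)"

definition subgraph :: "('v, 'e) metric_graph \<Rightarrow> 'e set \<Rightarrow> ('v, 'e) metric_graph"
  where "subgraph G S = G\<lparr>edges := S\<rparr>"

text \<open>
  The point set of the union of the edges in \<open>S\<close>, without the finitely many vertices, which form a
  null set; the point at coordinate \<open>x\<close> of edge \<open>e\<close> is the pair \<open>(e, x)\<close>.
\<close>

definition points :: "('v, 'e) metric_graph \<Rightarrow> 'e set \<Rightarrow> ('e \<times> real) set"
  where "points G S = (SIGMA e:S. {0<..<elen G e})"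

definition graph_measure :: "('v, 'e) metric_graph \<Rightarrow> ('e \<times> real) measure"
  where "graph_measure G =
    restrict_space (count_space (edges G) \<Otimes>\<^sub>M lborel) (points G (edges G))"


section \<open>The Laplacian with natural conditions\<close>

definition square_integrable :: "real \<Rightarrow> (real \<Rightarrow> real) \<Rightarrow> bool"
  where "square_integrable l h \<longleftrightarrow>
    set_borel_measurable lborel {0<..<l} h \<and> set_integrable lborel {0<..<l} (\<lambda>x. (h x)\<^sup>2)"

text \<open>
  \<open>f\<close> is the continuous representative on \<open>[0, l]\<close> of an element of \<open>H\<^sup>1(0, l)\<close> with weak derivative
  \<open>g\<close>, i.e. \<open>f\<close> is absolutely continuous with \<open>f' = g\<close> almost everywhere and \<open>g\<close> in \<open>L\<^sup>2(0, l)\<close>.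
\<close>

definition H1_deriv :: "real \<Rightarrow> (real \<Rightarrow> real) \<Rightarrow> (real \<Rightarrow> real) \<Rightarrow> bool"
  where "H1_deriv l f g \<longleftrightarrow>
    square_integrable l g \<and> (\<forall>x\<in>{0..l}. f x = f 0 + (LINT t:{0..x}|lborel. g t))"

text \<open>\<open>f\<close> is in \<open>H\<^sup>2(0, l)\<close>, \<open>g\<close> is the continuous representative of \<open>f'\<close>, and \<open>f'' = h\<close>.\<close>

definition H2_derivs :: "real \<Rightarrow> (real \<Rightarrow> real) \<Rightarrow> (real \<Rightarrow> real) \<Rightarrow> (real \<Rightarrow> real) \<Rightarrow> bool"
  where "H2_derivs l f g h \<longleftrightarrow> H1_deriv l f g \<and> H1_deriv l g h"

definition continuous_at_vertices :: "('v, 'e) metric_graph \<Rightarrow> ('e \<Rightarrow> real \<Rightarrow> real) \<Rightarrow> bool"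
  where "continuous_at_vertices G f \<longleftrightarrow>
    (\<exists>\<phi>. \<forall>e\<in>edges G. f e 0 = \<phi> (src G e) \<and> f e (elen G e) = \<phi> (tgt G e))"

text \<open>Here \<open>g\<close> is the derivative along the edges; normal derivatives are taken into the edge.\<close>

definition kirchhoff :: "('v, 'e) metric_graph \<Rightarrow> ('e \<Rightarrow> real \<Rightarrow> real) \<Rightarrow> bool"
  where "kirchhoff G g \<longleftrightarrow>
    (\<forall>v\<in>vertices G.
      (\<Sum>e | e \<in> edges G \<and> src G e = v. g e 0)
      + (\<Sum>e | e \<in> edges G \<and> tgt G e = v. - g e (elen G e)) = 0)"

text \<open>
  Pairs \<open>(f, u)\<close> with \<open>f\<close> in the domain and \<open>u = -f''\<close> almost everywhere on each edge. An element
  \<open>f\<close> of the domain is given by its continuous representative on the closed edges, extended by zero;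
  this makes the representative unique, so that linear independence in \<open>L\<^sup>2\<close> is linear independence
  of functions. Scalars are real: the operator commutes with complex conjugation, hence real
  and complex multiplicities agree.
\<close>

definition standard_laplacian :: "('v, 'e) metric_graph \<Rightarrow> ('e \<Rightarrow> real \<Rightarrow> real) operator"
  where "standard_laplacian G = {(f, u).
    (\<forall>e x. e \<notin> edges G \<or> x \<notin> {0..elen G e} \<longrightarrow> f e x = 0) \<and>
    continuous_at_vertices G f \<and>
    (\<exists>g h. (\<forall>e\<in>edges G. H2_derivs (elen G e) (f e) (g e) (h e)) \<and>
      kirchhoff G g \<and>
      (\<forall>e\<in>edges G. AE x in lborel. x \<in> {0<..<elen G e} \<longrightarrow> u e x = - h e x))}"

definition graph_eigenvalue :: "('v, 'e) metric_graph \<Rightarrow> nat \<Rightarrow> real"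
  where "graph_eigenvalue G n = nth_eigenvalue (standard_laplacian G) n"


section \<open>Covers and their vicinity graphs\<close>

text \<open>
  The family \<open>(\<U>\<^sub>i)\<close> is indexed by a finite type, and \<open>\<U>\<^sub>i\<close> is the subgraph consisting of the edges
  in \<open>U i\<close>. Cutting an edge in its interior amounts to inserting a dummy vertex into \<open>G\<close>.
\<close>

definition fold_cover ::
    "nat \<Rightarrow> ('v, 'e) metric_graph \<Rightarrow> ('i::finite \<Rightarrow> 'e set) \<Rightarrow> bool"
  where "fold_cover m G U \<longleftrightarrow>
    (\<forall>i. U i \<noteq> {} \<and> U i \<subseteq> edges G \<and> connected_graph (subgraph G (U i))) \<and>
    (AE p in graph_measure G. card {i. p \<in> points G (U i)} = m)"

text \<open>
  A weighted graph on \<open>'i\<close> is represented by its symmetric weight function, which vanishes on the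
  diagonal; \<open>i\<close> and \<open>j\<close> are adjacent iff their weight is positive.
\<close>

definition vicinity_weight ::
    "('v, 'e) metric_graph \<Rightarrow> ('i::finite \<Rightarrow> 'e set) \<Rightarrow> 'i \<Rightarrow> 'i \<Rightarrow> real"
  where "vicinity_weight G U i j =
    (if i = j then 0 else measure (graph_measure G) (points G (U i) \<inter> points G (U j)))"

definition weighted_degree :: "('i::finite \<Rightarrow> 'i \<Rightarrow> real) \<Rightarrow> 'i \<Rightarrow> real"
  where "weighted_degree \<mu> v = (\<Sum>w\<in>UNIV. \<mu> v w)"

definition normalized_laplacian :: "('i::finite \<Rightarrow> 'i \<Rightarrow> real) \<Rightarrow> real ^ 'i \<Rightarrow> real ^ 'i"
  where "normalized_laplacian \<mu> f =
    (\<chi> v. 1 / weighted_degree \<mu> v * (\<Sum>w\<in>UNIV. \<mu> v w * (f $ v - f $ w)))"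

definition normalized_eigenvalue :: "('i::finite \<Rightarrow> 'i \<Rightarrow> real) \<Rightarrow> nat \<Rightarrow> real"
  where "normalized_eigenvalue \<mu> n = nth_eigenvalue {(f, normalized_laplacian \<mu> f) | f. True} n"

end

theory Submission
  imports Defs "HOL-Complex_Analysis.Great_Picard"
begin

text \<open>
  Both operators are described by a pair of forms, and in both cases \<open>i\<close> eigenvalues lie below
  \<open>t\<close> as soon as the quadratic form is at most \<open>t\<close> times the inner product on an
  \<open>i\<close>-dimensional space. Eigenvectors are obtained by minimising the Rayleigh quotient on the
  orthogonal complement of a system of eigenvectors; on a metric graph \<open>C\<^sup>1\<close> functions suffice for
  this, since the minimising sequence converges uniformly by Arzela--Ascoli and the
  Euler--Lagrange equation passes to the limit after two integrations by parts.

  Let \<open>f\<close> lie in a space on which the energy is at most \<open>t \<parallel>f\<parallel>\<^sup>2\<close>, let \<open>F\<^sub>j\<close> be the mean of \<open>f\<close>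
  over \<open>\<U>\<^sub>j\<close>, \<open>N = \<Sum>\<^sub>j \<bar>\<U>\<^sub>j\<bar> F\<^sub>j\<^sup>2\<close> and \<open>P = \<integral> p\<^sup>2\<close>, where \<open>p(x)\<close> is the sum of the \<open>F\<^sub>j\<close> over the
  \<open>j\<close> with \<open>x \<in> \<U>\<^sub>j\<close>. Summing the Poincare inequalities of the \<open>\<U>\<^sub>j\<close> gives
  \<open>\<eta> (m \<parallel>f\<parallel>\<^sup>2 - N) \<le> m t \<parallel>f\<parallel>\<^sup>2\<close>. Each point lies in \<open>m\<close> of the \<open>\<U>\<^sub>j\<close>, so the form of the vicinity
  graph at \<open>F\<close> is \<open>m N - P\<close> and its weighted square norm is \<open>(m - 1) N\<close>. As
  \<open>N = \<integral> f p\<close>, Cauchy--Schwarz gives \<open>N\<^sup>2 \<le> \<parallel>f\<parallel>\<^sup>2 P\<close>, which bounds the Rayleigh quotient of \<open>F\<close> by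
  \<open>m t / ((m - 1) \<eta>)\<close>. If \<open>f \<mapsto> F\<close> is not injective, then \<open>\<eta> \<le> t\<close>, and the trivial
  bound \<open>\<alpha>\<^sub>i \<le> m / (m - 1)\<close> is enough.
\<close>

section \<open>Positive semidefinite forms\<close>

text \<open>The discriminant of a nonnegative quadratic polynomial in \<open>c\<close> is not
  positive; for \<open>P > 0\<close> the minimiser \<open>c = N / P\<close> shows this. Every
  Cauchy--Schwarz inequality below is obtained by expanding a square and applying this.\<close>

lemma quadratic_nonneg_imp:
  fixes A N P :: real
  assumes "\<And>c. 0 \<le> A - 2 * c * N + c\<^sup>2 * P" and "0 \<le> P"
  shows "N\<^sup>2 \<le> A * P"
proof (cases "P = 0")
  case True
  have "N = 0"
  proof (rule ccontr)
    assume "N \<noteq> 0"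
    \<comment> \<open>For \<open>P = 0\<close> this choice of \<open>c\<close> makes the polynomial
      equal to -1.\<close>
    then show False using assms(1)[of "(A + 1) / (2 * N)"] True by simp
  qed
  then show ?thesis using True by simp
next
  case False
  then have "P > 0" using assms(2) by simp
  then show ?thesis using assms(1)[of "N / P"] by (simp add: field_simps power2_eq_square)
qed

text \<open>The laws are required on a carrier \<open>V\<close> only, since integrals are additive
  only for sufficiently regular functions. Definiteness is not demanded because the energy vanishes
  on constants.\<close>

locale psd_form =
  fixes V :: "'a::real_vector set" and p :: "'a \<Rightarrow> 'a \<Rightarrow> real"
  assumes subspace: "subspace V"
    and add_left: "\<lbrakk>f \<in> V; g \<in> V; h \<in> V\<rbrakk> \<Longrightarrow> p (f + g) h = p f h + p g h"
    and scale_left: "\<lbrakk>f \<in> V; h \<in> V\<rbrakk> \<Longrightarrow> p (c *\<^sub>R f) h = c * p f h"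
    and sym: "\<lbrakk>f \<in> V; h \<in> V\<rbrakk> \<Longrightarrow> p f h = p h f"
    and nonneg: "f \<in> V \<Longrightarrow> 0 \<le> p f f"
begin

lemmas V_closed = subspace_0[OF subspace] subspace_add[OF subspace] subspace_diff[OF subspace]
  subspace_scale[OF subspace] subspace_sum[OF subspace]

lemma add_right: "\<lbrakk>f \<in> V; g \<in> V; h \<in> V\<rbrakk> \<Longrightarrow> p h (f + g) = p h f + p h g"
  using add_left[of f g h] sym V_closed by metis

lemma scale_right: "\<lbrakk>f \<in> V; h \<in> V\<rbrakk> \<Longrightarrow> p h (c *\<^sub>R f) = c * p h f"
  using scale_left[of f h c] sym V_closed by metis

lemma zero_left: "h \<in> V \<Longrightarrow> p 0 h = 0"
  using scale_left[of 0 h 0] V_closed(1) by simp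

lemma diff_left: "\<lbrakk>f \<in> V; g \<in> V; h \<in> V\<rbrakk> \<Longrightarrow> p (f - g) h = p f h - p g h"
  using add_left[of f "-1 *\<^sub>R g" h] scale_left[of g h "-1"] V_closed(4)[of g "-1"] by simp

lemma diff_right: "\<lbrakk>f \<in> V; g \<in> V; h \<in> V\<rbrakk> \<Longrightarrow> p h (f - g) = p h f - p h g"
  using diff_left[of f g h] sym V_closed by metis

lemma sum_left: "\<lbrakk>\<And>x. x \<in> A \<Longrightarrow> f x \<in> V; h \<in> V\<rbrakk> \<Longrightarrow> p (\<Sum>x\<in>A. f x) h = (\<Sum>x\<in>A. p (f x) h)"
proof (induction A rule: infinite_finite_induct)
  case (insert x F)
  then show ?case by (simp add: add_left V_closed)
qed (simp_all add: zero_left)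

lemma sum_right: "\<lbrakk>\<And>x. x \<in> A \<Longrightarrow> f x \<in> V; h \<in> V\<rbrakk> \<Longrightarrow> p h (\<Sum>x\<in>A. f x) = (\<Sum>x\<in>A. p h (f x))"
  by (simp add: sym[of h] V_closed sum_left)

lemmas bilinear = add_left add_right diff_left diff_right scale_left scale_right

lemma subspace_orthogonal: "B \<subseteq> V \<Longrightarrow> subspace {f \<in> V. \<forall>x\<in>B. p f x = 0}"
  by (auto simp: subspace_def V_closed zero_left add_left scale_left subset_iff)

lemma Cauchy_Schwarz:
  assumes "f \<in> V" "g \<in> V"
  shows "(p f g)\<^sup>2 \<le> p f f * p g g"
proof (rule quadratic_nonneg_imp)
  fix c
  have "p (f - c *\<^sub>R g) (f - c *\<^sub>R g) = p f f - 2 * c * p f g + c\<^sup>2 * p g g"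
    using assms sym[of g f] by (simp add: bilinear V_closed power2_eq_square algebra_simps)
  then show "0 \<le> p f f - 2 * c * p f g + c\<^sup>2 * p g g"
    using nonneg[of "f - c *\<^sub>R g"] assms V_closed by metis
qed (use assms nonneg in auto)

definition orthonormal :: "'a set \<Rightarrow> bool"
  where "orthonormal B \<longleftrightarrow> finite B \<and> B \<subseteq> V \<and> (\<forall>x\<in>B. \<forall>y\<in>B. p x y = (if x = y then 1 else 0))"

lemma orthonormal_coefficient:
  assumes "orthonormal B" "y \<in> B"
  shows "p (\<Sum>x\<in>B. c x *\<^sub>R x) y = c y"
proof -
  have "p (\<Sum>x\<in>B. c x *\<^sub>R x) y = (\<Sum>x\<in>B. c x * (if x = y then 1 else 0))"
    using assms by (subst sum_left) (auto simp: orthonormal_def V_closed scale_left subset_iff intro!: sum.cong)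
  also have "\<dots> = c y" using assms by (simp add: orthonormal_def if_distrib cong: if_cong)
  finally show ?thesis .
qed

lemma orthonormal_independent:
  assumes "orthonormal B"
  shows "independent B"
proof (rule independent_if_scalars_zero)
  show "finite B" using assms by (simp add: orthonormal_def)
  fix c x assume "(\<Sum>x\<in>B. c x *\<^sub>R x) = 0" "x \<in> B"
  then show "c x = 0"
    using orthonormal_coefficient[OF assms, of x c] assms zero_left by (auto simp: orthonormal_def)
qed

lemma orthonormal_residual:
  assumes "orthonormal B" "f \<in> V" "y \<in> B"
  shows "p (f - (\<Sum>x\<in>B. p f x *\<^sub>R x)) y = 0"
proof -
  have "y \<in> V" "(\<Sum>x\<in>B. p f x *\<^sub>R x) \<in> V"
    using assms by (auto simp: orthonormal_def intro!: V_closed)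
  then show ?thesis
    using orthonormal_coefficient[OF assms(1,3)] assms by (simp add: diff_left)
qed

end

text \<open>\<open>L\<close> is linear only on the span of \<open>S\<close>, so it is replaced by a
  globally linear \<open>g\<close> agreeing with it on \<open>S\<close>. Either \<open>g\<close> is
  injective on the span and transports the basis, or the difference of two points with equal image
  lies in the kernel.\<close>

lemma independent_image_or_kernel:
  fixes L :: "'a::real_vector \<Rightarrow> 'b::real_vector"
  assumes S: "independent S"
    and add: "\<And>x y. \<lbrakk>x \<in> span S; y \<in> span S\<rbrakk> \<Longrightarrow> L (x + y) = L x + L y"
    and scale: "\<And>c x. x \<in> span S \<Longrightarrow> L (c *\<^sub>R x) = c *\<^sub>R L x"
  shows "independent (L ` S) \<and> inj_on L S \<and> span (L ` S) = L ` span S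
    \<or> (\<exists>f\<in>span S. f \<noteq> 0 \<and> L f = 0)"
proof -
  obtain g where g: "linear g" "\<forall>x\<in>S. g x = L x"
    using linear_independent_extend[OF S, of L] by blast
  interpret g: linear g by fact
  have "x \<in> span S \<and> g x = L x" if "x \<in> span S" for x
    using that
  proof (induction rule: span_induct_alt)
    case base
    show ?case using scale[of 0 0] by (simp add: span_zero g.zero)
  next
    case (step c x y)
    then show ?case
      using g(2) by (simp add: add scale span_base span_scale span_add g.add g.scale)
  qed
  then have eq: "\<And>x. x \<in> span S \<Longrightarrow> g x = L x" by blast
  have img: "L ` S = g ` S" "L ` span S = g ` span S" using eq by (auto simp: span_base)
  show ?thesis
  proof (cases "inj_on g (span S)")
    case True
    then have "inj_on L S" using g(2) by (metis (mono_tags, lifting) inj_on_def span_base)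
    moreover have "independent (g ` S)"
      using linear_independent_injective_image[OF g(1) S True] .
    ultimately show ?thesis using img linear_span_image[OF g(1)] by metis
  next
    case False
    then obtain x y where "x \<in> span S" "y \<in> span S" "x \<noteq> y" "g x = g y" by (auto simp: inj_on_def)
    then have "x - y \<in> span S" "x - y \<noteq> 0" "L (x - y) = 0"
      using eq[of "x - y"] by (auto simp: span_diff g.diff)
    then show ?thesis by blast
  qed
qed

lemma sum_fun_apply: "(\<Sum>y\<in>A. F y) x = (\<Sum>y\<in>A. F y x)"
  by (induction A rule: infinite_finite_induct) auto

text \<open>Dimension count: sending \<open>f\<close> to the family of its products with the
  elements of \<open>B\<close> maps a space of dimension \<open>card S\<close> into one of dimension
  at most \<open>card B\<close>, so the kernel is nontrivial.\<close>

lemma (in psd_form) exists_orthogonal: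
  assumes S: "independent S" "S \<subseteq> V" and B: "finite B" "B \<subseteq> V" "card B < card S"
  shows "\<exists>f\<in>span S. f \<noteq> 0 \<and> (\<forall>x\<in>B. p f x = 0)"
proof -
  \<comment> \<open>Functions vanishing outside \<open>B\<close> stand in for the coordinate space
    over \<open>B\<close>; the indicators \<open>D\<close> of single points span them.\<close>
  define L where "L f = (\<lambda>x. if x \<in> B then p f x else 0)" for f
  have "span S \<subseteq> V" using S(2) subspace by (rule span_minimal)
  then have L: "\<And>x y. \<lbrakk>x \<in> span S; y \<in> span S\<rbrakk> \<Longrightarrow> L (x + y) = L x + L y"
      "\<And>c x. x \<in> span S \<Longrightarrow> L (c *\<^sub>R x) = c *\<^sub>R L x"
    using B(2) by (auto simp: L_def fun_eq_iff scaleR_fun_def add_left scale_left subset_iff)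
  define D where "D = (\<lambda>y x. if x = y then 1 else (0::real)) ` B"
  have "L f \<in> span D" for f
  proof -
    have "L f = (\<Sum>y\<in>B. p f y *\<^sub>R (\<lambda>x. if x = y then 1 else (0::real)))"
      using B(1) by (auto simp: L_def fun_eq_iff scaleR_fun_def sum_fun_apply if_distrib cong: if_cong)
    also have "\<dots> \<in> span D"
      unfolding D_def by (intro span_sum span_scale span_base imageI)
    finally show ?thesis .
  qed
  then have "L ` S \<subseteq> span D" by blast
  moreover have "finite D" "card D \<le> card B" using B(1) by (auto simp: D_def card_image_le)
  ultimately have "independent (L ` S) \<Longrightarrow> card (L ` S) \<le> card B"
    using independent_span_bound[of D "L ` S"] by fastforce
  then have "\<not> (independent (L ` S) \<and> inj_on L S)"
    using B(3) card_image[of L S] by auto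
  then obtain f where "f \<in> span S" "f \<noteq> 0" "L f = 0"
    using independent_image_or_kernel[OF S(1), of L] L by blast
  then show ?thesis by (intro bexI[of _ f]) (auto simp: L_def fun_eq_iff split: if_splits)
qed

section \<open>The variational principle\<close>

lemma tendsto_0_if_square_le:
  fixes f g :: "nat \<Rightarrow> real"
  assumes "\<And>n. (f n)\<^sup>2 \<le> g n" "g \<longlonglongrightarrow> 0"
  shows "f \<longlonglongrightarrow> 0"
proof -
  have "(\<lambda>n. (f n)\<^sup>2) \<longlonglongrightarrow> 0"
    by (rule tendsto_sandwich[OF always_eventually always_eventually tendsto_const assms(2)])
      (use assms(1) in auto)
  then show ?thesis by simp
qed

text \<open>Common interface of both operators: \<open>b\<close> is the inner product,
  \<open>q\<close> the energy, and eigenvectors are the weak ones. The last two assumptions express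
  compactness without completeness of \<open>V\<close>: there is no infinite well-separated family
  of bounded energy, and a bounded-energy sequence that solves the eigenvalue equation
  asymptotically comes close to a true eigenvector. The map \<open>r\<close> need not be increasing,
  as only properties shared by all \<open>F n\<close> are passed to the limit.\<close>

locale spectral_form =
  B: psd_form V b + Q: psd_form V q
  for V :: "'a::real_vector set" and b q :: "'a \<Rightarrow> 'a \<Rightarrow> real" +
  fixes T :: "'a operator"
  assumes pos: "\<lbrakk>f \<in> V; f \<noteq> 0\<rbrakk> \<Longrightarrow> 0 < b f f"
    and eigenspace: "eigenspace T s = {f \<in> V. \<forall>\<phi>\<in>V. q f \<phi> = s * b f \<phi>}"
    and not_separated: "(\<And>n::nat. F n \<in> V \<and> b (F n) (F n) = 1 \<and> q (F n) (F n) \<le> K)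
      \<Longrightarrow> \<exists>i j. i \<noteq> j \<and> b (F i - F j) (F i - F j) < 1"
    and approximate_eigenvector: "\<lbrakk>\<And>n::nat. F n \<in> V \<and> b (F n) (F n) = 1 \<and> q (F n) (F n) \<le> K;
        \<And>\<phi>. \<phi> \<in> V \<Longrightarrow> (\<lambda>n. q (F n) \<phi> - s * b (F n) \<phi>) \<longlonglongrightarrow> 0\<rbrakk>
      \<Longrightarrow> \<exists>r f. f \<in> eigenspace T s \<and> (\<lambda>n. b (F (r n) - f) (F (r n) - f)) \<longlonglongrightarrow> 0"
begin

lemma eigenspaceD: "f \<in> eigenspace T s \<Longrightarrow> f \<in> V" "\<lbrakk>f \<in> eigenspace T s; \<phi> \<in> V\<rbrakk> \<Longrightarrow> q f \<phi> = s * b f \<phi>"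
  by (auto simp: eigenspace)

lemma subspace_eigenspace: "subspace (eigenspace T s)"
  by (auto simp: eigenspace subspace_def B.V_closed B.zero_left Q.zero_left
      B.bilinear Q.bilinear algebra_simps)

lemma normalize:
  assumes "f \<in> V" "f \<noteq> 0"
  defines "g \<equiv> (1 / sqrt (b f f)) *\<^sub>R f"
  shows "b g g = 1" "q g g = q f f / b f f"
proof -
  have "b f f > 0" by (rule pos) fact+
  then show "b g g = 1" "q g g = q f f / b f f" unfolding g_def
    using assms(1) by (auto simp: B.bilinear Q.bilinear B.V_closed field_simps)
qed

lemma eigenvalue_nonneg:
  assumes "is_eigenvalue T s"
  shows "0 \<le> s"
proof -
  obtain f where f: "f \<in> eigenspace T s" "f \<noteq> 0" using assms by (auto simp: is_eigenvalue_def)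
  then have "0 \<le> s * b f f" "0 < b f f"
    using Q.nonneg[of f] pos[of f] eigenspaceD[of f s] by auto
  then show ?thesis by (simp add: zero_le_mult_iff)
qed

text \<open>By symmetry \<open>q f g\<close> equals both \<open>s * b f g\<close> and
  \<open>t * b f g\<close>.\<close>

lemma eigenspaces_orthogonal:
  assumes "f \<in> eigenspace T s" "g \<in> eigenspace T t" "s \<noteq> t"
  shows "b f g = 0"
  using assms eigenspaceD[OF assms(1)] eigenspaceD[OF assms(2)] B.sym[of f g] Q.sym[of f g] by auto

text \<open>Direct method: \<open>s\<close> is the infimum of the Rayleigh quotient over the
  orthogonal complement \<open>W\<close> of \<open>X\<close>. A minimising sequence satisfies the
  eigenvalue equation asymptotically, so the compactness assumption yields the eigenvector.\<close>

lemma exists_orthogonal_eigenvector: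
  assumes O: "B.orthonormal X" and E: "\<And>x. x \<in> X \<Longrightarrow> x \<in> eigenspace T (\<mu> x)"
    and g: "g \<in> V" "g \<noteq> 0" "\<And>x. x \<in> X \<Longrightarrow> b g x = 0"
  obtains h s where "h \<in> eigenspace T s" "b h h = 1" "\<And>x. x \<in> X \<Longrightarrow> b h x = 0" "s \<le> q g g / b g g"
proof -
  define W where "W = {f \<in> V. \<forall>x\<in>X. b f x = 0}"
  have OV: "X \<subseteq> V" using O by (simp add: B.orthonormal_def)
  have W: "subspace W" "W \<subseteq> V"
    using B.subspace_orthogonal[OF OV] by (auto simp: W_def)
  have gW: "g \<in> W" using g by (auto simp: W_def)
  define R where "R = {q f f |f. f \<in> W \<and> b f f = 1}"
  define s where "s = Inf R"
  have normR: "q f f / b f f \<in> R" if "f \<in> W" "f \<noteq> 0" for f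
  proof -
    have "(1 / sqrt (b f f)) *\<^sub>R f \<in> W" using subspace_scale[OF W(1) that(1)] .
    then show ?thesis unfolding R_def using normalize[of f] that W(2) by force
  qed
  have bdd: "bdd_below R" unfolding R_def using Q.nonneg W(2) by (intro bdd_belowI[of _ 0]) auto
  have s_le: "s * b f f \<le> q f f" if "f \<in> W" for f
  proof (cases "f = 0")
    case True then show ?thesis by (simp add: B.zero_left Q.zero_left B.V_closed)
  next
    case False
    then have "s \<le> q f f / b f f" unfolding s_def using cInf_lower[OF normR bdd] that by blast
    then show ?thesis using pos[of f] that W(2) False by (auto simp: field_simps)
  qed
  \<comment> \<open>Since \<open>s\<close> is the infimum, \<open>q - s b\<close> is positive
    semidefinite on \<open>W\<close>, so its own Cauchy--Schwarz inequality is available.\<close>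
  interpret P: psd_form W "\<lambda>f h. q f h - s * b f h"
  proof
    fix f h assume "f \<in> W" "h \<in> W"
    then have "f \<in> V" "h \<in> V" using W(2) by auto
    then show "q f h - s * b f h = q h f - s * b h f" by (metis B.sym Q.sym)
  qed (use W s_le in \<open>auto simp: B.bilinear Q.bilinear subset_iff algebra_simps\<close>)
  have "R \<noteq> {}" using normR[OF gW g(2)] by blast
  have "\<exists>f. f \<in> W \<and> b f f = 1 \<and> q f f < s + 1 / real (Suc n)" for n
    using cInf_lessD[OF \<open>R \<noteq> {}\<close>, of "s + 1 / real (Suc n)"] unfolding s_def[symmetric]
    by (auto simp: R_def)
  then obtain F where F: "\<And>n. F n \<in> W" "\<And>n. b (F n) (F n) = 1"
      "\<And>n. q (F n) (F n) < s + 1 / real (Suc n)" by metis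
  have FV: "\<And>n. F n \<in> V" using F(1) W(2) by blast
  \<comment> \<open>Orthogonality to an eigenvector with respect to \<open>b\<close> implies
    orthogonality with respect to \<open>q\<close>.\<close>
  have F0: "b (F n) x = 0" "q (F n) x = 0" if "x \<in> X" for n x
  proof -
    show "b (F n) x = 0" using F(1) that by (auto simp: W_def)
    then show "q (F n) x = 0"
      using eigenspaceD(2)[OF E[OF that] FV[of n]] B.sym[of x "F n"] Q.sym[of x "F n"] FV that OV by auto
  qed
  have lim: "(\<lambda>n. q (F n) \<phi> - s * b (F n) \<phi>) \<longlonglongrightarrow> 0" if \<phi>: "\<phi> \<in> V" for \<phi>
  proof -
    \<comment> \<open>Projecting the test function onto \<open>W\<close> changes neither form
      against \<open>F n\<close>. In \<open>W\<close>, Cauchy--Schwarz for \<open>q - s b\<close>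
      bounds the defect by the excess of \<open>F n\<close> over the infimum, which tends to
      0.\<close>
    define \<psi> where "\<psi> = \<phi> - (\<Sum>x\<in>X. b \<phi> x *\<^sub>R x)"
    have S: "(\<Sum>x\<in>X. b \<phi> x *\<^sub>R x) \<in> V" using OV by (auto intro!: B.V_closed)
    have \<psi>: "\<psi> \<in> W" unfolding W_def \<psi>_def
      using B.orthonormal_residual[OF O \<phi>] S \<phi> by (auto intro: B.V_closed)
    have "b (F n) \<psi> = b (F n) \<phi>" "q (F n) \<psi> = q (F n) \<phi>" for n
      using OV by (auto simp: \<psi>_def B.diff_right[OF \<phi> S FV] Q.diff_right[OF \<phi> S FV]
          B.sum_right Q.sum_right B.scale_right Q.scale_right B.V_closed FV F0 subset_iff)
    then have *: "(q (F n) \<phi> - s * b (F n) \<phi>)\<^sup>2 \<le> (1 / real (Suc n)) * (q \<psi> \<psi> - s * b \<psi> \<psi>)" for n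
      using P.Cauchy_Schwarz[OF F(1)[of n] \<psi>] F(2)[of n] F(3)[of n] P.nonneg[OF \<psi>]
        mult_right_mono[of "q (F n) (F n) - s" "1 / real (Suc n)" "q \<psi> \<psi> - s * b \<psi> \<psi>"] by simp
    have "(\<lambda>n. 1 / real (Suc n)) \<longlonglongrightarrow> 0" using LIMSEQ_inverse_real_of_nat by (simp add: inverse_eq_divide)
    then have "(\<lambda>n. (1 / real (Suc n)) * (q \<psi> \<psi> - s * b \<psi> \<psi>)) \<longlonglongrightarrow> 0"
      by (rule tendsto_mult_left_zero)
    then show ?thesis by (rule tendsto_0_if_square_le[OF *])
  qed
  have "q (F n) (F n) \<le> s + 1" for n
  proof -
    have "1 / real (Suc n) \<le> 1" by simp
    then show ?thesis using F(3)[of n] by linarith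
  qed
  then obtain r h where h: "h \<in> eigenspace T s" "(\<lambda>n. b (F (r n) - h) (F (r n) - h)) \<longlonglongrightarrow> 0"
    using approximate_eigenvector[of F "s + 1" s] FV F(2) lim by blast
  have hV: "h \<in> V" using h(1) by (rule eigenspaceD)
  have conv: "(\<lambda>n. b (F (r n)) x) \<longlonglongrightarrow> b h x" if x: "x \<in> V" for x
  proof -
    have *: "(b (F (r n)) x - b h x)\<^sup>2 \<le> b (F (r n) - h) (F (r n) - h) * b x x" for n
      using B.Cauchy_Schwarz[of "F (r n) - h" x] x hV FV by (simp add: B.diff_left B.V_closed)
    have "(\<lambda>n. b (F (r n) - h) (F (r n) - h) * b x x) \<longlonglongrightarrow> 0"
      using h(2) by (rule tendsto_mult_left_zero)
    then have "(\<lambda>n. b (F (r n)) x - b h x) \<longlonglongrightarrow> 0" by (rule tendsto_0_if_square_le[OF *])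
    then show ?thesis by (rule LIM_zero_cancel)
  qed
  have orth: "b h x = 0" if "x \<in> X" for x
  proof -
    have "(\<lambda>n. 0) \<longlonglongrightarrow> b h x" using conv[of x] F0(1)[OF that] that OV by auto
    then show ?thesis by (simp add: LIMSEQ_const_iff)
  qed
  \<comment> \<open>Expanding the squared distance and passing to the limit gives
    \<open>1 - b h h = 0\<close>, so the limit is normalised and in particular nonzero.\<close>
  have "b (F (r n) - h) (F (r n) - h) = 1 - 2 * b (F (r n)) h + b h h" for n
    using FV[of "r n"] hV F(2)[of "r n"] B.sym[of h "F (r n)"] by (simp add: B.bilinear B.V_closed)
  then have "(\<lambda>n. 1 - 2 * b (F (r n)) h + b h h) \<longlonglongrightarrow> 0" using h(2) by simp
  moreover have "(\<lambda>n. 1 - 2 * b (F (r n)) h + b h h) \<longlonglongrightarrow> 1 - 2 * b h h + b h h"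
    by (intro tendsto_intros conv hV)
  ultimately have "1 - 2 * b h h + b h h = 0" using LIMSEQ_unique by blast
  then have "b h h = 1" by simp
  moreover have "s \<le> q g g / b g g" unfolding s_def using cInf_lower[OF normR[OF gW g(2)] bdd] .
  ultimately show ?thesis using that[OF h(1)] orth by blast
qed

section \<open>Orthonormal systems of eigenvectors and the eigenvalue count\<close>

definition eigen_system :: "real \<Rightarrow> 'a set \<Rightarrow> bool"
  where "eigen_system t S \<longleftrightarrow> B.orthonormal S \<and> (\<forall>x\<in>S. \<exists>s\<le>t. x \<in> eigenspace T s)"

text \<open>Maximality is tested against adding a single vector; every use below adds exactly
  one.\<close>

definition maximal_system :: "real \<Rightarrow> 'a set \<Rightarrow> bool"
  where "maximal_system t S \<longleftrightarrow> eigen_system t S \<and> (\<forall>f. eigen_system t (insert f S) \<longrightarrow> f \<in> S)"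

lemma eigen_systemD:
  assumes "eigen_system t S"
  shows "B.orthonormal S" "x \<in> S \<Longrightarrow> \<exists>s\<le>t. x \<in> eigenspace T s" "finite S" "S \<subseteq> V"
  using assms by (simp_all add: eigen_system_def B.orthonormal_def)

lemma maximal_systemD: "maximal_system t S \<Longrightarrow> eigen_system t S"
  "\<lbrakk>maximal_system t S; eigen_system t (insert f S)\<rbrakk> \<Longrightarrow> f \<in> S"
  unfolding maximal_system_def by blast+

text \<open>Otherwise systems could be enlarged forever, which gives an infinite orthonormal
  sequence with energies at most \<open>t\<close>. Its members have squared distance 2 from each
  other, against \<open>not_separated\<close>.\<close>

lemma exists_maximal_system:
  assumes "eigen_system t S0"
  obtains S where "maximal_system t S" "S0 \<subseteq> S"
proof (rule ccontr)
  assume "\<not> thesis"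
  then have noext: "\<And>S. maximal_system t S \<Longrightarrow> \<not> S0 \<subseteq> S" using that by blast
  have ext: "\<exists>f. f \<notin> S \<and> eigen_system t (insert f S)" if "eigen_system t S" "S0 \<subseteq> S" for S
    using that noext unfolding maximal_system_def by blast
  have "\<exists>S. \<forall>n. (eigen_system t (S n) \<and> S0 \<subseteq> S n) \<and> (\<exists>f. f \<notin> S n \<and> S (Suc n) = insert f (S n))"
    by (rule dependent_nat_choice) (use assms ext in \<open>blast+\<close>)
  then obtain S f where S: "\<And>n. eigen_system t (S n)" "\<And>n. f n \<notin> S n" "\<And>n. S (Suc n) = insert (f n) (S n)"
    by metis
  have mono: "S i \<subseteq> S j" if "i \<le> j" for i j using that by (rule lift_Suc_mono_le[rotated]) (use S(3) in blast)
  have f: "f i \<in> S (Suc j)" if "i \<le> j" for i j using mono[of "Suc i" "Suc j"] that S(3)[of i] by auto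
  have f_inj: "f i \<noteq> f j" if "i < j" for i j
    using f[of i "j - 1"] S(2)[of j] that by (metis Suc_diff_1 less_Suc_eq_le less_nat_zero_code neq0_conv)
  have fV: "f i \<in> V" and f1: "b (f i) (f i) = 1" for i
    using f[of i i] S(1)[of "Suc i"] by (auto simp: eigen_system_def B.orthonormal_def)
  have f0: "b (f i) (f j) = 0" if "i < j" for i j
    using f[of i j] f[of j j] S(1)[of "Suc j"] f_inj[OF that] that
    by (auto simp: eigen_system_def B.orthonormal_def)
  have "q (f i) (f i) \<le> t" for i
  proof -
    obtain s where "s \<le> t" "f i \<in> eigenspace T s"
      using f[of i i] S(1)[of "Suc i"] by (auto simp: eigen_system_def)
    then show ?thesis using eigenspaceD(2)[of "f i" s "f i"] fV f1[of i] by simp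
  qed
  then obtain i j where "i \<noteq> j" "b (f i - f j) (f i - f j) < 1"
    using not_separated[of f t] fV f1 by blast
  moreover have "b (f i - f j) (f i - f j) = 2 - 2 * b (f i) (f j)"
    using fV f1 B.sym[of "f i" "f j"] by (simp add: B.bilinear B.V_closed)
  moreover have "b (f i) (f j) = 0"
    using f0[of i j] f0[of j i] \<open>i \<noteq> j\<close> B.sym[of "f i" "f j"] fV by (metis nat_neq_iff)
  ultimately show False by simp
qed

text \<open>Subtracting from an eigenvector its projection onto \<open>S'\<close> leaves an
  eigenvector orthogonal to all of \<open>S\<close>; if it were nonzero, its normalisation could be
  added to \<open>S\<close>.\<close>

lemma maximal_system_span:
  assumes S: "maximal_system t S" and "s \<le> t"
  shows "span (S \<inter> eigenspace T s) = eigenspace T s"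
proof
  show "span (S \<inter> eigenspace T s) \<subseteq> eigenspace T s"
    by (rule span_minimal) (use subspace_eigenspace in auto)
  show "eigenspace T s \<subseteq> span (S \<inter> eigenspace T s)"
  proof
    fix f assume f: "f \<in> eigenspace T s"
    define S' where "S' = S \<inter> eigenspace T s"
    define g where "g = f - (\<Sum>x\<in>S'. b f x *\<^sub>R x)"
    have on: "B.orthonormal S" using eigen_systemD(1)[OF maximal_systemD(1)[OF S]] .
    then have on': "B.orthonormal S'" by (auto simp: B.orthonormal_def S'_def)
    have fV: "f \<in> V" using f by (rule eigenspaceD)
    have gE: "g \<in> eigenspace T s" unfolding g_def
      using f by (auto simp: S'_def intro!: subspace_diff[OF subspace_eigenspace]
          subspace_sum[OF subspace_eigenspace] subspace_scale[OF subspace_eigenspace])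
    \<comment> \<open>Members of \<open>S\<close> outside this eigenspace belong to a different
      eigenvalue and are orthogonal to \<open>g\<close> for that reason.\<close>
    have orth: "b g x = 0" if "x \<in> S" for x
    proof (cases "x \<in> S'")
      case True then show ?thesis unfolding g_def by (rule B.orthonormal_residual[OF on' fV])
    next
      case False
      moreover obtain u where "x \<in> eigenspace T u"
        using eigen_systemD(2)[OF maximal_systemD(1)[OF S] \<open>x \<in> S\<close>] by blast
      ultimately show ?thesis using eigenspaces_orthogonal[OF gE, of x u] that by (auto simp: S'_def)
    qed
    have gV: "g \<in> V" using gE by (rule eigenspaceD)
    have "g = 0"
    proof (rule ccontr)
      assume "g \<noteq> 0"
      define h where "h = (1 / sqrt (b g g)) *\<^sub>R g"
      have h: "b h h = 1" using normalize[OF gV \<open>g \<noteq> 0\<close>] by (simp add: h_def)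
      have SV: "S \<subseteq> V" using on by (auto simp: B.orthonormal_def)
      have hx: "b h x = 0" "b x h = 0" if "x \<in> S" for x
        using orth[OF that] B.sym[of x g] gV that SV by (auto simp: h_def B.bilinear subset_iff)
      have hE: "h \<in> eigenspace T s" unfolding h_def by (rule subspace_scale[OF subspace_eigenspace gE])
      have "eigen_system t (insert h S)"
        using eigen_systemD(2)[OF maximal_systemD(1)[OF S]] on h hx hE \<open>s \<le> t\<close> eigenspaceD(1)[OF hE]
        by (auto simp: eigen_system_def B.orthonormal_def)
      then have "h \<in> S" by (rule maximal_systemD(2)[OF S])
      then show False using hx h by simp
    qed
    then have "f = (\<Sum>x\<in>S'. b f x *\<^sub>R x)" by (simp add: g_def)
    then show "f \<in> span (S \<inter> eigenspace T s)"
      by (metis (no_types, lifting) S'_def span_base span_scale span_sum)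
  qed
qed

text \<open>Each member of \<open>S\<close> belongs to exactly one eigenvalue \<mu>, and the members
  with a given eigenvalue form a basis of its eigenspace. Grouping \<open>S\<close> by \<mu> gives
  the count; in particular the sum in \<open>eigenvalue_count\<close> runs over a finite set and is
  not 0 by default.\<close>

lemma eigenvalue_count_maximal_system:
  assumes S: "maximal_system t S"
  shows "eigenvalue_count T t = card S"
proof -
  have on: "B.orthonormal S" and E: "\<And>x. x \<in> S \<Longrightarrow> \<exists>s\<le>t. x \<in> eigenspace T s"
    using eigen_systemD[OF maximal_systemD(1)[OF S]] by auto
  have fin: "finite S" using on by (simp add: B.orthonormal_def)
  have nz: "x \<noteq> 0" if "x \<in> S" for x
    using on that B.zero_left[of 0] by (auto simp: B.orthonormal_def)
  obtain \<mu> where \<mu>: "\<And>x. x \<in> S \<Longrightarrow> \<mu> x \<le> t" "\<And>x. x \<in> S \<Longrightarrow> x \<in> eigenspace T (\<mu> x)" using E by metis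
  \<comment> \<open>A unit vector is not orthogonal to itself, so it cannot lie in two
    eigenspaces.\<close>
  have \<mu>_eq: "\<mu> x = s" if "x \<in> S" "x \<in> eigenspace T s" for x s
    using eigenspaces_orthogonal[OF \<mu>(2)[OF that(1)] that(2)] on that(1) by (auto simp: B.orthonormal_def)
  have ev: "{s. is_eigenvalue T s \<and> s \<le> t} = \<mu> ` S"
  proof safe
    fix s assume s: "is_eigenvalue T s" "s \<le> t"
    then obtain f where "f \<in> eigenspace T s" "f \<noteq> 0" by (auto simp: is_eigenvalue_def)
    then have "S \<inter> eigenspace T s \<noteq> {}" using maximal_system_span[OF S s(2)] by auto
    then show "s \<in> \<mu> ` S" using \<mu>_eq by auto
  qed (use \<mu> nz in \<open>auto simp: is_eigenvalue_def\<close>)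
  have "dim (eigenspace T s) = card {x \<in> S. \<mu> x = s}" if "s \<in> \<mu> ` S" for s
  proof -
    have "s \<le> t" using that \<mu> by auto
    have "S \<inter> eigenspace T s = {x \<in> S. \<mu> x = s}" using \<mu> \<mu>_eq by auto
    moreover have "independent (S \<inter> eigenspace T s)"
      using independent_mono[OF B.orthonormal_independent[OF on]] by auto
    ultimately show ?thesis
      using maximal_system_span[OF S \<open>s \<le> t\<close>]
        dim_eq_card[of "S \<inter> eigenspace T s" "eigenspace T s"]
      by (metis span_span)
  qed
  then have "eigenvalue_count T t = (\<Sum>s\<in>\<mu> ` S. card {x \<in> S. \<mu> x = s})"
    unfolding eigenvalue_count_def ev by (rule sum.cong[OF refl])
  also have "\<dots> = card S"
    using sum.image_gen[OF fin, of "\<lambda>x. 1::nat" \<mu>] by simp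
  finally show ?thesis .
qed

lemma eigenvalue_count_ge:
  assumes "eigen_system t S"
  shows "card S \<le> eigenvalue_count T t"
proof -
  obtain M where M: "maximal_system t M" "S \<subseteq> M" using exists_maximal_system[OF assms] .
  then have "finite M" using eigen_systemD(3) maximal_systemD(1) by blast
  then show ?thesis using eigenvalue_count_maximal_system[OF M(1)] card_mono M(2) by metis
qed

section \<open>The min-max principle\<close>

lemma eigen_system_empty: "eigen_system t {}"
  by (simp add: eigen_system_def B.orthonormal_def)

text \<open>Minimising the Rayleigh quotient orthogonally to \<open>M\<close> gives a new
  eigenvector. Its eigenvalue exceeds \<open>t\<close>, since otherwise the vector could be added to
  the maximal system at level \<open>t\<close>.\<close>

lemma eigen_system_extend:
  assumes M: "maximal_system t M" and g: "g \<in> V" "g \<noteq> 0" "\<forall>x\<in>M. b g x = 0"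
  shows "\<exists>u. u \<le> q g g / b g g \<and> t < u \<and> card M + 1 \<le> eigenvalue_count T u"
proof -
  have S: "eigen_system t M" "B.orthonormal M" using eigen_systemD(1) maximal_systemD(1)[OF M] by auto
  then obtain \<mu> where \<mu>: "\<And>x. x \<in> M \<Longrightarrow> \<mu> x \<le> t \<and> x \<in> eigenspace T (\<mu> x)"
    unfolding eigen_system_def by metis
  obtain h u where h: "h \<in> eigenspace T u" "b h h = 1" "\<And>x. x \<in> M \<Longrightarrow> b h x = 0" "u \<le> q g g / b g g"
  proof (rule exists_orthogonal_eigenvector[OF S(2), of \<mu> g])
    show "x \<in> M \<Longrightarrow> x \<in> eigenspace T (\<mu> x)" "x \<in> M \<Longrightarrow> b g x = 0" for x using \<mu> g(3) by auto
  qed (use g in auto)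
  have MV: "M \<subseteq> V" using S(2) by (simp add: B.orthonormal_def)
  have hV: "h \<in> V" using h(1) by (rule eigenspaceD)
  have hx: "b x h = 0" if "x \<in> M" for x using h(3)[OF that] B.sym[of x h] that MV hV by auto
  have hM: "h \<notin> M" using h(2) h(3)[of h] by auto
  have es: "eigen_system t' (insert h M)" if "t \<le> t'" "u \<le> t'" for t'
    unfolding eigen_system_def
  proof
    show "B.orthonormal (insert h M)" using S(2) h hV hx by (auto simp: B.orthonormal_def)
    show "\<forall>x\<in>insert h M. \<exists>s\<le>t'. x \<in> eigenspace T s"
    proof
      fix x assume "x \<in> insert h M"
      then show "\<exists>s\<le>t'. x \<in> eigenspace T s"
      proof
        assume "x \<in> M"
        then show ?thesis using \<mu>[of x] that by (intro exI[of _ "\<mu> x"]) auto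
      qed (use h(1) that in auto)
    qed
  qed
  have "t < u" using maximal_systemD(2)[OF M] es[of t] hM by force
  moreover have "card M + 1 \<le> eigenvalue_count T u"
    using eigenvalue_count_ge[OF es[of u]] \<open>t < u\<close> hM S(2) by (simp add: B.orthonormal_def)
  ultimately show ?thesis using h(4) by blast
qed

text \<open>If the count were smaller, some nonzero \<open>g\<close> in the span would be orthogonal
  to a maximal system. Extending the system by means of \<open>g\<close> produces an eigenvalue
  above \<open>t\<close> but at most the Rayleigh quotient of \<open>g\<close>, which is at most
  \<open>t\<close>.\<close>

lemma eigenvalue_count_ge_of_subspace:
  assumes S: "independent S" "S \<subseteq> V" "finite S" and le: "\<And>f. f \<in> span S \<Longrightarrow> q f f \<le> t * b f f"
  shows "card S \<le> eigenvalue_count T t"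
proof (rule ccontr)
  assume less: "\<not> ?thesis"
  obtain M where M: "maximal_system t M" using exists_maximal_system[OF eigen_system_empty] .
  then have M': "finite M" "M \<subseteq> V" "card M < card S"
    using less eigenvalue_count_maximal_system[OF M]
      eigen_systemD(3,4)[OF maximal_systemD(1)[OF M]] by auto
  obtain g where g: "g \<in> span S" "g \<noteq> 0" "\<forall>x\<in>M. b g x = 0"
    using B.exists_orthogonal[OF S(1,2) M'] by (elim bexE conjE)
  have gV: "g \<in> V" using subsetD[OF span_minimal[OF S(2) B.subspace] g(1)] .
  have "q g g / b g g \<le> t" using le[OF g(1)] pos[OF gV g(2)] by (simp add: divide_le_eq)
  moreover obtain u where "u \<le> q g g / b g g" "t < u"
    using eigen_system_extend[OF M gV g(2,3)] by (elim exE conjE)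
  ultimately show False by linarith
qed

text \<open>A bounded count would attain its maximum at some \<open>t\<close>, and extending a
  maximal system there would exceed it. This keeps the infimum in \<open>nth_eigenvalue\<close> from
  being taken over the empty set.\<close>

lemma exists_eigenvalue_count_ge:
  assumes S: "independent S" "S \<subseteq> V" "finite S"
  shows "\<exists>t. card S \<le> eigenvalue_count T t"
proof (rule ccontr)
  assume "\<not> ?thesis"
  then have lt: "\<And>t. eigenvalue_count T t < card S" by (simp add: not_le)
  then obtain t where t: "\<And>u. eigenvalue_count T u \<le> eigenvalue_count T t"
    using ex_has_greatest_nat[of "\<lambda>_. True" 0 "eigenvalue_count T" "card S"] by (metis less_imp_le)
  obtain M where M: "maximal_system t M" using exists_maximal_system[OF eigen_system_empty] .
  then have M': "finite M" "M \<subseteq> V" "card M < card S"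
    using lt[of t] eigenvalue_count_maximal_system[OF M]
      eigen_systemD(3,4)[OF maximal_systemD(1)[OF M]] by auto
  obtain g where g: "g \<in> span S" "g \<noteq> 0" "\<forall>x\<in>M. b g x = 0"
    using B.exists_orthogonal[OF S(1,2) M'] by (elim bexE conjE)
  have gV: "g \<in> V" using subsetD[OF span_minimal[OF S(2) B.subspace] g(1)] .
  obtain u where "card M + 1 \<le> eigenvalue_count T u"
    using eigen_system_extend[OF M gV g(2,3)] by (elim exE conjE)
  then show False using t[of u] eigenvalue_count_maximal_system[OF M] by simp
qed

text \<open>Any \<open>n\<close> members of a maximal system will do: in an orthonormal eigenbasis
  both forms are diagonal, and the weights of the energy are at most \<open>t\<close>.\<close>

lemma eigenvalue_count_geD:
  assumes "n \<le> eigenvalue_count T t"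
  obtains S where "independent S" "S \<subseteq> V" "finite S" "card S = n" "\<And>f. f \<in> span S \<Longrightarrow> q f f \<le> t * b f f"
proof -
  obtain M where M: "maximal_system t M" using exists_maximal_system[OF eigen_system_empty] .
  then have on: "B.orthonormal M" and E: "\<And>x. x \<in> M \<Longrightarrow> \<exists>s\<le>t. x \<in> eigenspace T s"
    using eigen_systemD[OF maximal_systemD(1)[OF M]] by auto
  then obtain \<mu> where \<mu>: "\<And>x. x \<in> M \<Longrightarrow> \<mu> x \<le> t \<and> x \<in> eigenspace T (\<mu> x)" by metis
  obtain S where S: "S \<subseteq> M" "card S = n"
    using obtain_subset_with_card_n[OF assms[unfolded eigenvalue_count_maximal_system[OF M]]] by metis
  have onS: "B.orthonormal S"
    using on S(1) finite_subset[OF S(1)] by (simp add: B.orthonormal_def subset_iff)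
  then have S': "finite S" "S \<subseteq> V" by (auto simp: B.orthonormal_def)
  have le: "q f f \<le> t * b f f" if f_span: "f \<in> span S" for f
  proof -
    obtain c where f: "f = (\<Sum>x\<in>S. c x *\<^sub>R x)"
      using f_span unfolding span_finite[OF S'(1)] by blast
    have fV: "f \<in> V" using subsetD[OF span_minimal[OF S'(2) B.subspace] f_span] .
    have bx: "b x f = c x" if "x \<in> S" for x
    proof -
      have "b x f = b f x" using B.sym[OF _ fV] subsetD[OF S'(2) that] .
      also have "\<dots> = c x" using B.orthonormal_coefficient[OF onS that, of c] unfolding f[symmetric] .
      finally show ?thesis .
    qed
    have cV: "c x *\<^sub>R x \<in> V" "x \<in> V" if "x \<in> S" for x using that S'(2) B.V_closed by auto
    have "b f f = (\<Sum>x\<in>S. b (c x *\<^sub>R x) f)" using B.sum_left[of S "\<lambda>x. c x *\<^sub>R x" f] cV fV unfolding f[symmetric] by blast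
    then have bf: "b f f = (\<Sum>x\<in>S. (c x)\<^sup>2)"
      using cV fV bx by (simp add: B.scale_left power2_eq_square)
    have "q f f = (\<Sum>x\<in>S. q (c x *\<^sub>R x) f)" using Q.sum_left[of S "\<lambda>x. c x *\<^sub>R x" f] cV fV unfolding f[symmetric] by blast
    then have "q f f = (\<Sum>x\<in>S. c x * q x f)" using cV fV by (simp add: Q.scale_left)
    also have "\<dots> = (\<Sum>x\<in>S. \<mu> x * (c x)\<^sup>2)"
    proof (rule sum.cong[OF refl])
      fix x assume x: "x \<in> S"
      then have "q x f = \<mu> x * c x" using eigenspaceD(2)[of x "\<mu> x", OF _ fV] \<mu> S(1) bx[OF x] by auto
      then show "c x * q x f = \<mu> x * (c x)\<^sup>2" by (simp add: power2_eq_square)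
    qed
    also have "\<dots> \<le> (\<Sum>x\<in>S. t * (c x)\<^sup>2)"
      using \<mu> S(1) by (auto intro!: sum_mono mult_right_mono)
    finally show ?thesis by (simp add: bf sum_distrib_left)
  qed
  show thesis by (rule that[OF B.orthonormal_independent[OF onS] S'(2,1) S(2) le])
qed

text \<open>A positive count requires an eigenvalue below \<open>t\<close>, and eigenvalues are
  nonnegative. For \<open>n = 0\<close> the set would be the whole real line.\<close>

lemma bdd_below_count:
  assumes "1 \<le> n"
  shows "bdd_below {t. n \<le> eigenvalue_count T t}"
proof (rule bdd_belowI[of _ 0])
  fix t assume "t \<in> {t. n \<le> eigenvalue_count T t}"
  then have n: "n \<le> eigenvalue_count T t" by simp
  have "\<exists>s. is_eigenvalue T s \<and> s \<le> t"
  proof (rule ccontr)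
    assume "\<not> ?thesis"
    then have "{s. is_eigenvalue T s \<and> s \<le> t} = {}" by simp
    then have "eigenvalue_count T t = 0" unfolding eigenvalue_count_def by (simp only: sum.empty)
    then show False using n assms by linarith
  qed
  then obtain s where "is_eigenvalue T s" "s \<le> t" by (elim exE conjE)
  then show "0 \<le> t" using eigenvalue_nonneg[of s] by linarith
qed

lemma nth_eigenvalue_le:
  assumes "independent S" "S \<subseteq> V" "finite S" "1 \<le> card S" "\<And>f. f \<in> span S \<Longrightarrow> q f f \<le> t * b f f"
  shows "nth_eigenvalue T (card S) \<le> t"
  unfolding nth_eigenvalue_def
proof (rule cInf_lower)
  show "t \<in> {t. card S \<le> eigenvalue_count T t}"
    using eigenvalue_count_ge_of_subspace[OF assms(1-3,5)] by simp
qed (rule bdd_below_count[OF assms(4)])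

text \<open>Together with \<open>nth_eigenvalue_le\<close> this is the min-max principle.
  \<open>S\<close> only certifies a sufficient dimension of \<open>V\<close>; the bound itself has
  to be checked on arbitrary test spaces \<open>S'\<close> of the same dimension.\<close>

lemma nth_eigenvalue_ge:
  assumes "independent S" "S \<subseteq> V" "finite S"
    and "\<And>t S'. \<lbrakk>independent S'; S' \<subseteq> V; finite S'; card S' = card S; \<And>f. f \<in> span S' \<Longrightarrow> q f f \<le> t * b f f\<rbrakk>
      \<Longrightarrow> c \<le> t"
  shows "c \<le> nth_eigenvalue T (card S)"
  unfolding nth_eigenvalue_def
proof (rule cInf_greatest)
  show "{t. card S \<le> eigenvalue_count T t} \<noteq> {}" using exists_eigenvalue_count_ge[OF assms(1-3)] by auto
  fix t assume "t \<in> {t. card S \<le> eigenvalue_count T t}"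
  then have "card S \<le> eigenvalue_count T t" by simp
  then show "c \<le> t" by (rule eigenvalue_count_geD) (rule assms(4))
qed

lemma nth_eigenvalue_nonneg:
  assumes "independent S" "S \<subseteq> V" "finite S" "1 \<le> card S"
  shows "0 \<le> nth_eigenvalue T (card S)"
proof (rule nth_eigenvalue_ge[OF assms(1-3)])
  fix t S' assume S': "independent S'" "S' \<subseteq> V" "card S' = card S" "\<And>f. f \<in> span S' \<Longrightarrow> q f f \<le> t * b f f"
  obtain f where f: "f \<in> S'" using S'(3) assms(4) by fastforce
  then have "f \<noteq> 0" using S'(1) dependent_zero by metis
  then have "0 < b f f" "0 \<le> q f f" using S'(2) f pos Q.nonneg by auto
  moreover have "q f f \<le> t * b f f" using S'(4) f by (simp add: span_base)
  ultimately have "0 \<le> t * b f f" "0 < b f f" by auto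
  then show "0 \<le> t" by (simp add: zero_le_mult_iff)
qed

end

section \<open>The normalized Laplacian\<close>

text \<open>The inner product weighted by the degrees, with respect to which the factor
  \<open>1 / weighted_degree\<close> leaves the operator symmetric.\<close>

definition degree_form :: "('i::finite \<Rightarrow> 'i \<Rightarrow> real) \<Rightarrow> real ^ 'i \<Rightarrow> real ^ 'i \<Rightarrow> real"
  where "degree_form \<mu> f g = (\<Sum>v\<in>UNIV. weighted_degree \<mu> v * (f $ v * g $ v))"

text \<open>The Dirichlet form; the double sum meets every edge in both directions, hence the factor
  1/2.\<close>

definition edge_form :: "('i::finite \<Rightarrow> 'i \<Rightarrow> real) \<Rightarrow> real ^ 'i \<Rightarrow> real ^ 'i \<Rightarrow> real"
  where "edge_form \<mu> f g = (\<Sum>v\<in>UNIV. \<Sum>w\<in>UNIV. \<mu> v w * ((f $ v - f $ w) * (g $ v - g $ w))) / 2"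

text \<open>Summation by parts: exchanging \<open>v\<close> and \<open>w\<close> reverses the sign
  of the difference of \<open>f\<close>, so both halves of the product contribute equally.\<close>

lemma edge_form_eq:
  assumes "\<And>v w. \<mu> v w = \<mu> w v"
  shows "edge_form \<mu> f g = (\<Sum>v\<in>UNIV. (\<Sum>w\<in>UNIV. \<mu> v w * (f $ v - f $ w)) * g $ v)"
proof -
  let ?S = "\<lambda>h. \<Sum>v\<in>UNIV. \<Sum>w\<in>UNIV. \<mu> v w * (f $ v - f $ w) * h v w"
  have "?S (\<lambda>v w. g $ w) = (\<Sum>w\<in>UNIV. \<Sum>v\<in>UNIV. \<mu> v w * (f $ v - f $ w) * g $ w)"
    by (rule sum.swap)
  also have "\<dots> = - ?S (\<lambda>v w. g $ v)"
    by (simp add: sum_negf[symmetric] assms algebra_simps)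
  finally have "?S (\<lambda>v w. g $ w) = - ?S (\<lambda>v w. g $ v)" .
  moreover have "2 * edge_form \<mu> f g = ?S (\<lambda>v w. g $ v) - ?S (\<lambda>v w. g $ w)"
    by (simp add: edge_form_def sum_subtractf[symmetric] algebra_simps)
  ultimately show ?thesis by (simp add: sum_distrib_right)
qed

lemma spectral_form_normalized_laplacian:
  fixes \<mu> :: "'i::finite \<Rightarrow> 'i \<Rightarrow> real"
  assumes sym: "\<And>v w. \<mu> v w = \<mu> w v" and nonneg: "\<And>v w. 0 \<le> \<mu> v w"
    and deg: "\<And>v. 0 < weighted_degree \<mu> v"
  shows "spectral_form UNIV (degree_form \<mu>) (edge_form \<mu>) {(f, normalized_laplacian \<mu> f) |f. True}"
proof -
  let ?T = "{(f, normalized_laplacian \<mu> f) |f. True}"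
  have d0: "\<And>v. weighted_degree \<mu> v \<noteq> 0" "\<And>v. 0 \<le> weighted_degree \<mu> v"
    using deg by (simp_all add: less_imp_le less_imp_neq[symmetric])
  have ev: "eigenspace ?T s = {f \<in> UNIV. \<forall>\<phi>\<in>UNIV. edge_form \<mu> f \<phi> = s * degree_form \<mu> f \<phi>}" for s
  proof -
    have "normalized_laplacian \<mu> f = s *\<^sub>R f \<longleftrightarrow> (\<forall>\<phi>. edge_form \<mu> f \<phi> = s * degree_form \<mu> f \<phi>)" for f
    proof -
      have "normalized_laplacian \<mu> f = s *\<^sub>R f \<longleftrightarrow>
          (\<forall>v. (\<Sum>w\<in>UNIV. \<mu> v w * (f $ v - f $ w)) = s * (weighted_degree \<mu> v * f $ v))"
        using d0(1) by (simp add: normalized_laplacian_def vec_eq_iff field_simps)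
      also have "\<dots> \<longleftrightarrow> (\<forall>\<phi>. edge_form \<mu> f \<phi> = s * degree_form \<mu> f \<phi>)"
      proof safe
        fix \<phi> assume "\<forall>v. (\<Sum>w\<in>UNIV. \<mu> v w * (f $ v - f $ w)) = s * (weighted_degree \<mu> v * f $ v)"
        then show "edge_form \<mu> f \<phi> = s * degree_form \<mu> f \<phi>"
          by (simp add: edge_form_eq[OF sym] degree_form_def sum_distrib_left mult.assoc)
      next
        fix v assume *: "\<forall>\<phi>. edge_form \<mu> f \<phi> = s * degree_form \<mu> f \<phi>"
        \<comment> \<open>Testing with a unit vector isolates the equation at
          \<open>v\<close>.\<close>
        have "edge_form \<mu> f (axis v 1) = (\<Sum>w\<in>UNIV. \<mu> v w * (f $ v - f $ w))"
          by (simp add: edge_form_eq[OF sym] axis_def if_distrib cong: if_cong)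
        moreover have "degree_form \<mu> f (axis v 1) = weighted_degree \<mu> v * f $ v"
          by (simp add: degree_form_def axis_def if_distrib cong: if_cong)
        ultimately show "(\<Sum>w\<in>UNIV. \<mu> v w * (f $ v - f $ w)) = s * (weighted_degree \<mu> v * f $ v)"
          using * by metis
      qed
      finally show ?thesis .
    qed
    then show ?thesis by (auto simp: eigenspace_def eq_commute[of "s *\<^sub>R _"])
  qed
  have pos: "0 < degree_form \<mu> f f" if f: "f \<noteq> 0" for f
  proof -
    obtain v where v: "f $ v \<noteq> 0" using f by (auto simp: vec_eq_iff)
    have "0 < weighted_degree \<mu> v * (f $ v * f $ v)" using deg v by (auto simp: zero_less_mult_iff)
    also have "\<dots> \<le> degree_form \<mu> f f"
      unfolding degree_form_def by (rule member_le_sum) (auto intro: mult_nonneg_nonneg d0)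
    finally show ?thesis .
  qed
  \<comment> \<open>All degrees are positive, so the unit sphere of the weighted norm is bounded and
    Bolzano--Weierstrass applies.\<close>
  have sub: "\<exists>r l. strict_mono (r :: nat \<Rightarrow> nat) \<and> (\<lambda>n. F (r n)) \<longlonglongrightarrow> l"
    if F: "\<And>n. degree_form \<mu> (F n) (F n) = 1" for F
  proof -
    define M where "M = (\<Sum>v\<in>UNIV. 1 / weighted_degree \<mu> v)"
    have M: "1 / weighted_degree \<mu> v \<le> M" for v
      unfolding M_def by (rule member_le_sum) (auto simp: d0)
    have "\<bar>F n $ v\<bar> \<le> M + 1" for n v
    proof -
      have "weighted_degree \<mu> v * (F n $ v * F n $ v) \<le> degree_form \<mu> (F n) (F n)"
        unfolding degree_form_def by (rule member_le_sum) (auto intro: mult_nonneg_nonneg d0)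
      then have *: "(F n $ v)\<^sup>2 \<le> 1 / weighted_degree \<mu> v"
        using deg[of v] F[of n] by (simp add: field_simps power2_eq_square)
      have "0 \<le> (\<bar>F n $ v\<bar> - 1/2)\<^sup>2" by simp
      then have "\<bar>F n $ v\<bar> \<le> (F n $ v)\<^sup>2 + 1" by (simp add: power2_eq_square algebra_simps)
      then show ?thesis using * M[of v] by linarith
    qed
    then have "norm (F n) \<le> (\<Sum>v\<in>(UNIV :: 'i set). M + 1)" for n
      by (intro order_trans[OF norm_le_l1_cart] sum_mono) auto
    then have "bounded (range F)" by (auto intro!: boundedI)
    then show ?thesis using bounded_imp_convergent_subsequence[of F] by (auto simp: o_def)
  qed
  have cont: "((\<lambda>n. degree_form \<mu> (A n) (B n)) \<longlongrightarrow> degree_form \<mu> a b) sequentially"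
    "((\<lambda>n. edge_form \<mu> (A n) (B n)) \<longlongrightarrow> edge_form \<mu> a b) sequentially"
    if "A \<longlonglongrightarrow> a" "B \<longlonglongrightarrow> b" for A B :: "nat \<Rightarrow> real ^ 'i" and a b
    unfolding degree_form_def edge_form_def by (intro tendsto_intros that; simp)+
  have z: "degree_form \<mu> 0 0 = 0" by (simp add: degree_form_def)
  show ?thesis
  proof
    show "0 < degree_form \<mu> f f" if "f \<noteq> 0" for f by (rule pos[OF that])
    show "0 \<le> edge_form \<mu> f f" for f
      by (auto simp: edge_form_def intro!: sum_nonneg mult_nonneg_nonneg[OF nonneg])
    show "eigenspace ?T s = {f \<in> UNIV. \<forall>\<phi>\<in>UNIV. edge_form \<mu> f \<phi> = s * degree_form \<mu> f \<phi>}" for s by (rule ev)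
    show "0 \<le> degree_form \<mu> f f" for f
      by (auto simp: degree_form_def intro!: sum_nonneg mult_nonneg_nonneg[OF d0(2)])
  next
    fix F :: "nat \<Rightarrow> real ^ 'i" and K
    assume F: "\<And>n. F n \<in> UNIV \<and> degree_form \<mu> (F n) (F n) = 1 \<and> edge_form \<mu> (F n) (F n) \<le> K"
    obtain r l where r: "strict_mono (r :: nat \<Rightarrow> nat)" "(\<lambda>n. F (r n)) \<longlonglongrightarrow> l" using sub[of F] F by blast
    \<comment> \<open>Consecutive members of the convergent subsequence eventually have distance
      below 1.\<close>
    have "(\<lambda>n. F (r (Suc n)) - F (r n)) \<longlonglongrightarrow> l - l"
      by (intro tendsto_diff r(2) LIMSEQ_Suc[OF r(2)])
    then have "(\<lambda>n. degree_form \<mu> (F (r (Suc n)) - F (r n)) (F (r (Suc n)) - F (r n))) \<longlonglongrightarrow> 0"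
      using cont(1) z by fastforce
    then have "\<forall>\<^sub>F n in sequentially. degree_form \<mu> (F (r (Suc n)) - F (r n)) (F (r (Suc n)) - F (r n)) < 1"
      by (rule order_tendstoD) simp
    then obtain n where "degree_form \<mu> (F (r (Suc n)) - F (r n)) (F (r (Suc n)) - F (r n)) < 1"
      by (auto simp: eventually_sequentially)
    moreover have "r (Suc n) \<noteq> r n" using r(1) by (simp add: strict_mono_eq)
    ultimately show "\<exists>i j. i \<noteq> j \<and> degree_form \<mu> (F i - F j) (F i - F j) < 1" by blast
    fix s assume lim: "\<And>\<phi>. \<phi> \<in> UNIV \<Longrightarrow> (\<lambda>n. edge_form \<mu> (F n) \<phi> - s * degree_form \<mu> (F n) \<phi>) \<longlonglongrightarrow> 0"
    have "edge_form \<mu> l \<phi> = s * degree_form \<mu> l \<phi>" for \<phi>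
    proof -
      have "(\<lambda>n. edge_form \<mu> (F (r n)) \<phi> - s * degree_form \<mu> (F (r n)) \<phi>) \<longlonglongrightarrow> 0"
        using LIMSEQ_subseq_LIMSEQ[OF lim[OF UNIV_I] r(1), of \<phi>] by (simp add: o_def)
      moreover have "(\<lambda>n. edge_form \<mu> (F (r n)) \<phi> - s * degree_form \<mu> (F (r n)) \<phi>)
          \<longlonglongrightarrow> edge_form \<mu> l \<phi> - s * degree_form \<mu> l \<phi>"
        by (intro tendsto_intros cont r(2))
      ultimately show ?thesis using LIMSEQ_unique by fastforce
    qed
    then have "l \<in> eigenspace ?T s" unfolding ev by simp
    moreover have "(\<lambda>n. F (r n) - l) \<longlonglongrightarrow> 0" using r(2) by (rule LIM_zero)
    then have "(\<lambda>n. degree_form \<mu> (F (r n) - l) (F (r n) - l)) \<longlonglongrightarrow> 0"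
      using cont(1) z by fastforce
    ultimately show "\<exists>r f. f \<in> eigenspace ?T s \<and> (\<lambda>n. degree_form \<mu> (F (r n) - f) (F (r n) - f)) \<longlonglongrightarrow> 0"
      by blast
  qed (auto simp: degree_form_def edge_form_def sum.distrib[symmetric] sum_distrib_left
      add_divide_distrib[symmetric] algebra_simps)
qed

section \<open>Continuously differentiable functions on an interval\<close>

text \<open>A nonzero polynomial has finitely many roots, whereas the interval is infinite.\<close>

lemma polynomial_coefficients_zero:
  fixes c :: "nat \<Rightarrow> real"
  assumes "0 < a" "\<And>x. \<lbrakk>0 < x; x < a\<rbrakk> \<Longrightarrow> (\<Sum>i<n. c i * x ^ i) = 0" "k < n"
  shows "c k = 0"
proof (rule ccontr)
  assume "c k \<noteq> 0"
  have "{0<..<a} \<subseteq> {x. (\<Sum>i\<le>n - 1. c i * x ^ i) = 0}"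
    using assms(2,3) by (auto simp: lessThan_Suc_atMost[symmetric])
  moreover have "\<exists>k\<le>n - 1. c k \<noteq> 0" using \<open>c k \<noteq> 0\<close> assms(3) by (intro exI[of _ k]) simp
  then have "finite {x. (\<Sum>i\<le>n - 1. c i * x ^ i) = 0}" by (rule polyfun_rootbound_finite)
  ultimately show False using assms(1) infinite_Ioo finite_subset by metis
qed

lemma uniform_limit_subseq:
  assumes "uniform_limit A f g sequentially" "strict_mono (r :: nat \<Rightarrow> nat)"
  shows "uniform_limit A (\<lambda>n. f (r n)) g sequentially"
  using assms eventually_subseq[OF assms(2)] unfolding uniform_limit_iff by blast

text \<open>Derivatives at 0 and \<open>l\<close> are one-sided, so boundary terms at the vertices
  make sense.\<close>

definition C1_on :: "real \<Rightarrow> (real \<Rightarrow> real) \<Rightarrow> (real \<Rightarrow> real) \<Rightarrow> bool"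
  where "C1_on l f g \<longleftrightarrow>
    continuous_on {0..l} g \<and> (\<forall>x\<in>{0..l}. (f has_real_derivative g x) (at x within {0..l}))"

lemma C1_onD:
  assumes "C1_on l f g"
  shows "continuous_on {0..l} g" "continuous_on {0..l} f"
    "x \<in> {0..l} \<Longrightarrow> (f has_real_derivative g x) (at x within {0..l})"
  using assms by (auto simp: C1_on_def intro: DERIV_continuous_on)

lemma C1_on_cong:
  assumes "\<And>x. x \<in> {0..l} \<Longrightarrow> f x = f' x" "\<And>x. x \<in> {0..l} \<Longrightarrow> g x = g' x"
  shows "C1_on l f g \<longleftrightarrow> C1_on l f' g'"
proof -
  have "continuous_on {0..l} g \<longleftrightarrow> continuous_on {0..l} g'"
    using assms(2) by (intro continuous_on_cong) auto
  moreover have "(f has_real_derivative g x) (at x within {0..l})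
      \<longleftrightarrow> (f' has_real_derivative g' x) (at x within {0..l})" if "x \<in> {0..l}" for x
    using assms that by (intro has_field_derivative_cong_ev) (auto intro!: always_eventually)
  ultimately show ?thesis by (auto simp: C1_on_def)
qed

lemma C1_on_add: "\<lbrakk>C1_on l f g; C1_on l f' g'\<rbrakk> \<Longrightarrow> C1_on l (\<lambda>x. f x + f' x) (\<lambda>x. g x + g' x)"
  by (auto simp: C1_on_def intro!: continuous_intros derivative_intros)

lemma C1_on_cmult: "C1_on l f g \<Longrightarrow> C1_on l (\<lambda>x. c * f x) (\<lambda>x. c * g x)"
  by (auto simp: C1_on_def intro!: continuous_intros derivative_eq_intros)

lemma C1_on_integral:
  assumes "continuous_on {0..l} g"
  shows "C1_on l (\<lambda>x. c + integral {0..x} g) g"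
  unfolding C1_on_def
  using assms integral_has_real_derivative[OF assms] by (auto intro!: derivative_eq_intros)

lemma C1_on_has_integral:
  assumes "C1_on l f g" "0 \<le> a" "a \<le> b" "b \<le> l"
  shows "(g has_integral f b - f a) {a..b}"
proof (rule fundamental_theorem_of_calculus[OF assms(3)])
  fix x assume "x \<in> {a..b}"
  then have "(f has_real_derivative g x) (at x within {a..b})"
    using C1_onD(3)[OF assms(1), of x] assms(2,4) by (auto intro: DERIV_subset)
  then show "(f has_vector_derivative g x) (at x within {a..b})"
    by (simp add: has_real_derivative_iff_has_vector_derivative)
qed

lemma C1_on_integral_eq:
  assumes "C1_on l f g" "0 \<le> a" "a \<le> b" "b \<le> l"
  shows "integral {a..b} g = f b - f a"
  using C1_on_has_integral[OF assms] by (rule integral_unique)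

lemma C1_on_mult:
  assumes "C1_on l f f'" "C1_on l g g'"
  shows "C1_on l (\<lambda>x. f x * g x) (\<lambda>x. f' x * g x + f x * g' x)"
  unfolding C1_on_def
proof (intro conjI ballI)
  fix x assume "x \<in> {0..l}"
  then show "((\<lambda>x. f x * g x) has_real_derivative f' x * g x + f x * g' x) (at x within {0..l})"
    using DERIV_mult[OF C1_onD(3)[OF assms(1)] C1_onD(3)[OF assms(2)]] by (simp add: mult.commute)
qed (intro continuous_intros C1_onD[OF assms(1)] C1_onD[OF assms(2)])

lemma integral_continuous_add:
  fixes f g :: "real \<Rightarrow> real"
  assumes "continuous_on {a..b} f" "continuous_on {a..b} g"
  shows "integral {a..b} (\<lambda>x. f x + g x) = integral {a..b} f + integral {a..b} g"
  by (intro integral_add integrable_continuous_real assms)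

lemma C1_on_by_parts:
  assumes "C1_on l f f'" "C1_on l g g'" "0 \<le> l"
  shows "integral {0..l} (\<lambda>x. f' x * g x) = f l * g l - f 0 * g 0 - integral {0..l} (\<lambda>x. f x * g' x)"
proof -
  have "integral {0..l} (\<lambda>x. f' x * g x + f x * g' x) = f l * g l - f 0 * g 0"
    using C1_on_integral_eq[OF C1_on_mult[OF assms(1,2)], of 0 l] assms(3) by simp
  moreover have "integral {0..l} (\<lambda>x. f' x * g x + f x * g' x)
      = integral {0..l} (\<lambda>x. f' x * g x) + integral {0..l} (\<lambda>x. f x * g' x)"
    using C1_onD[OF assms(1)] C1_onD[OF assms(2)]
    by (intro integral_continuous_add continuous_intros)
  ultimately show ?thesis by simp
qed

text \<open>Cauchy--Schwarz for the derivative against the constant 1 between \<open>y\<close> and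
  \<open>x\<close>, obtained from the integral of the square of \<open>g - c\<close>. This supplies
  the equicontinuity for Arzela--Ascoli.\<close>

lemma C1_on_Hoelder:
  assumes f: "C1_on l f g" and xy: "x \<in> {0..l}" "y \<in> {0..l}"
  shows "(f x - f y)\<^sup>2 \<le> integral {0..l} (\<lambda>t. (g t)\<^sup>2) * \<bar>x - y\<bar>"
proof -
  have *: "(f x - f y)\<^sup>2 \<le> integral {0..l} (\<lambda>t. (g t)\<^sup>2) * (x - y)" if "0 \<le> y" "y \<le> x" "x \<le> l" for x y
  proof -
    have g: "continuous_on {y..x} g"
      using C1_onD(1)[OF f] that by (auto intro: continuous_on_subset)
    have "(f x - f y)\<^sup>2 \<le> integral {y..x} (\<lambda>t. (g t)\<^sup>2) * (x - y)"
    proof (rule quadratic_nonneg_imp)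
      fix c
      have "0 \<le> integral {y..x} (\<lambda>t. (g t - c)\<^sup>2)" by (intro integral_nonneg integrable_continuous_real continuous_intros g) auto
      also have "\<dots> = integral {y..x} (\<lambda>t. (g t)\<^sup>2 + ((- 2 * c) * g t + c\<^sup>2))"
        by (simp add: power2_eq_square algebra_simps)
      also have "\<dots> = integral {y..x} (\<lambda>t. (g t)\<^sup>2) + ((- 2 * c) * integral {y..x} g + c\<^sup>2 * (x - y))"
        using that by (subst integral_continuous_add integral_mult_right; (intro continuous_intros g)?)+ (simp add: mult.commute)
      finally show "0 \<le> integral {y..x} (\<lambda>t. (g t)\<^sup>2) - 2 * c * (f x - f y) + c\<^sup>2 * (x - y)"
        using C1_on_integral_eq[OF f that] by simp
    qed (use that in simp)
    also have "integral {y..x} (\<lambda>t. (g t)\<^sup>2) \<le> integral {0..l} (\<lambda>t. (g t)\<^sup>2)"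
      using that C1_onD(1)[OF f] g
      by (intro integral_subset_le integrable_continuous_real continuous_intros) auto
    finally show ?thesis using that by (simp add: mult_right_mono)
  qed
  show ?thesis
  proof (cases "y \<le> x")
    case True then show ?thesis using *[of y x] xy by simp
  next
    case False then show ?thesis using *[of x y] xy by (simp add: power2_commute)
  qed
qed

text \<open>Compare \<open>f x\<close> with \<open>f y\<close> by the Hoelder estimate and average
  over \<open>y\<close>. This supplies the equiboundedness for Arzela--Ascoli.\<close>

lemma C1_on_sup_bound:
  assumes f: "C1_on l f g" and l: "0 < l" and x: "x \<in> {0..l}"
  shows "(f x)\<^sup>2 \<le> 2 / l * integral {0..l} (\<lambda>t. (f t)\<^sup>2) + 2 * l * integral {0..l} (\<lambda>t. (g t)\<^sup>2)"
proof -
  define K where "K = integral {0..l} (\<lambda>t. (g t)\<^sup>2)"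
  have K: "0 \<le> K" unfolding K_def
    using C1_onD[OF f] by (intro integral_nonneg integrable_continuous_real continuous_intros) auto
  have le: "(f x)\<^sup>2 \<le> 2 * (f y)\<^sup>2 + 2 * (K * l)" if "y \<in> {0..l}" for y
  proof -
    \<comment> \<open>The difference of the two sides is the square of
      \<open>f x - 2 * f y\<close>.\<close>
    have "(f x)\<^sup>2 \<le> 2 * (f y)\<^sup>2 + 2 * (f x - f y)\<^sup>2"
      using zero_le_power2[of "f x - 2 * f y"] by (simp add: power2_eq_square algebra_simps)
    moreover have "K * \<bar>x - y\<bar> \<le> K * l" using x that K by (intro mult_left_mono) auto
    ultimately show ?thesis using C1_on_Hoelder[OF f x that] unfolding K_def by linarith
  qed
  have "l * (f x)\<^sup>2 = integral {0..l} (\<lambda>y. (f x)\<^sup>2)" using l by simp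
  also have "\<dots> \<le> integral {0..l} (\<lambda>y. 2 * (f y)\<^sup>2 + 2 * (K * l))"
    using le C1_onD[OF f] by (intro integral_le integrable_continuous_real continuous_intros) auto
  also have "\<dots> = 2 * integral {0..l} (\<lambda>t. (f t)\<^sup>2) + 2 * (K * l) * l"
    using C1_onD[OF f] l by (subst integral_continuous_add) (auto intro!: continuous_intros)
  finally have "l * (f x)\<^sup>2 \<le> 2 * integral {0..l} (\<lambda>t. (f t)\<^sup>2) + 2 * (K * l) * l" .
  then show ?thesis using l unfolding K_def[symmetric] by (simp add: field_simps)
qed

section \<open>Forms on a metric graph\<close>

definition supported_on_edges :: "('v, 'e) metric_graph \<Rightarrow> ('e \<Rightarrow> real \<Rightarrow> real) \<Rightarrow> bool"
  where "supported_on_edges G f \<longleftrightarrow> (\<forall>e x. e \<notin> edges G \<or> x \<notin> {0..elen G e} \<longrightarrow> f e x = 0)"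

text \<open>A canonical derivative makes the energy a function of \<open>f\<close> alone; taking it
  within the closed edge covers the end points.\<close>

definition edge_deriv :: "('v, 'e) metric_graph \<Rightarrow> ('e \<Rightarrow> real \<Rightarrow> real) \<Rightarrow> 'e \<Rightarrow> real \<Rightarrow> real"
  where "edge_deriv G f e x = vector_derivative (f e) (at x within {0..elen G e})"

text \<open>The domain of the forms, a substitute for the Sobolev space of order one. No Kirchhoff
  condition is imposed: it is the natural boundary condition and follows from the weak
  equation.\<close>

definition C1_graph :: "('v, 'e) metric_graph \<Rightarrow> ('e \<Rightarrow> real \<Rightarrow> real) set"
  where "C1_graph G = {f. supported_on_edges G f \<and> continuous_at_vertices G f \<and>
    (\<forall>e\<in>edges G. \<exists>g. C1_on (elen G e) (f e) g)}"

definition graph_inner :: "('v, 'e) metric_graph \<Rightarrow> ('e \<Rightarrow> real \<Rightarrow> real) \<Rightarrow> ('e \<Rightarrow> real \<Rightarrow> real) \<Rightarrow> real"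
  where "graph_inner G f g = (\<Sum>e\<in>edges G. integral {0..elen G e} (\<lambda>x. f e x * g e x))"

definition graph_energy :: "('v, 'e) metric_graph \<Rightarrow> ('e \<Rightarrow> real \<Rightarrow> real) \<Rightarrow> ('e \<Rightarrow> real \<Rightarrow> real) \<Rightarrow> real"
  where "graph_energy G f g = graph_inner G (edge_deriv G f) (edge_deriv G g)"

lemma C1_graphD:
  assumes "f \<in> C1_graph G"
  shows "supported_on_edges G f" "continuous_at_vertices G f"
  using assms by (auto simp: C1_graph_def)

locale metric_graph =
  fixes G :: "('v, 'e) metric_graph"
  assumes G: "is_metric_graph G"
begin

abbreviation "E \<equiv> edges G"
abbreviation "l \<equiv> elen G"

lemma fin: "finite E" and nonempty: "E \<noteq> {}" and len: "e \<in> E \<Longrightarrow> 0 < l e"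
  using G by (auto simp: is_metric_graph_def)

lemma C1_on_unique:
  assumes "C1_on (l e) (f e) g" "e \<in> E" "x \<in> {0..l e}"
  shows "edge_deriv G f e x = g x"
  unfolding edge_deriv_def
  using C1_onD(3)[OF assms(1,3)] vector_derivative_within_closed_interval[OF len[OF assms(2)] assms(3)]
  by (simp add: has_real_derivative_iff_has_vector_derivative)

lemma C1_on_edge_deriv_if:
  assumes "C1_on (l e) (f e) g" "e \<in> E"
  shows "C1_on (l e) (f e) (edge_deriv G f e)"
proof -
  have "C1_on (l e) (f e) g \<longleftrightarrow> C1_on (l e) (f e) (edge_deriv G f e)"
    using C1_on_unique[of e f g] assms by (intro C1_on_cong) simp_all
  then show ?thesis using assms(1) by simp
qed

lemma C1_on_edge_deriv:
  assumes "f \<in> C1_graph G" "e \<in> E"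
  shows "C1_on (l e) (f e) (edge_deriv G f e)"
  using assms C1_on_edge_deriv_if by (auto simp: C1_graph_def)

lemma continuous_on_edge:
  assumes "f \<in> C1_graph G" "e \<in> E"
  shows "continuous_on {0..l e} (f e)" "continuous_on {0..l e} (edge_deriv G f e)"
  using C1_onD[OF C1_on_edge_deriv[OF assms]] by auto

lemma C1_graphI:
  assumes "supported_on_edges G f" "continuous_at_vertices G f"
    "\<And>e. e \<in> E \<Longrightarrow> C1_on (l e) (f e) (g e)"
  shows "f \<in> C1_graph G"
  using assms by (auto simp: C1_graph_def)

lemma continuous_at_vertices_add:
  assumes "continuous_at_vertices G f" "continuous_at_vertices G g"
  shows "continuous_at_vertices G (f + g)"
proof -
  obtain \<phi> \<psi> where "\<forall>e\<in>E. f e 0 = \<phi> (src G e) \<and> f e (l e) = \<phi> (tgt G e)"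
    "\<forall>e\<in>E. g e 0 = \<psi> (src G e) \<and> g e (l e) = \<psi> (tgt G e)"
    using assms by (auto simp: continuous_at_vertices_def)
  then show ?thesis
    unfolding continuous_at_vertices_def by (intro exI[of _ "\<lambda>v. \<phi> v + \<psi> v"]) simp
qed

lemma continuous_at_vertices_scale:
  assumes "continuous_at_vertices G f"
  shows "continuous_at_vertices G (c *\<^sub>R f)"
proof -
  obtain \<phi> where "\<forall>e\<in>E. f e 0 = \<phi> (src G e) \<and> f e (l e) = \<phi> (tgt G e)"
    using assms by (auto simp: continuous_at_vertices_def)
  then show ?thesis
    unfolding continuous_at_vertices_def
    by (intro exI[of _ "\<lambda>v. c * \<phi> v"]) (simp add: scaleR_fun_def)
qed

lemma edge_deriv_add:
  assumes "f \<in> C1_graph G" "g \<in> C1_graph G" "e \<in> E" "x \<in> {0..l e}"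
  shows "edge_deriv G (f + g) e x = edge_deriv G f e x + edge_deriv G g e x"
  using C1_on_unique[of e "f + g", OF _ assms(3,4)]
    C1_on_add[OF C1_on_edge_deriv[OF assms(1,3)] C1_on_edge_deriv[OF assms(2,3)]]
  by (simp add: plus_fun_def)

lemma edge_deriv_scale:
  assumes "f \<in> C1_graph G" "e \<in> E" "x \<in> {0..l e}"
  shows "edge_deriv G (c *\<^sub>R f) e x = c * edge_deriv G f e x"
  using C1_on_unique[of e "c *\<^sub>R f", OF _ assms(2,3)]
    C1_on_cmult[OF C1_on_edge_deriv[OF assms(1,2)], of c]
  by (simp add: scaleR_fun_def)

lemma subspace_C1_graph: "subspace (C1_graph G)"
  unfolding subspace_def
proof (intro conjI allI ballI)
  show "0 \<in> C1_graph G"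
    by (rule C1_graphI[where g = "\<lambda>_ _. 0"])
      (auto simp: supported_on_edges_def continuous_at_vertices_def C1_on_def func_zero)
next
  fix f g assume fg: "f \<in> C1_graph G" "g \<in> C1_graph G"
  show "f + g \<in> C1_graph G"
  proof (rule C1_graphI)
    show "supported_on_edges G (f + g)" using fg by (auto simp: C1_graph_def supported_on_edges_def)
    show "continuous_at_vertices G (f + g)"
      using fg by (auto simp: C1_graph_def intro: continuous_at_vertices_add)
    show "C1_on (l e) ((f + g) e) (\<lambda>x. edge_deriv G f e x + edge_deriv G g e x)" if "e \<in> E" for e
      using C1_on_add[OF C1_on_edge_deriv[OF fg(1) that] C1_on_edge_deriv[OF fg(2) that]]
      by (simp add: plus_fun_def)
  qed
next
  fix c f assume f: "f \<in> C1_graph G"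
  show "c *\<^sub>R f \<in> C1_graph G"
  proof (rule C1_graphI)
    show "supported_on_edges G (c *\<^sub>R f)"
      using f by (auto simp: C1_graph_def supported_on_edges_def scaleR_fun_def)
    show "continuous_at_vertices G (c *\<^sub>R f)"
      using f by (auto simp: C1_graph_def intro: continuous_at_vertices_scale)
    show "C1_on (l e) ((c *\<^sub>R f) e) (\<lambda>x. c * edge_deriv G f e x)" if "e \<in> E" for e
      using C1_on_cmult[OF C1_on_edge_deriv[OF f that], of c] by (simp add: scaleR_fun_def)
  qed
qed

section \<open>Inner product and energy as positive semidefinite forms\<close>

lemma graph_inner_cong:
  assumes "\<And>e x. \<lbrakk>e \<in> E; x \<in> {0..l e}\<rbrakk> \<Longrightarrow> f e x = f' e x"
    "\<And>e x. \<lbrakk>e \<in> E; x \<in> {0..l e}\<rbrakk> \<Longrightarrow> g e x = g' e x"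
  shows "graph_inner G f g = graph_inner G f' g'"
  unfolding graph_inner_def
  by (intro sum.cong refl integral_cong) (simp add: assms)

lemma graph_inner_add:
  assumes "\<And>e. e \<in> E \<Longrightarrow> continuous_on {0..l e} (f e)" "\<And>e. e \<in> E \<Longrightarrow> continuous_on {0..l e} (f' e)"
    "\<And>e. e \<in> E \<Longrightarrow> continuous_on {0..l e} (g e)"
  shows "graph_inner G (\<lambda>e x. f e x + f' e x) g = graph_inner G f g + graph_inner G f' g"
  unfolding graph_inner_def sum.distrib[symmetric]
proof (rule sum.cong[OF refl])
  fix e assume e: "e \<in> E"
  show "integral {0..l e} (\<lambda>x. (f e x + f' e x) * g e x)
      = integral {0..l e} (\<lambda>x. f e x * g e x) + integral {0..l e} (\<lambda>x. f' e x * g e x)"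
    unfolding distrib_right by (intro integral_continuous_add continuous_on_mult assms e)
qed

lemma graph_inner_scale: "graph_inner G (\<lambda>e x. c * f e x) g = c * graph_inner G f g"
  by (simp add: graph_inner_def sum_distrib_left mult.assoc)

lemma graph_inner_commute: "graph_inner G f g = graph_inner G g f"
  by (simp add: graph_inner_def mult.commute)

lemma graph_inner_nonneg:
  assumes "\<And>e. e \<in> E \<Longrightarrow> continuous_on {0..l e} (f e)"
  shows "0 \<le> graph_inner G f f"
  unfolding graph_inner_def
  by (intro sum_nonneg integral_nonneg integrable_continuous_real continuous_on_mult assms) auto

text \<open>By the support condition a nonzero function is nonzero at some point of a closed edge,
  and continuity makes the integral over that edge positive.\<close>

lemma graph_inner_pos:
  assumes "f \<in> C1_graph G" "f \<noteq> 0"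
  shows "0 < graph_inner G f f"
proof -
  obtain e x where ex: "f e x \<noteq> 0" using assms(2) by (auto simp: fun_eq_iff)
  then have e: "e \<in> E" and x: "x \<in> {0..l e}"
    using assms(1) by (auto simp: C1_graph_def supported_on_edges_def)
  have c: "continuous_on {0..l e} (\<lambda>x. f e x * f e x)" if "e \<in> E" for e
    by (intro continuous_on_mult continuous_on_edge assms that)
  have nn: "0 \<le> integral {0..l e} (\<lambda>x. f e x * f e x)" if "e \<in> E" for e
    by (intro integral_nonneg integrable_continuous_real c that) auto
  have "integral {0..l e} (\<lambda>x. f e x * f e x) \<noteq> 0"
    using integral_eq_0_iff[OF c[OF e] len[OF e]] x ex by auto
  then have "0 < integral {0..l e} (\<lambda>x. f e x * f e x)" using nn[OF e] by simp
  also have "\<dots> \<le> graph_inner G f f"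
    unfolding graph_inner_def by (rule member_le_sum[OF e]) (use nn fin in auto)
  finally show ?thesis .
qed

sublocale inner: psd_form "C1_graph G" "graph_inner G"
proof
  show "subspace (C1_graph G)" by (rule subspace_C1_graph)
next
  fix f g h assume "f \<in> C1_graph G" "g \<in> C1_graph G" "h \<in> C1_graph G"
  then show "graph_inner G (f + g) h = graph_inner G f h + graph_inner G g h"
    using graph_inner_add[of f g h] continuous_on_edge(1) by (simp add: plus_fun_def)
next
  fix f h c
  show "graph_inner G (c *\<^sub>R f) h = c * graph_inner G f h"
    using graph_inner_scale[of c f h] by (simp add: scaleR_fun_def)
qed (auto simp: graph_inner_commute intro: graph_inner_nonneg continuous_on_edge)

sublocale energy: psd_form "C1_graph G" "graph_energy G"
proof
  show "subspace (C1_graph G)" by (rule subspace_C1_graph)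
next
  fix f g h assume fgh: "f \<in> C1_graph G" "g \<in> C1_graph G" "h \<in> C1_graph G"
  have "graph_energy G (f + g) h
      = graph_inner G (\<lambda>e x. edge_deriv G f e x + edge_deriv G g e x) (edge_deriv G h)"
    unfolding graph_energy_def by (rule graph_inner_cong) (simp_all add: edge_deriv_add[OF fgh(1,2)])
  then show "graph_energy G (f + g) h = graph_energy G f h + graph_energy G g h"
    unfolding graph_energy_def by (simp add: graph_inner_add continuous_on_edge fgh)
next
  fix f h c assume f: "f \<in> C1_graph G"
  have "graph_energy G (c *\<^sub>R f) h = graph_inner G (\<lambda>e x. c * edge_deriv G f e x) (edge_deriv G h)"
    unfolding graph_energy_def by (rule graph_inner_cong) (simp_all add: edge_deriv_scale[OF f])
  then show "graph_energy G (c *\<^sub>R f) h = c * graph_energy G f h"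
    unfolding graph_energy_def by (simp add: graph_inner_scale)
qed (auto simp: graph_energy_def graph_inner_commute intro: graph_inner_nonneg continuous_on_edge)

section \<open>Eigenfunctions\<close>

text \<open>The classical form of the eigenvalue equation: the second derivative equals the
  continuous function \<open>- s * f\<close>, so no almost-everywhere statement is left.\<close>

definition eigenfunction :: "real \<Rightarrow> ('e \<Rightarrow> real \<Rightarrow> real) \<Rightarrow> bool"
  where "eigenfunction s f \<longleftrightarrow> supported_on_edges G f \<and> continuous_at_vertices G f \<and>
    (\<exists>g. (\<forall>e\<in>E. C1_on (l e) (f e) (g e) \<and> C1_on (l e) (g e) (\<lambda>x. - s * f e x)) \<and> kirchhoff G g)"

text \<open>Boundary terms of an integration by parts, regrouped from edges to vertices; the inner
  bracket is the Kirchhoff sum.\<close>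

lemma sum_vertices:
  fixes a b :: "'e \<Rightarrow> real" and \<phi> :: "'v \<Rightarrow> real"
  shows
  "(\<Sum>e\<in>E. b e * \<phi> (tgt G e) - a e * \<phi> (src G e))
    = - (\<Sum>v\<in>vertices G. \<phi> v * ((\<Sum>e | e \<in> E \<and> src G e = v. a e) + (\<Sum>e | e \<in> E \<and> tgt G e = v. - b e)))"
proof -
  have fv: "finite (vertices G)" using fin by (simp add: vertices_def)
  have "(\<Sum>v\<in>vertices G. \<Sum>e\<in>{e\<in>E. src G e = v}. a e * \<phi> (src G e)) = (\<Sum>e\<in>E. a e * \<phi> (src G e))"
    by (rule sum.group[OF fin fv]) (auto simp: vertices_def)
  moreover have "(\<Sum>v\<in>vertices G. \<Sum>e\<in>{e\<in>E. tgt G e = v}. b e * \<phi> (tgt G e)) = (\<Sum>e\<in>E. b e * \<phi> (tgt G e))"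
    by (rule sum.group[OF fin fv]) (auto simp: vertices_def)
  moreover have "(\<Sum>e\<in>{e\<in>E. src G e = v}. a e * \<phi> (src G e)) = \<phi> v * (\<Sum>e | e \<in> E \<and> src G e = v. a e)"
    "(\<Sum>e\<in>{e\<in>E. tgt G e = v}. b e * \<phi> (tgt G e)) = \<phi> v * (\<Sum>e | e \<in> E \<and> tgt G e = v. b e)" for v
    by (simp_all add: sum_distrib_left mult.commute)
  ultimately show ?thesis
    by (simp add: sum_subtractf sum_negf right_diff_distrib)
qed

lemma eigenfunction_C1: "eigenfunction s f \<Longrightarrow> f \<in> C1_graph G"
  by (auto simp: eigenfunction_def C1_graph_def)

text \<open>After integration by parts the boundary terms collect at the vertices, where \<phi> has
  a single value and the Kirchhoff sums vanish.\<close>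

lemma eigenfunction_weak:
  assumes f: "eigenfunction s f" and \<phi>: "\<phi> \<in> C1_graph G"
  shows "graph_energy G f \<phi> = s * graph_inner G f \<phi>"
proof -
  obtain g where g: "\<And>e. e \<in> E \<Longrightarrow> C1_on (l e) (f e) (g e)"
      "\<And>e. e \<in> E \<Longrightarrow> C1_on (l e) (g e) (\<lambda>x. - s * f e x)" "kirchhoff G g"
    using f by (auto simp: eigenfunction_def)
  obtain \<psi> where \<psi>: "\<And>e. e \<in> E \<Longrightarrow> \<phi> e 0 = \<psi> (src G e) \<and> \<phi> e (l e) = \<psi> (tgt G e)"
    using C1_graphD(2)[OF \<phi>] by (auto simp: continuous_at_vertices_def)
  have "graph_energy G f \<phi> = graph_inner G g (edge_deriv G \<phi>)"
    unfolding graph_energy_def by (rule graph_inner_cong) (simp_all add: C1_on_unique[OF g(1)])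
  also have "\<dots> = (\<Sum>e\<in>E. (g e (l e) * \<psi> (tgt G e) - g e 0 * \<psi> (src G e))
      + s * integral {0..l e} (\<lambda>x. f e x * \<phi> e x))"
    unfolding graph_inner_def
  proof (rule sum.cong[OF refl])
    fix e assume e: "e \<in> E"
    have "integral {0..l e} (\<lambda>x. - s * f e x * \<phi> e x)
        = g e (l e) * \<phi> e (l e) - g e 0 * \<phi> e 0 - integral {0..l e} (\<lambda>x. g e x * edge_deriv G \<phi> e x)"
      by (rule C1_on_by_parts[OF g(2)[OF e] C1_on_edge_deriv[OF \<phi> e]]) (use len[OF e] in simp)
    moreover have "integral {0..l e} (\<lambda>x. - s * f e x * \<phi> e x) = - s * integral {0..l e} (\<lambda>x. f e x * \<phi> e x)"
      unfolding mult.assoc by (rule integral_mult_right)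
    ultimately show "integral {0..l e} (\<lambda>x. g e x * edge_deriv G \<phi> e x)
        = (g e (l e) * \<psi> (tgt G e) - g e 0 * \<psi> (src G e)) + s * integral {0..l e} (\<lambda>x. f e x * \<phi> e x)"
      using \<psi>[OF e] by simp
  qed
  also have "\<dots> = s * graph_inner G f \<phi>"
    using g(3) sum_vertices[of "\<lambda>e. g e (l e)" \<psi> "\<lambda>e. g e 0"] unfolding kirchhoff_def
    by (simp add: sum.distrib graph_inner_def sum_distrib_left)
  finally show ?thesis .
qed

text \<open>Two integrations by parts move all derivatives of a weak eigenfunction to the test
  function; the resulting condition is stable under uniform convergence.\<close>

definition very_weak :: "real \<Rightarrow> ('e \<Rightarrow> real \<Rightarrow> real) \<Rightarrow> bool"
  where "very_weak s f \<longleftrightarrow> (\<forall>\<phi> \<phi>' \<phi>''. \<phi> \<in> C1_graph G \<and>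
    (\<forall>e\<in>E. C1_on (l e) (\<phi> e) (\<phi>' e) \<and> C1_on (l e) (\<phi>' e) (\<phi>'' e)) \<longrightarrow>
    (\<Sum>e\<in>E. f e (l e) * \<phi>' e (l e) - f e 0 * \<phi>' e 0 - integral {0..l e} (\<lambda>x. f e x * \<phi>'' e x))
      = s * graph_inner G f \<phi>)"

lemma graph_energy_by_parts:
  assumes f: "f \<in> C1_graph G"
    and \<phi>: "\<And>e. e \<in> E \<Longrightarrow> C1_on (l e) (\<phi> e) (\<phi>' e)" "\<And>e. e \<in> E \<Longrightarrow> C1_on (l e) (\<phi>' e) (\<phi>'' e)"
  shows "graph_energy G f \<phi>
    = (\<Sum>e\<in>E. f e (l e) * \<phi>' e (l e) - f e 0 * \<phi>' e 0 - integral {0..l e} (\<lambda>x. f e x * \<phi>'' e x))"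
proof -
  have "graph_energy G f \<phi> = graph_inner G (edge_deriv G f) \<phi>'"
    unfolding graph_energy_def by (rule graph_inner_cong) (simp_all add: C1_on_unique[OF \<phi>(1)])
  also have "\<dots> = (\<Sum>e\<in>E. f e (l e) * \<phi>' e (l e) - f e 0 * \<phi>' e 0 - integral {0..l e} (\<lambda>x. f e x * \<phi>'' e x))"
    unfolding graph_inner_def
    by (intro sum.cong refl C1_on_by_parts C1_on_edge_deriv f \<phi>(2)) (use len in \<open>auto intro: less_imp_le\<close>)
  finally show ?thesis .
qed

text \<open>Extension by zero, which turns functions given on the closed edges into the normalised
  representatives.\<close>

definition on_edges :: "('e \<Rightarrow> real \<Rightarrow> real) \<Rightarrow> 'e \<Rightarrow> real \<Rightarrow> real"
  where "on_edges f e x = (if e \<in> E \<and> x \<in> {0..l e} then f e x else 0)"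

lemma supported_on_edges: "supported_on_edges G (on_edges f)"
  by (auto simp: supported_on_edges_def on_edges_def)

lemma C1_on_on_edges: "e \<in> E \<Longrightarrow> C1_on (l e) (on_edges f e) g \<longleftrightarrow> C1_on (l e) (f e) g"
  by (intro C1_on_cong) (auto simp: on_edges_def)

lemma on_edges_end: "e \<in> E \<Longrightarrow> on_edges f e 0 = f e 0" "e \<in> E \<Longrightarrow> on_edges f e (l e) = f e (l e)"
  using len[of e] by (auto simp: on_edges_def)

text \<open>On an edge let \<open>w\<close> solve \<open>w'' = - s f\<close> with the boundary values of \<open>f\<close>. Testing with the
  function that has second derivative \<open>f - w\<close> and vanishes at both ends gives \<open>f = w\<close>.\<close>

lemma very_weak_edge:
  assumes cont: "\<And>e. e \<in> E \<Longrightarrow> continuous_on {0..l e} (f e)" and vw: "very_weak s f" and e: "e \<in> E"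
  shows "\<exists>g. C1_on (l e) (f e) g \<and> C1_on (l e) g (\<lambda>x. - s * f e x)"
proof -
  define L where "L = l e"
  have L: "0 < L" using len[OF e] by (simp add: L_def)
  have f: "continuous_on {0..L} (f e)" using cont[OF e] by (simp add: L_def)
  define h where "h x = integral {0..x} (f e)" for x
  have h: "C1_on L h (f e)" using C1_on_integral[OF f, of 0] by (simp add: h_def[abs_def])
  define H where "H x = integral {0..x} h" for x
  have H: "C1_on L H h" using C1_on_integral[OF C1_onD(2)[OF h], of 0] by (simp add: H_def[abs_def])
  \<comment> \<open>Chosen so that \<open>w\<close> takes the value \<open>f e L\<close> at
    \<open>L\<close>.\<close>
  define c where "c = (f e L - f e 0 + s * H L) / L"
  define w where "w x = f e 0 + c * x + (- s) * H x" for x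
  define w' where "w' x = c + (- s) * h x" for x
  have affine: "C1_on L (\<lambda>x. a + b * x) (\<lambda>x. b)" "C1_on L (\<lambda>x. b) (\<lambda>x. 0)" for a b
    by (auto simp: C1_on_def intro!: derivative_eq_intros)
  have w: "C1_on L w w'" unfolding w_def[abs_def] w'_def[abs_def] by (intro C1_on_add affine C1_on_cmult H)
  have w': "C1_on L w' (\<lambda>x. - s * f e x)"
    using C1_on_add[OF affine(2) C1_on_cmult[OF h, of "- s"]] by (simp add: w'_def[abs_def])
  have w0: "w 0 = f e 0" by (simp add: w_def H_def)
  have wL: "w L = f e L" using L by (simp add: w_def c_def)
  define d where "d x = f e x - w x" for x
  have d: "continuous_on {0..L} d" unfolding d_def[abs_def] by (intro continuous_intros f C1_onD(2)[OF w])
  define A where "A x = integral {0..x} d" for x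
  have A: "C1_on L A d" using C1_on_integral[OF d, of 0] by (simp add: A_def[abs_def])
  define B where "B x = integral {0..x} A" for x
  have B: "C1_on L B A" using C1_on_integral[OF C1_onD(2)[OF A], of 0] by (simp add: B_def[abs_def])
  \<comment> \<open>A linear correction of the double antiderivative \<open>B\<close> of
    \<open>d\<close>: the second derivative stays \<open>d\<close>, and \<phi> now vanishes at both
    ends.\<close>
  define k where "k = - B L / L"
  define \<phi> where "\<phi> x = B x + (0 + k * x)" for x
  define \<phi>' where "\<phi>' x = A x + k" for x
  have \<phi>: "C1_on L \<phi> \<phi>'" unfolding \<phi>_def[abs_def] \<phi>'_def[abs_def] by (intro C1_on_add affine B)
  have \<phi>': "C1_on L \<phi>' d" using C1_on_add[OF A affine(2)[of k]] by (simp add: \<phi>'_def[abs_def])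
  have \<phi>0: "\<phi> 0 = 0" "\<phi> L = 0" using L by (auto simp: \<phi>_def B_def k_def)
  define \<Phi> where "\<Phi> = on_edges (\<lambda>e'. if e' = e then \<phi> else (\<lambda>_. 0))"
  define \<Phi>' where "\<Phi>' e' = (if e' = e then \<phi>' else (\<lambda>_. 0))" for e'
  define \<Phi>'' where "\<Phi>'' e' = (if e' = e then d else (\<lambda>_. 0))" for e'
  have z: "C1_on a (\<lambda>_. 0) (\<lambda>_. 0)" for a by (simp add: C1_on_def)
  have \<Phi>: "C1_on (l e') (\<Phi> e') (\<Phi>' e')" "C1_on (l e') (\<Phi>' e') (\<Phi>'' e')" if "e' \<in> E" for e'
    using \<phi> \<phi>' z by (auto simp: \<Phi>_def C1_on_on_edges[OF that] \<Phi>'_def \<Phi>''_def L_def)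
  \<comment> \<open>As \<phi> vanishes at both ends of \<open>e\<close>, extending it by zero to the
    other edges is continuous.\<close>
  have "continuous_at_vertices G \<Phi>"
    using \<phi>0 by (auto simp: continuous_at_vertices_def \<Phi>_def on_edges_end L_def intro!: exI[of _ "\<lambda>_. 0"])
  then have "\<Phi> \<in> C1_graph G"
    using C1_graphI[OF _ _ \<Phi>(1)] supported_on_edges by (simp add: \<Phi>_def)
  then have "(\<Sum>e'\<in>E. f e' (l e') * \<Phi>' e' (l e') - f e' 0 * \<Phi>' e' 0 - integral {0..l e'} (\<lambda>x. f e' x * \<Phi>'' e' x))
      = s * graph_inner G f \<Phi>"
    using vw \<Phi> unfolding very_weak_def by blast
  also have "(\<Sum>e'\<in>E. f e' (l e') * \<Phi>' e' (l e') - f e' 0 * \<Phi>' e' 0 - integral {0..l e'} (\<lambda>x. f e' x * \<Phi>'' e' x))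
      = (\<Sum>e'\<in>E. if e' = e then f e L * \<phi>' L - f e 0 * \<phi>' 0 - integral {0..L} (\<lambda>x. f e x * d x) else 0)"
    by (rule sum.cong) (auto simp: \<Phi>'_def \<Phi>''_def L_def)
  also have "\<dots> = f e L * \<phi>' L - f e 0 * \<phi>' 0 - integral {0..L} (\<lambda>x. f e x * d x)"
    using e fin by simp
  also have "graph_inner G f \<Phi> = (\<Sum>e'\<in>E. if e' = e then integral {0..L} (\<lambda>x. f e x * \<phi> x) else 0)"
    unfolding graph_inner_def
  proof (rule sum.cong[OF refl])
    fix e' assume "e' \<in> E"
    then have "integral {0..l e'} (\<lambda>x. f e' x * \<Phi> e' x)
        = integral {0..l e'} (\<lambda>x. f e' x * (if e' = e then \<phi> x else 0))"
      by (intro integral_cong) (auto simp: \<Phi>_def on_edges_def)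
    then show "integral {0..l e'} (\<lambda>x. f e' x * \<Phi> e' x)
        = (if e' = e then integral {0..L} (\<lambda>x. f e x * \<phi> x) else 0)"
      by (auto simp: L_def)
  qed
  also have "\<dots> = integral {0..L} (\<lambda>x. f e x * \<phi> x)"
    using e fin by simp
  finally have test: "f e L * \<phi>' L - f e 0 * \<phi>' 0 - integral {0..L} (\<lambda>x. f e x * d x)
      = s * integral {0..L} (\<lambda>x. f e x * \<phi> x)" .
  \<comment> \<open>Two integrations by parts show that \<open>w\<close> satisfies the tested
    identity of \<open>f\<close>. The boundary values agree, so subtracting leaves that the integral
    of \<open>(f - w) d\<close>, the square of \<open>d\<close>, is 0.\<close>
  have "integral {0..L} (\<lambda>x. - s * f e x * \<phi> x) = - integral {0..L} (\<lambda>x. w' x * \<phi>' x)"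
    using C1_on_by_parts[OF w' \<phi>] L \<phi>0 by simp
  moreover have "integral {0..L} (\<lambda>x. - s * f e x * \<phi> x) = - s * integral {0..L} (\<lambda>x. f e x * \<phi> x)"
    unfolding mult.assoc by (rule integral_mult_right)
  moreover have "integral {0..L} (\<lambda>x. w' x * \<phi>' x) = f e L * \<phi>' L - f e 0 * \<phi>' 0 - integral {0..L} (\<lambda>x. w x * d x)"
    using C1_on_by_parts[OF w \<phi>'] L w0 wL by simp
  ultimately have "integral {0..L} (\<lambda>x. f e x * d x) = integral {0..L} (\<lambda>x. w x * d x)"
    using test by simp
  moreover have "integral {0..L} (\<lambda>x. d x * d x) = integral {0..L} (\<lambda>x. f e x * d x) - integral {0..L} (\<lambda>x. w x * d x)"
    unfolding d_def[of "_ :: real"] left_diff_distrib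
    by (intro integral_diff integrable_continuous_real continuous_intros f C1_onD(2)[OF w])
  ultimately have "integral {0..L} (\<lambda>x. d x * d x) = 0" by simp
  moreover have "continuous_on {0..L} (\<lambda>x. d x * d x)" by (intro continuous_intros d)
  ultimately have "\<forall>x\<in>{0..L}. d x * d x = 0"
    using integral_eq_0_iff[of 0 L "\<lambda>x. d x * d x"] L by simp
  then have "w x = f e x" if "x \<in> {0..L}" for x using that by (auto simp: d_def)
  then have "C1_on L (f e) w'" using w C1_on_cong[of L w "f e" w' w'] by simp
  then show ?thesis using w' unfolding L_def by blast
qed

text \<open>The equation on each edge is \<open>very_weak_edge\<close>; the Kirchhoff condition at a
  vertex comes from testing with the edgewise affine hat function of that vertex.\<close>

lemma eigenfunction_if_very_weak:
  assumes f: "supported_on_edges G f" "continuous_at_vertices G f"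
    and cont: "\<And>e. e \<in> E \<Longrightarrow> continuous_on {0..l e} (f e)" and vw: "very_weak s f"
  shows "eigenfunction s f"
proof -
  obtain g where g: "\<And>e. e \<in> E \<Longrightarrow> C1_on (l e) (f e) (g e)"
      "\<And>e. e \<in> E \<Longrightarrow> C1_on (l e) (g e) (\<lambda>x. - s * f e x)"
    using very_weak_edge[OF cont vw] by metis
  have "kirchhoff G g"
    unfolding kirchhoff_def
  proof
    fix u assume u: "u \<in> vertices G"
    \<comment> \<open>Vertex values of the hat function at \<open>u\<close>; \<open>k\<close> is its
      slope along an edge.\<close>
    define \<psi> where "\<psi> v = (if v = u then 1 else (0::real))" for v
    define k where "k e = (\<psi> (tgt G e) - \<psi> (src G e)) / l e" for e
    define \<phi> where "\<phi> e x = \<psi> (src G e) + k e * x" for e x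
    define \<Phi> where "\<Phi> = on_edges \<phi>"
    have \<phi>: "C1_on (l e) (\<phi> e) (\<lambda>_. k e)" for e
      unfolding \<phi>_def by (auto simp: C1_on_def intro!: derivative_eq_intros)
    have k': "C1_on (l e) (\<lambda>_. k e) (\<lambda>_. 0)" for e by (auto simp: C1_on_def)
    have \<Phi>: "C1_on (l e) (\<Phi> e) (\<lambda>_. k e)" if "e \<in> E" for e
      using \<phi> by (simp add: \<Phi>_def C1_on_on_edges that)
    have end_: "\<phi> e 0 = \<psi> (src G e)" "\<phi> e (l e) = \<psi> (tgt G e)" if "e \<in> E" for e
      using len[OF that] by (auto simp: \<phi>_def k_def)
    then have "continuous_at_vertices G \<Phi>"
      by (auto simp: continuous_at_vertices_def \<Phi>_def on_edges_end intro!: exI[of _ \<psi>])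
    then have "\<Phi> \<in> C1_graph G"
      using C1_graphI[OF _ _ \<Phi>] supported_on_edges by (simp add: \<Phi>_def)
    then have "(\<Sum>e\<in>E. f e (l e) * k e - f e 0 * k e) = s * graph_inner G f \<Phi>"
      using vw \<Phi> k' unfolding very_weak_def by (elim allE[of _ \<Phi>] allE[of _ "\<lambda>e _. k e"] allE[of _ "\<lambda>_ _. 0"]) auto
    also have "graph_inner G f \<Phi> = graph_inner G f \<phi>"
      by (rule graph_inner_cong) (simp_all add: \<Phi>_def on_edges_def)
    \<comment> \<open>Integration by parts with the classical derivative \<open>g\<close> reproduces
      the boundary terms of \<open>f\<close> and adds those of \<open>g\<close>, which must
      therefore sum to zero.\<close>
    also have "s * graph_inner G f \<phi> = (\<Sum>e\<in>E. (f e (l e) * k e - f e 0 * k e)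
        - (g e (l e) * \<psi> (tgt G e) - g e 0 * \<psi> (src G e)))"
      unfolding graph_inner_def sum_distrib_left
    proof (rule sum.cong[OF refl])
      fix e assume e: "e \<in> E"
      have "integral {0..l e} (\<lambda>x. - s * f e x * \<phi> e x)
          = g e (l e) * \<psi> (tgt G e) - g e 0 * \<psi> (src G e) - integral {0..l e} (\<lambda>x. g e x * k e)"
        using C1_on_by_parts[OF g(2)[OF e] \<phi>] len[OF e] end_[OF e] by simp
      moreover have "integral {0..l e} (\<lambda>x. g e x * k e) = f e (l e) * k e - f e 0 * k e"
        using C1_on_by_parts[OF g(1)[OF e] k'] len[OF e] by simp
      moreover have "integral {0..l e} (\<lambda>x. - s * f e x * \<phi> e x) = - s * integral {0..l e} (\<lambda>x. f e x * \<phi> e x)"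
        unfolding mult.assoc by (rule integral_mult_right)
      ultimately show "s * integral {0..l e} (\<lambda>x. f e x * \<phi> e x) = (f e (l e) * k e - f e 0 * k e)
          - (g e (l e) * \<psi> (tgt G e) - g e 0 * \<psi> (src G e))" by simp
    qed
    finally have "(\<Sum>e\<in>E. g e (l e) * \<psi> (tgt G e) - g e 0 * \<psi> (src G e)) = 0"
      by (simp add: sum_subtractf)
    then have "(\<Sum>v\<in>vertices G. \<psi> v * ((\<Sum>e | e \<in> E \<and> src G e = v. g e 0) + (\<Sum>e | e \<in> E \<and> tgt G e = v. - g e (l e)))) = 0"
      using sum_vertices[of "\<lambda>e. g e (l e)" \<psi> "\<lambda>e. g e 0"] by simp
    moreover have "finite (vertices G)" using fin by (simp add: vertices_def)
    ultimately show "(\<Sum>e | e \<in> E \<and> src G e = u. g e 0) + (\<Sum>e | e \<in> E \<and> tgt G e = u. - g e (l e)) = 0"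
      using u by (simp add: \<psi>_def if_distrib[of "\<lambda>x. x * _"] cong: if_cong)
  qed
  then show ?thesis using f g by (auto simp: eigenfunction_def)
qed

lemma eigenfunction_iff_weak:
  "eigenfunction s f \<longleftrightarrow> f \<in> C1_graph G \<and> (\<forall>\<phi>\<in>C1_graph G. graph_energy G f \<phi> = s * graph_inner G f \<phi>)"
proof safe
  assume f: "f \<in> C1_graph G" and weak: "\<forall>\<phi>\<in>C1_graph G. graph_energy G f \<phi> = s * graph_inner G f \<phi>"
  show "eigenfunction s f"
  proof (rule eigenfunction_if_very_weak)
    show "very_weak s f"
      unfolding very_weak_def
    proof (intro allI impI, elim conjE)
      fix \<phi> \<phi>' \<phi>'' assume \<phi>: "\<phi> \<in> C1_graph G"
        and "\<forall>e\<in>E. C1_on (l e) (\<phi> e) (\<phi>' e) \<and> C1_on (l e) (\<phi>' e) (\<phi>'' e)"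
      then show "(\<Sum>e\<in>E. f e (l e) * \<phi>' e (l e) - f e 0 * \<phi>' e 0 - integral {0..l e} (\<lambda>x. f e x * \<phi>'' e x))
          = s * graph_inner G f \<phi>"
        using graph_energy_by_parts[OF f, of \<phi> \<phi>' \<phi>''] weak by auto
    qed
  qed (use f C1_graphD continuous_on_edge in auto)
qed (auto intro: eigenfunction_C1 eigenfunction_weak)

end

section \<open>The standard Laplacian\<close>

text \<open>On a bounded interval the bound of an absolute value by 1 plus the square gives
  integrability.\<close>

lemma square_integrable_imp_set_integrable:
  assumes "square_integrable l h"
  shows "set_integrable lborel {0..l} h"
proof (cases "0 < l")
  case True
  have "set_integrable lborel {0<..<l} (\<lambda>x. 1 + (h x)\<^sup>2)"
    using assms True unfolding square_integrable_def
    by (intro set_integral_add) (auto simp: set_integrable_def)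
  then have int: "set_integrable lborel {0<..<l} h"
  proof (rule set_integrable_bound)
    show "set_borel_measurable lborel {0<..<l} h" using assms by (simp add: square_integrable_def)
    have "\<bar>y\<bar> \<le> 1 + y\<^sup>2" for y :: real
      using zero_le_power2[of "\<bar>y\<bar> - 1/2"] by (simp add: power2_eq_square algebra_simps)
    then have "norm (h x) \<le> norm (1 + (h x)\<^sup>2)" for x by (simp add: order_trans[OF _ abs_ge_self])
    then show "AE x in lborel. x \<in> {0<..<l} \<longrightarrow> norm (h x) \<le> norm (1 + (h x)\<^sup>2)" by simp
  qed
  \<comment> \<open>Square integrability speaks about the open interval only, so the two end points
    are added by hand.\<close>
  have "integrable lborel (\<lambda>t. indicator {0<..<l} t *\<^sub>R h t + indicator {0} t *\<^sub>R h 0 + indicator {l} t *\<^sub>R h l)"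
    by (intro Bochner_Integration.integrable_add integrable_real_indicator integrable_scaleR_left)
      (use int in \<open>auto simp: set_integrable_def\<close>)
  also have "(\<lambda>t. indicator {0<..<l} t *\<^sub>R h t + indicator {0} t *\<^sub>R h 0 + indicator {l} t *\<^sub>R h l)
      = (\<lambda>t. indicator {0..l} t *\<^sub>R h t)"
    using True by (auto simp: fun_eq_iff indicator_def)
  finally show ?thesis by (simp add: set_integrable_def)
next
  \<comment> \<open>Here the closed interval is empty or the single point 0, where \<open>h\<close>
    may be replaced by the constant \<open>h 0\<close>.\<close>
  case False
  have "integrable lborel (\<lambda>t. indicator {0..l} t *\<^sub>R h 0)"
    by (intro integrable_scaleR_left integrable_real_indicator) (use False in \<open>auto simp: emeasure_lborel_Icc_eq\<close>)
  also have "(\<lambda>t. indicator {0..l} t *\<^sub>R h 0) = (\<lambda>t. indicator {0..l} t *\<^sub>R h t)"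
  proof -
    have "x = 0" if "x \<in> {0..l}" for x using that False by simp
    then show ?thesis by (force simp: fun_eq_iff indicator_def)
  qed
  finally show ?thesis by (simp add: set_integrable_def)
qed

text \<open>Bridge from the Lebesgue integral of the definitions to the gauge integral used for
  calculus.\<close>

lemma LINT_eq_integral:
  assumes "set_integrable lborel {0..l} h" "x \<in> {0..l}"
  shows "(LINT t:{0..x}|lborel. h t) = integral {0..x} (h :: real \<Rightarrow> real)"
  using assms set_integrable_subset[OF assms(1), of "{0..x}"] set_borel_integral_eq_integral(2) by auto

lemma H1_derivD:
  assumes "H1_deriv l f g"
  shows "set_integrable lborel {0..l} g" "x \<in> {0..l} \<Longrightarrow> f x = f 0 + integral {0..x} g" "continuous_on {0..l} f"
proof -
  show g: "set_integrable lborel {0..l} g"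
    using assms square_integrable_imp_set_integrable by (auto simp: H1_deriv_def)
  show eq: "f x = f 0 + integral {0..x} g" if "x \<in> {0..l}" for x
    using assms that unfolding H1_deriv_def LINT_eq_integral[OF g that, symmetric] by blast
  have "continuous_on {0..l} (\<lambda>x. f 0 + integral {0..x} g)"
    by (intro continuous_intros indefinite_integral_continuous_1 set_borel_integral_eq_integral(1) g)
  then show "continuous_on {0..l} f"
    by (rule continuous_on_eq) (rule eq[symmetric])
qed

lemma H1_deriv_C1:
  assumes "H1_deriv l f g" "continuous_on {0..l} g"
  shows "C1_on l f g"
  using C1_on_integral[OF assms(2), of "f 0"]
  by (simp only: C1_on_cong[OF H1_derivD(2)[OF assms(1)] refl])

lemma C1_on_H1_deriv:
  assumes "C1_on l f g"
  shows "H1_deriv l f g"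
  unfolding H1_deriv_def square_integrable_def
proof (intro conjI ballI)
  have g: "set_integrable lborel {0..l} g" by (rule borel_integrable_atLeastAtMost'[OF C1_onD(1)[OF assms]])
  have g2: "set_integrable lborel {0..l} (\<lambda>x. (g x)\<^sup>2)"
    by (intro borel_integrable_atLeastAtMost' continuous_intros C1_onD(1)[OF assms])
  have "set_integrable lborel {0<..<l} g" by (rule set_integrable_subset[OF g]) auto
  then show "set_borel_measurable lborel {0<..<l} g"
    by (simp add: set_integrable_def set_borel_measurable_def borel_measurable_integrable)
  show "set_integrable lborel {0<..<l} (\<lambda>x. (g x)\<^sup>2)" by (rule set_integrable_subset[OF g2]) auto
  fix x assume x: "x \<in> {0..l}"
  then show "f x = f 0 + (LINT t:{0..x}|lborel. g t)"
    using C1_on_integral_eq[OF assms, of 0 x] by (simp add: LINT_eq_integral[OF g x])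
qed

lemma integral_cong_AE_open:
  assumes h: "set_integrable lborel {0..l} h" and k: "set_integrable lborel {0..l} k"
    and ae: "AE x in lborel. x \<in> {0<..<l} \<longrightarrow> h x = k x" and x: "x \<in> {0..l}"
  shows "integral {0..x} h = integral {0..x} (k :: real \<Rightarrow> real)"
proof -
  have "(LINT t:{0..x}|lborel. h t) = (LINT t:{0..x}|lborel. k t)"
    unfolding set_lebesgue_integral_def
  proof (rule integral_cong_AE)
    have "set_integrable lborel {0..x} h" "set_integrable lborel {0..x} k"
      using set_integrable_subset[OF h, of "{0..x}"] set_integrable_subset[OF k, of "{0..x}"] x by auto
    then show "(\<lambda>t. indicat_real {0..x} t *\<^sub>R h t) \<in> borel_measurable lborel"
      "(\<lambda>t. indicat_real {0..x} t *\<^sub>R k t) \<in> borel_measurable lborel"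
      by (auto simp: set_integrable_def borel_measurable_integrable)
    show "AE t in lborel. indicat_real {0..x} t *\<^sub>R h t = indicat_real {0..x} t *\<^sub>R k t"
      using ae AE_lborel_singleton[of 0] AE_lborel_singleton[of l]
      by eventually_elim (use x in \<open>auto simp: indicator_def\<close>)
  qed
  then show ?thesis by (simp add: LINT_eq_integral[OF h x] LINT_eq_integral[OF k x])
qed

context metric_graph
begin

text \<open>Regularity: \<open>g\<close> is absolutely continuous, so \<open>f\<close> is
  continuously differentiable. The weak derivative of \<open>g\<close> agrees almost everywhere with
  the continuous function \<open>- s * f\<close>, so \<open>g\<close> is an antiderivative of the
  latter and itself continuously differentiable.\<close>

lemma eigenspace_standard_laplacian: "eigenspace (standard_laplacian G) s = {f. eigenfunction s f}"
proof (intro set_eqI iffI)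
  fix f assume "f \<in> eigenspace (standard_laplacian G) s"
  then obtain g h where f: "supported_on_edges G f" "continuous_at_vertices G f"
    and gh: "\<And>e. e \<in> E \<Longrightarrow> H2_derivs (l e) (f e) (g e) (h e)" and "kirchhoff G g"
    and ae: "\<And>e. e \<in> E \<Longrightarrow> AE x in lborel. x \<in> {0<..<l e} \<longrightarrow> (s *\<^sub>R f) e x = - h e x"
    unfolding eigenspace_def standard_laplacian_def supported_on_edges_def by blast
  have fg: "C1_on (l e) (f e) (g e)" if "e \<in> E" for e
    using gh[OF that] H1_deriv_C1 H1_derivD(3) by (auto simp: H2_derivs_def)
  have "C1_on (l e) (g e) (\<lambda>x. - s * f e x)" if e: "e \<in> E" for e
  proof -
    have g: "H1_deriv (l e) (g e) (h e)" using gh[OF e] by (simp add: H2_derivs_def)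
    have c: "continuous_on {0..l e} (\<lambda>x. - s * f e x)"
      by (intro continuous_intros C1_onD(2)[OF fg[OF e]])
    have "g e x = g e 0 + integral {0..x} (\<lambda>x. - s * f e x)" if x: "x \<in> {0..l e}" for x
    proof -
      have "integral {0..x} (h e) = integral {0..x} (\<lambda>x. - s * f e x)"
      proof (rule integral_cong_AE_open[OF H1_derivD(1)[OF g] borel_integrable_atLeastAtMost'[OF c] _ x])
        show "AE x in lborel. x \<in> {0<..<l e} \<longrightarrow> h e x = - s * f e x"
          using ae[OF e] by eventually_elim (auto simp: scaleR_fun_def)
      qed
      then show ?thesis using H1_derivD(2)[OF g x] by simp
    qed
    then have "C1_on (l e) (g e) (\<lambda>x. - s * f e x)
        \<longleftrightarrow> C1_on (l e) (\<lambda>x. g e 0 + integral {0..x} (\<lambda>x. - s * f e x)) (\<lambda>x. - s * f e x)"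
      by (rule C1_on_cong) (assumption, rule refl)
    with C1_on_integral[OF c, of "g e 0"] show ?thesis by blast
  qed
  then show "f \<in> {f. eigenfunction s f}" using f fg \<open>kirchhoff G g\<close> by (auto simp: eigenfunction_def)
next
  fix f assume "f \<in> {f. eigenfunction s f}"
  then obtain g where f: "supported_on_edges G f" "continuous_at_vertices G f" "kirchhoff G g"
    and g: "\<And>e. e \<in> E \<Longrightarrow> C1_on (l e) (f e) (g e)"
      "\<And>e. e \<in> E \<Longrightarrow> C1_on (l e) (g e) (\<lambda>x. - s * f e x)"
    by (auto simp: eigenfunction_def)
  have "\<exists>g h. (\<forall>e\<in>E. H2_derivs (l e) (f e) (g e) (h e)) \<and> kirchhoff G g \<and>
      (\<forall>e\<in>E. AE x in lborel. x \<in> {0<..<l e} \<longrightarrow> (s *\<^sub>R f) e x = - h e x)"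
    using f(3) g C1_on_H1_deriv
    by (intro exI[of _ g] exI[of _ "\<lambda>e x. - s * f e x"]) (auto simp: H2_derivs_def scaleR_fun_def)
  then show "f \<in> eigenspace (standard_laplacian G) s"
    using f(1,2) by (simp add: eigenspace_def standard_laplacian_def supported_on_edges_def)
qed

section \<open>Compactness\<close>

text \<open>All summands of the norm and of the energy are nonnegative, so the global bounds hold on
  every single edge.\<close>

lemma edge_bounds:
  assumes f: "f \<in> C1_graph G" "graph_inner G f f = 1" "graph_energy G f f \<le> K" and e: "e \<in> E"
  shows "\<lbrakk>x \<in> {0..l e}; y \<in> {0..l e}\<rbrakk> \<Longrightarrow> (f e x - f e y)\<^sup>2 \<le> K * \<bar>x - y\<bar>"
    and "x \<in> {0..l e} \<Longrightarrow> (f e x)\<^sup>2 \<le> 2 / l e + 2 * l e * K"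
proof -
  have c: "continuous_on {0..l e} (\<lambda>x. (f e x)\<^sup>2)" "continuous_on {0..l e} (\<lambda>x. (edge_deriv G f e x)\<^sup>2)" if "e \<in> E" for e
    by (intro continuous_intros continuous_on_edge f that)+
  have nn: "0 \<le> integral {0..l e} (\<lambda>x. (f e x)\<^sup>2)" "0 \<le> integral {0..l e} (\<lambda>x. (edge_deriv G f e x)\<^sup>2)"
    if "e \<in> E" for e
    by (intro integral_nonneg integrable_continuous_real c that; simp)+
  have 1: "integral {0..l e} (\<lambda>x. (f e x)\<^sup>2) \<le> 1"
  proof -
    have "integral {0..l e} (\<lambda>x. (f e x)\<^sup>2) \<le> (\<Sum>e\<in>E. integral {0..l e} (\<lambda>x. (f e x)\<^sup>2))"
      by (rule member_le_sum[OF e]) (use nn fin in auto)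
    then show ?thesis using f(2) by (simp add: graph_inner_def power2_eq_square)
  qed
  have 2: "integral {0..l e} (\<lambda>x. (edge_deriv G f e x)\<^sup>2) \<le> K"
  proof -
    have "integral {0..l e} (\<lambda>x. (edge_deriv G f e x)\<^sup>2) \<le> (\<Sum>e\<in>E. integral {0..l e} (\<lambda>x. (edge_deriv G f e x)\<^sup>2))"
      by (rule member_le_sum[OF e]) (use nn fin in auto)
    then show ?thesis using f(3) by (simp add: graph_energy_def graph_inner_def power2_eq_square)
  qed
  note fe = C1_on_edge_deriv[OF f(1) e]
  show "(f e x - f e y)\<^sup>2 \<le> K * \<bar>x - y\<bar>" if "x \<in> {0..l e}" "y \<in> {0..l e}"
    by (rule order_trans[OF C1_on_Hoelder[OF fe that] mult_right_mono[OF 2]]) simp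
  show "(f e x)\<^sup>2 \<le> 2 / l e + 2 * l e * K" if "x \<in> {0..l e}"
  proof -
    have "2 / l e * integral {0..l e} (\<lambda>t. (f e t)\<^sup>2) \<le> 2 / l e * 1"
      "2 * l e * integral {0..l e} (\<lambda>t. (edge_deriv G f e t)\<^sup>2) \<le> 2 * l e * K"
      using 1 2 len[OF e] by (intro mult_left_mono; simp)+
    then show ?thesis using C1_on_sup_bound[OF fe len[OF e] that] by linarith
  qed
qed

lemma uniform_subsequence_edge:
  assumes F: "\<And>n::nat. F n \<in> C1_graph G" "\<And>n. graph_inner G (F n) (F n) = 1"
    "\<And>n. graph_energy G (F n) (F n) \<le> K" and e: "e \<in> E"
  shows "\<exists>r g. strict_mono (r :: nat \<Rightarrow> nat) \<and> uniform_limit {0..l e} (\<lambda>n. F (r n) e) g sequentially"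
proof -
  define M where "M = 2 / l e + 2 * l e * K"
  have K: "0 \<le> K" using F(3)[of 0] energy.nonneg[OF F(1)[of 0]] by linarith
  note bounds = edge_bounds[OF F(1) F(2) F(3) e]
  obtain g r where r: "strict_mono (r :: nat \<Rightarrow> nat)"
    and g: "\<And>\<epsilon>. 0 < \<epsilon> \<Longrightarrow> \<exists>N. \<forall>n x. n \<ge> N \<and> x \<in> {0..l e} \<longrightarrow> norm (F (r n) e x - g x) < \<epsilon>"
  proof (rule Arzela_Ascoli[of "{0..l e}" "\<lambda>n. F n e" "sqrt M"])
    show "norm (F n e x) \<le> sqrt M" if "x \<in> {0..l e}" for n x
      using real_sqrt_le_mono[OF bounds(2)[OF that, of n]] by (simp add: M_def)
    fix x \<epsilon> :: real assume x: "x \<in> {0..l e}" and \<epsilon>: "0 < \<epsilon>"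
    show "\<exists>d>0. \<forall>n y. y \<in> {0..l e} \<and> norm (x - y) < d \<longrightarrow> norm (F n e x - F n e y) < \<epsilon>"
    \<comment> \<open>The Hoelder estimate allows this modulus for all \<open>n\<close> at once;
      \<open>K + 1\<close> replaces \<open>K\<close> because \<open>K\<close> may be 0.\<close>
    proof (intro exI[of _ "\<epsilon>\<^sup>2 / (K + 1)"] conjI allI impI)
      show "0 < \<epsilon>\<^sup>2 / (K + 1)" using \<epsilon> K by simp
      fix n y assume y: "y \<in> {0..l e} \<and> norm (x - y) < \<epsilon>\<^sup>2 / (K + 1)"
      have "(F n e x - F n e y)\<^sup>2 \<le> K * \<bar>x - y\<bar>" using bounds(1)[OF x] y by blast
      also have "\<dots> \<le> (K + 1) * \<bar>x - y\<bar>" by (simp add: mult_right_mono)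
      also have "\<dots> < \<epsilon>\<^sup>2" using y K by (simp add: field_simps)
      finally have "\<bar>F n e x - F n e y\<bar>\<^sup>2 < \<epsilon>\<^sup>2" by simp
      then show "norm (F n e x - F n e y) < \<epsilon>" using \<epsilon> by (simp add: power2_less_imp_less)
    qed
  qed auto
  then have "uniform_limit {0..l e} (\<lambda>n. F (r n) e) g sequentially"
    unfolding uniform_limit_iff eventually_sequentially dist_norm by blast
  then show ?thesis using r by blast
qed

text \<open>There are finitely many edges, so subsequences can be refined edge by edge.\<close>

lemma uniform_subsequence:
  assumes F: "\<And>n::nat. F n \<in> C1_graph G" "\<And>n. graph_inner G (F n) (F n) = 1"
    "\<And>n. graph_energy G (F n) (F n) \<le> K" and A: "A \<subseteq> E"
  shows "\<exists>r g. strict_mono (r :: nat \<Rightarrow> nat) \<and>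
    (\<forall>e\<in>A. uniform_limit {0..l e} (\<lambda>n. F (r n) e) (g e) sequentially)"
proof -
  have "finite A" using A fin by (rule finite_subset)
  then show ?thesis using A
  proof (induction A rule: finite_induct)
    case empty
    show ?case by (intro exI[of _ id]) (simp add: strict_mono_def)
  next
    case (insert e A)
    then obtain r g where r: "strict_mono (r :: nat \<Rightarrow> nat)"
      and g: "\<forall>e\<in>A. uniform_limit {0..l e} (\<lambda>n. F (r n) e) (g e) sequentially" by blast
    obtain r' g' where r': "strict_mono (r' :: nat \<Rightarrow> nat)"
      and g': "uniform_limit {0..l e} (\<lambda>n. F (r (r' n)) e) g' sequentially"
      using uniform_subsequence_edge[of "\<lambda>n. F (r n)" K e] F insert.prems by auto
    have "strict_mono (\<lambda>n. r (r' n))" using r r' by (simp add: strict_mono_def)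
    moreover have "\<forall>e'\<in>insert e A. uniform_limit {0..l e'} (\<lambda>n. F (r (r' n)) e') ((g(e := g')) e') sequentially"
      using g' uniform_limit_subseq[OF g[rule_format] r'] insert.hyps(2) by auto
    ultimately show ?case by blast
  qed
qed

lemma compactness:
  assumes F: "\<And>n::nat. F n \<in> C1_graph G \<and> graph_inner G (F n) (F n) = 1 \<and> graph_energy G (F n) (F n) \<le> K"
  shows "\<exists>r f. strict_mono (r :: nat \<Rightarrow> nat) \<and> supported_on_edges G f \<and> continuous_at_vertices G f \<and>
    (\<forall>e\<in>E. continuous_on {0..l e} (f e)) \<and>
    (\<forall>e\<in>E. uniform_limit {0..l e} (\<lambda>n. F (r n) e) (f e) sequentially)"
proof -
  obtain r g where r: "strict_mono (r :: nat \<Rightarrow> nat)"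
    and g: "\<forall>e\<in>E. uniform_limit {0..l e} (\<lambda>n. F (r n) e) (g e) sequentially"
    using uniform_subsequence[of F K E] F by blast
  define f where "f = on_edges g"
  have lim: "uniform_limit {0..l e} (\<lambda>n. F (r n) e) (f e) sequentially" if "e \<in> E" for e
    using g that uniform_limit_cong'[of "{0..l e}" "\<lambda>n. F (r n) e" "\<lambda>n. F (r n) e" "f e" "g e"]
    by (simp add: f_def on_edges_def)
  have cont: "continuous_on {0..l e} (f e)" if e: "e \<in> E" for e
    by (rule uniform_limit_theorem[OF _ lim[OF e]]) (use continuous_on_edge(1)[OF _ e] F in auto)
  have pt: "(\<lambda>n. F (r n) e x) \<longlonglongrightarrow> f e x" if "e \<in> E" "x \<in> {0..l e}" for e x
    using lim[OF that(1)] that(2) by (rule tendsto_uniform_limitI)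
  have "\<exists>\<phi>. \<forall>e\<in>E. F n e 0 = \<phi> (src G e) \<and> F n e (l e) = \<phi> (tgt G e)" for n
    using F[of n] by (auto simp: C1_graph_def continuous_at_vertices_def)
  then obtain \<phi> where \<phi>: "\<And>n e. e \<in> E \<Longrightarrow> F n e 0 = \<phi> n (src G e) \<and> F n e (l e) = \<phi> n (tgt G e)" by metis
  \<comment> \<open>The values at a vertex converge along the subsequence, and their limits serve as
    the vertex values of \<open>f\<close>. Only vertices on edges matter, so \<open>lim\<close> is
    used where it exists.\<close>
  have "f e 0 = lim (\<lambda>n. \<phi> (r n) (src G e))" "f e (l e) = lim (\<lambda>n. \<phi> (r n) (tgt G e))" if e: "e \<in> E" for e
    using pt[OF e, of 0] pt[OF e, of "l e"] \<phi>[OF e] len[OF e] by (auto simp: limI)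
  then have "continuous_at_vertices G f"
    unfolding continuous_at_vertices_def by (intro exI[of _ "\<lambda>v. lim (\<lambda>n. \<phi> (r n) v)"]) simp
  moreover have "supported_on_edges G f" unfolding f_def by (rule supported_on_edges)
  ultimately show ?thesis using r cont lim by blast
qed

lemma graph_inner_tendsto:
  assumes "\<And>e. e \<in> E \<Longrightarrow> uniform_limit {0..l e} (\<lambda>n. A n e) (a e) sequentially"
    "\<And>e. e \<in> E \<Longrightarrow> uniform_limit {0..l e} (\<lambda>n. B n e) (b e) sequentially"
    "\<And>e n. e \<in> E \<Longrightarrow> continuous_on {0..l e} (A n e)" "\<And>e n. e \<in> E \<Longrightarrow> continuous_on {0..l e} (B n e)"
  shows "(\<lambda>n. graph_inner G (A n) (B n)) \<longlonglongrightarrow> graph_inner G a b"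
  unfolding graph_inner_def
proof (rule tendsto_sum)
  fix e assume e: "e \<in> E"
  have ab: "continuous_on {0..l e} (a e)" "continuous_on {0..l e} (b e)"
    using uniform_limit_theorem[OF _ assms(1)[OF e]] uniform_limit_theorem[OF _ assms(2)[OF e]]
      assms(3,4)[OF e] by auto
  have "uniform_limit {0..l e} (\<lambda>n x. A n e x * B n e x) (\<lambda>x. a e x * b e x) sequentially"
    using assms(1,2)[OF e] ab
    by (intro uniform_lim_mult compact_imp_bounded compact_continuous_image) auto
  then obtain I J where I: "\<And>n. ((\<lambda>x. A n e x * B n e x) has_integral I n) {0..l e}"
      and J: "((\<lambda>x. a e x * b e x) has_integral J) {0..l e}" "I \<longlonglongrightarrow> J"
    by (rule uniform_limit_integral) (use assms(3,4)[OF e] in \<open>auto intro: continuous_on_mult\<close>)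
  then show "(\<lambda>n. integral {0..l e} (\<lambda>x. A n e x * B n e x)) \<longlonglongrightarrow> integral {0..l e} (\<lambda>x. a e x * b e x)"
    by (simp add: integral_unique[OF I] integral_unique[OF J(1)])
qed

lemma spectral_form_standard_laplacian:
  "spectral_form (C1_graph G) (graph_inner G) (graph_energy G) (standard_laplacian G)"
proof
  show "0 < graph_inner G f f" if "f \<in> C1_graph G" "f \<noteq> 0" for f using that by (rule graph_inner_pos)
  show ev: "eigenspace (standard_laplacian G) s
      = {f \<in> C1_graph G. \<forall>\<phi>\<in>C1_graph G. graph_energy G f \<phi> = s * graph_inner G f \<phi>}" for s
    unfolding eigenspace_standard_laplacian by (auto simp: eigenfunction_iff_weak)
  fix F :: "nat \<Rightarrow> 'e \<Rightarrow> real \<Rightarrow> real" and K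
  assume F: "\<And>n. F n \<in> C1_graph G \<and> graph_inner G (F n) (F n) = 1 \<and> graph_energy G (F n) (F n) \<le> K"
  obtain r f where r: "strict_mono (r :: nat \<Rightarrow> nat)"
    and f: "supported_on_edges G f" "continuous_at_vertices G f" "\<forall>e\<in>E. continuous_on {0..l e} (f e)"
    and "\<forall>e\<in>E. uniform_limit {0..l e} (\<lambda>n. F (r n) e) (f e) sequentially"
    using compactness[of F K, OF F] by (elim exE conjE)
  then have lim: "\<And>e. e \<in> E \<Longrightarrow> uniform_limit {0..l e} (\<lambda>n. F (r n) e) (f e) sequentially" by blast
  have FC: "F n \<in> C1_graph G" for n using F by blast
  have cF: "continuous_on {0..l e} (F n e)" if "e \<in> E" for n e by (rule continuous_on_edge(1)[OF FC that])
  have diff0: "(\<lambda>n. graph_inner G (F (r (Suc n)) - F (r n)) (F (r (Suc n)) - F (r n))) \<longlonglongrightarrow> 0"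
  proof -
    have "uniform_limit {0..l e} (\<lambda>n. (F (r (Suc n)) - F (r n)) e) (\<lambda>_. 0) sequentially" if e: "e \<in> E" for e
      using uniform_limit_minus[OF uniform_limit_subseq[OF lim[OF e], of Suc] lim[OF e]]
      by (simp add: fun_diff_def strict_mono_def)
    then have "(\<lambda>n. graph_inner G (F (r (Suc n)) - F (r n)) (F (r (Suc n)) - F (r n))) \<longlonglongrightarrow> graph_inner G (\<lambda>_ _. 0) (\<lambda>_ _. 0)"
      using cF by (intro graph_inner_tendsto) (auto simp: fun_diff_def intro!: continuous_on_diff)
    then show ?thesis by (simp add: graph_inner_def)
  qed
  then have "\<forall>\<^sub>F n in sequentially. graph_inner G (F (r (Suc n)) - F (r n)) (F (r (Suc n)) - F (r n)) < 1"
    by (rule order_tendstoD) simp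
  then obtain n where "graph_inner G (F (r (Suc n)) - F (r n)) (F (r (Suc n)) - F (r n)) < 1"
    by (auto simp: eventually_sequentially)
  moreover have "r (Suc n) \<noteq> r n" using r by (simp add: strict_mono_eq)
  ultimately show "\<exists>i j. i \<noteq> j \<and> graph_inner G (F i - F j) (F i - F j) < 1" by blast
  fix s assume ae: "\<And>\<phi>. \<phi> \<in> C1_graph G \<Longrightarrow> (\<lambda>n. graph_energy G (F n) \<phi> - s * graph_inner G (F n) \<phi>) \<longlonglongrightarrow> 0"
  have pt: "(\<lambda>n. F (r n) e x) \<longlonglongrightarrow> f e x" if "e \<in> E" "x \<in> {0..l e}" for e x
    using lim[OF that(1)] that(2) by (rule tendsto_uniform_limitI)
  have conv: "(\<lambda>n. graph_inner G (F (r n)) \<psi>) \<longlonglongrightarrow> graph_inner G f \<psi>"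
    if "\<And>e. e \<in> E \<Longrightarrow> continuous_on {0..l e} (\<psi> e)" for \<psi>
    by (rule graph_inner_tendsto) (use lim cF that in \<open>auto intro: uniform_limit_const\<close>)
  have "very_weak s f"
    unfolding very_weak_def
  proof (intro allI impI, elim conjE)
    fix \<phi> \<phi>' \<phi>'' assume \<phi>: "\<phi> \<in> C1_graph G"
      and "\<forall>e\<in>E. C1_on (l e) (\<phi> e) (\<phi>' e) \<and> C1_on (l e) (\<phi>' e) (\<phi>'' e)"
    then have \<phi>': "C1_on (l e) (\<phi> e) (\<phi>' e)" "C1_on (l e) (\<phi>' e) (\<phi>'' e)" if "e \<in> E" for e using that by auto
    let ?b = "\<lambda>f. \<Sum>e\<in>E. f e (l e) * \<phi>' e (l e) - f e 0 * \<phi>' e 0"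
    \<comment> \<open>This form contains values of \<open>F n\<close> but no derivatives, so uniform
      convergence is enough to pass to the limit.\<close>
    have parts: "graph_energy G (F n) \<phi> = ?b (F n) - graph_inner G (F n) \<phi>''" for n
      using graph_energy_by_parts[OF FC \<phi>'] by (simp add: sum_subtractf graph_inner_def)
    have "(\<lambda>n. ?b (F (r n)) - graph_inner G (F (r n)) \<phi>'' - s * graph_inner G (F (r n)) \<phi>)
        \<longlonglongrightarrow> ?b f - graph_inner G f \<phi>'' - s * graph_inner G f \<phi>"
      using len by (intro tendsto_intros conv pt continuous_on_edge(1)[OF \<phi>] C1_onD(1)[OF \<phi>'(2)]) (auto intro: less_imp_le)
    moreover have "(\<lambda>n. ?b (F (r n)) - graph_inner G (F (r n)) \<phi>'' - s * graph_inner G (F (r n)) \<phi>) \<longlonglongrightarrow> 0"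
      using LIMSEQ_subseq_LIMSEQ[OF ae[OF \<phi>] r] by (simp add: o_def parts)
    ultimately have "?b f - graph_inner G f \<phi>'' - s * graph_inner G f \<phi> = 0" by (rule LIMSEQ_unique)
    then show "(\<Sum>e\<in>E. f e (l e) * \<phi>' e (l e) - f e 0 * \<phi>' e 0 - integral {0..l e} (\<lambda>x. f e x * \<phi>'' e x))
        = s * graph_inner G f \<phi>"
      by (simp add: sum_subtractf graph_inner_def)
  qed
  then have "f \<in> eigenspace (standard_laplacian G) s"
    unfolding eigenspace_standard_laplacian using eigenfunction_if_very_weak f by blast
  moreover have "(\<lambda>n. graph_inner G (F (r n) - f) (F (r n) - f)) \<longlonglongrightarrow> 0"
  proof -
    have "uniform_limit {0..l e} (\<lambda>n. (F (r n) - f) e) (\<lambda>_. 0) sequentially" if e: "e \<in> E" for e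
      using uniform_limit_minus[OF lim[OF e] uniform_limit_const[of "f e"]] by (simp add: fun_diff_def)
    then have "(\<lambda>n. graph_inner G (F (r n) - f) (F (r n) - f)) \<longlonglongrightarrow> graph_inner G (\<lambda>_ _. 0) (\<lambda>_ _. 0)"
      using cF f(3) by (intro graph_inner_tendsto) (auto simp: fun_diff_def intro!: continuous_on_diff)
    then show ?thesis by (simp add: graph_inner_def)
  qed
  ultimately show "\<exists>r f. f \<in> eigenspace (standard_laplacian G) s
      \<and> (\<lambda>n. graph_inner G (F (r n) - f) (F (r n) - f)) \<longlonglongrightarrow> 0" by blast
qed

end

section \<open>The Poincare inequality\<close>

context metric_graph
begin

sublocale spectral_form "C1_graph G" "graph_inner G" "graph_energy G" "standard_laplacian G"
  by (rule spectral_form_standard_laplacian)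

text \<open>The constant function 1 in the normalised representation.\<close>

definition unit :: "'e \<Rightarrow> real \<Rightarrow> real"
  where "unit = on_edges (\<lambda>_ _. 1)"

lemma unit_apply: "\<lbrakk>e \<in> E; x \<in> {0..l e}\<rbrakk> \<Longrightarrow> unit e x = 1"
  by (simp add: unit_def on_edges_def)

lemma C1_on_unit: "e \<in> E \<Longrightarrow> C1_on (l e) (unit e) (\<lambda>_. 0)"
  by (auto simp: unit_def C1_on_on_edges) (simp add: C1_on_def)

lemma unit_C1: "unit \<in> C1_graph G"
proof (rule C1_graphI[OF _ _ C1_on_unit])
  show "continuous_at_vertices G unit"
    by (auto simp: continuous_at_vertices_def unit_def on_edges_end intro!: exI[of _ "\<lambda>_. 1"])
qed (simp_all add: unit_def supported_on_edges)

definition total_length :: real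
  where "total_length = (\<Sum>e\<in>E. l e)"

lemma total_length_pos: "0 < total_length"
  unfolding total_length_def by (rule sum_pos[OF fin nonempty len])

lemma graph_inner_unit: "graph_inner G f unit = (\<Sum>e\<in>E. integral {0..l e} (f e))"
  unfolding graph_inner_def by (intro sum.cong refl integral_cong) (simp add: unit_apply)

lemma graph_inner_unit_unit: "graph_inner G unit unit = total_length"
  unfolding graph_inner_unit total_length_def
proof (rule sum.cong[OF refl])
  fix e assume e: "e \<in> E"
  have "integral {0..l e} (unit e) = integral {0..l e} (\<lambda>_. 1)"
    by (rule integral_cong) (simp add: unit_apply e)
  then show "integral {0..l e} (unit e) = l e" using len[OF e] by simp
qed

lemma graph_energy_unit: "graph_energy G unit f = 0"
proof -
  have "edge_deriv G unit e x = 0" if "e \<in> E" "x \<in> {0..l e}" for e x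
    by (rule C1_on_unique[of e unit "\<lambda>_. 0", OF C1_on_unit[OF that(1)] that])
  then have "graph_energy G unit f = graph_inner G (\<lambda>_ _. 0) (edge_deriv G f)"
    unfolding graph_energy_def by (intro graph_inner_cong) auto
  then show ?thesis by (simp add: graph_inner_def)
qed

text \<open>The test space is spanned by the constants and \<open>f\<close> minus its mean.\<close>

lemma Poincare:
  assumes f: "f \<in> C1_graph G" and c: "c \<le> graph_eigenvalue G 2"
  shows "c * (graph_inner G f f - (graph_inner G f unit)\<^sup>2 / total_length) \<le> graph_energy G f f"
proof -
  define a where "a = graph_inner G f unit / total_length"
  define g where "g = f - a *\<^sub>R unit"
  note L = total_length_pos
  have g: "g \<in> C1_graph G" unfolding g_def by (intro inner.V_closed f unit_C1)
  have g1: "graph_inner G g unit = 0"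
    using L f unit_C1 by (simp add: g_def inner.bilinear inner.V_closed graph_inner_unit_unit a_def)
  have gg: "graph_inner G g g = graph_inner G f f - (graph_inner G f unit)\<^sup>2 / total_length"
  proof -
    have "graph_inner G g g = graph_inner G g f"
      using g1 g f unit_C1 by (subst (2) g_def) (simp add: inner.bilinear inner.V_closed)
    also have "\<dots> = graph_inner G f f - a * graph_inner G f unit"
      using f unit_C1 graph_inner_commute[of f unit] by (simp add: g_def inner.bilinear inner.V_closed)
    finally show ?thesis by (simp add: a_def power2_eq_square)
  qed
  have e1: "graph_energy G f unit = 0" if "f \<in> C1_graph G" for f
    using graph_energy_unit energy.sym[OF that unit_C1] by simp
  have eg: "graph_energy G g g = graph_energy G f f"
  proof -
    have "graph_energy G g g = graph_energy G g f"
      using g f unit_C1 e1 by (subst (2) g_def) (simp add: energy.bilinear energy.V_closed)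
    then show ?thesis
      using f unit_C1 graph_energy_unit by (simp add: g_def energy.bilinear energy.V_closed)
  qed
  show ?thesis
  proof (cases "g = 0")
    \<comment> \<open>Then \<open>f\<close> is constant and the bracket on the left
      vanishes.\<close>
    case True
    then show ?thesis using gg energy.nonneg[OF f] inner.zero_left[OF g] by simp
  next
    case False
    have p: "0 < graph_inner G g g" by (rule pos[OF g False])
    define R where "R = graph_energy G g g / graph_inner G g g"
    have R: "0 \<le> R" using p energy.nonneg[OF g] by (simp add: R_def)
    have notin: "unit \<notin> span {g}"
    proof
      \<comment> \<open>\<open>g\<close> has mean zero, while the product of \<open>unit\<close>
        with itself is the total length.\<close>
      assume "unit \<in> span {g}"
      then obtain k where "unit = k *\<^sub>R g" by (auto simp: span_singleton)
      then have "graph_inner G unit unit = k * graph_inner G g unit"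
        using inner.scale_left[OF g unit_C1] by metis
      then show False using g1 L by (simp add: graph_inner_unit_unit)
    qed
    then have ne: "unit \<noteq> g" using span_base by blast
    have "nth_eigenvalue (standard_laplacian G) (card {unit, g}) \<le> R"
    proof (rule nth_eigenvalue_le)
      show "independent {unit, g}" using notin False by (simp add: independent_insert)
      fix h assume "h \<in> span {unit, g}"
      then obtain k where "h - k *\<^sub>R unit \<in> span {g}" by (auto simp: span_insert)
      then obtain k' where "h - k *\<^sub>R unit = k' *\<^sub>R g" by (auto simp: span_singleton)
      then have h: "h = k *\<^sub>R unit + k' *\<^sub>R g" by (simp add: algebra_simps)
      have "graph_energy G h h = k'\<^sup>2 * graph_energy G g g"
        using g unit_C1 graph_energy_unit e1[OF g]
        by (simp add: h energy.bilinear energy.V_closed power2_eq_square)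
      also have "\<dots> = R * (k'\<^sup>2 * graph_inner G g g)" using p by (simp add: R_def)
      \<comment> \<open>Constants do not contribute to the energy but enlarge the norm, so
        \<open>R\<close> bounds the Rayleigh quotient on the whole plane.\<close>
      also have "\<dots> \<le> R * (k\<^sup>2 * total_length + k'\<^sup>2 * graph_inner G g g)"
        using R L by (intro mult_left_mono) auto
      also have "k\<^sup>2 * total_length + k'\<^sup>2 * graph_inner G g g = graph_inner G h h"
        using g unit_C1 g1 graph_inner_commute[of unit g]
        by (simp add: h inner.bilinear inner.V_closed power2_eq_square graph_inner_unit_unit)
      finally show "graph_energy G h h \<le> R * graph_inner G h h" .
    qed (use ne g unit_C1 in auto)
    then have "graph_eigenvalue G 2 \<le> R" using ne by (simp add: graph_eigenvalue_def numeral_2_eq_2)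
    then have "c * graph_inner G g g \<le> R * graph_inner G g g" using c p by (intro mult_right_mono) auto
    then show ?thesis using p eg gg by (simp add: R_def)
  qed
qed

section \<open>Passage to subgraphs\<close>

lemma metric_graph_subgraph:
  assumes "S \<subseteq> E" "S \<noteq> {}"
  shows "metric_graph (subgraph G S)"
  using assms fin len G finite_subset by (unfold_locales) (auto simp: is_metric_graph_def subgraph_def)

lemma subgraph_simps [simp]:
  "edges (subgraph G S) = S" "elen (subgraph G S) = l" "src (subgraph G S) = src G" "tgt (subgraph G S) = tgt G"
  by (simp_all add: subgraph_def)

text \<open>The restriction \<open>h\<close> of \<open>f\<close> to \<open>S\<close> is admissible
  on the subgraph with the same vertex values. The result is phrased by edges of \<open>G\<close> so
  that it can be summed over a cover.\<close>

lemma Poincare_subgraph: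
  assumes S: "S \<subseteq> E" "S \<noteq> {}" and f: "f \<in> C1_graph G" and c: "c \<le> graph_eigenvalue (subgraph G S) 2"
  shows "c * ((\<Sum>e\<in>S. integral {0..l e} (\<lambda>x. f e x * f e x))
      - (\<Sum>e\<in>S. integral {0..l e} (f e))\<^sup>2 / (\<Sum>e\<in>S. l e))
    \<le> (\<Sum>e\<in>S. integral {0..l e} (\<lambda>x. edge_deriv G f e x * edge_deriv G f e x))"
proof -
  interpret H: metric_graph "subgraph G S" by (rule metric_graph_subgraph[OF S])
  define h where "h e = (if e \<in> S then f e else (\<lambda>_. 0))" for e
  have h: "h \<in> C1_graph (subgraph G S)"
  proof (rule H.C1_graphI)
    show "supported_on_edges (subgraph G S) h"
      using C1_graphD(1)[OF f] by (auto simp: supported_on_edges_def h_def)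
    show "continuous_at_vertices (subgraph G S) h"
      using C1_graphD(2)[OF f] S(1) by (auto simp: continuous_at_vertices_def h_def subset_iff)
    show "C1_on (elen (subgraph G S) e) (h e) (edge_deriv G f e)" if "e \<in> edges (subgraph G S)" for e
      using C1_on_edge_deriv[OF f] that S(1) by (auto simp: h_def)
  qed
  have "edge_deriv (subgraph G S) h e = edge_deriv G f e" if "e \<in> S" for e
    using that by (simp add: edge_deriv_def fun_eq_iff h_def)
  then have "graph_energy (subgraph G S) h h = (\<Sum>e\<in>S. integral {0..l e} (\<lambda>x. edge_deriv G f e x * edge_deriv G f e x))"
    by (simp add: graph_energy_def graph_inner_def)
  moreover have "graph_inner (subgraph G S) h h = (\<Sum>e\<in>S. integral {0..l e} (\<lambda>x. f e x * f e x))"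
    "graph_inner (subgraph G S) h H.unit = (\<Sum>e\<in>S. integral {0..l e} (f e))"
    unfolding H.graph_inner_unit by (simp_all add: graph_inner_def h_def)
  ultimately show ?thesis using H.Poincare[OF h c] by (simp add: H.total_length_def)
qed

text \<open>Polynomials on one edge, multiplied by \<open>x * (l e - x)\<close> so that they vanish
  at both ends and extend by zero. Hence every eigenvalue index is meaningful on a metric
  graph.\<close>

lemma exists_independent:
  obtains S where "independent S" "S \<subseteq> C1_graph G" "finite S" "card S = n"
proof -
  obtain e where e: "e \<in> E" using nonempty by blast
  define p where "p k = on_edges (\<lambda>e' x. if e' = e then x ^ k * (x * (l e - x)) else 0)" for k :: nat
  have p: "p k e x = x ^ k * (x * (l e - x))" if "0 < x" "x < l e" for k x
    using that e by (simp add: p_def on_edges_def)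
  define p' where "p' k x = l e * (real (Suc k) * x ^ k) + (- 1) * (real (Suc (Suc k)) * x ^ Suc k)" for k x
  have pow: "C1_on (l e) (\<lambda>x. x ^ Suc k) (\<lambda>x. real (Suc k) * x ^ k)" for k
    unfolding C1_on_def using DERIV_pow[of "Suc k"] by (auto intro!: continuous_intros)
  have p': "C1_on (l e) (\<lambda>x. x ^ k * (x * (l e - x))) (p' k)" for k
    using C1_on_add[OF C1_on_cmult[OF pow, of "l e" k] C1_on_cmult[OF pow, of "- 1" "Suc k"]]
    by (simp add: p'_def[abs_def] algebra_simps)
  have "p k \<in> C1_graph G" for k
  proof (rule C1_graphI)
    show "continuous_at_vertices G (p k)"
      unfolding continuous_at_vertices_def
      by (intro exI[of _ "\<lambda>_. 0"]) (auto simp: p_def on_edges_end)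
    show "C1_on (l e') (p k e') (if e' = e then p' k else (\<lambda>_. 0))" if "e' \<in> E" for e'
    proof (cases "e' = e")
      case True
      then show ?thesis using that p' by (simp add: p_def C1_on_on_edges)
    next
      case False
      then show ?thesis using that by (simp add: p_def C1_on_on_edges) (simp add: C1_on_def)
    qed
  qed (simp add: p_def supported_on_edges)
  \<comment> \<open>The cardinality requires the functions to be distinct; distinct powers of a
    point in (0,1) differ.\<close>
  moreover have inj: "inj p"
  proof (rule injI, rule ccontr)
    fix j k assume jk: "p j = p k" "j \<noteq> k"
    define x where "x = min (l e / 2) (1 / 2)"
    have x: "0 < x" "x < l e" "x < 1" using len[OF e] by (auto simp: x_def)
    have "x ^ j = x ^ k" using p[OF x(1,2), of j] p[OF x(1,2), of k] jk(1) x by simp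
    moreover have "x ^ j < x ^ k \<or> x ^ k < x ^ j"
      using jk(2) x power_strict_decreasing[of j k x] power_strict_decreasing[of k j x] by linarith
    ultimately show False by simp
  qed
  moreover have "independent (p ` {..<n})"
  proof (rule independent_if_scalars_zero)
    fix c f assume c: "(\<Sum>f\<in>p ` {..<n}. c f *\<^sub>R f) = 0" and "f \<in> p ` {..<n}"
    then obtain k where k: "k < n" "f = p k" by auto
    have "(\<Sum>i<n. c (p i) * x ^ i) = 0" if x: "0 < x" "x < l e" for x
    proof -
      have "0 = (\<Sum>f\<in>p ` {..<n}. c f *\<^sub>R f) e x" using c by simp
      also have "\<dots> = (\<Sum>i<n. c (p i) * p i e x)"
        using inj by (subst sum.reindex) (auto simp: inj_on_def sum_fun_apply scaleR_fun_def)
      also have "\<dots> = (\<Sum>i<n. c (p i) * x ^ i) * (x * (l e - x))"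
        by (simp add: p[OF x] sum_distrib_right mult.assoc)
      finally show ?thesis using x by simp
    qed
    then show "c f = 0"
      using polynomial_coefficients_zero[OF len[OF e], of "\<lambda>i. c (p i)" n k] k by simp
  qed simp
  ultimately show thesis using that[of "p ` {..<n}"] by (auto simp: card_image inj_on_def inj_def)
qed

lemma graph_eigenvalue_nonneg:
  assumes "1 \<le> n"
  shows "0 \<le> graph_eigenvalue G n"
proof -
  obtain S where "independent S" "S \<subseteq> C1_graph G" "finite S" "card S = n" using exists_independent .
  then show ?thesis using nth_eigenvalue_nonneg[of S] assms by (simp add: graph_eigenvalue_def)
qed

section \<open>The measure on a metric graph\<close>

lemma points_sets: "S \<subseteq> E \<Longrightarrow> points G S \<in> sets (count_space E \<Otimes>\<^sub>M lborel)"
proof -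
  assume S: "S \<subseteq> E"
  have "(\<Union>e\<in>S. {e} \<times> {0<..<l e}) \<in> sets (count_space E \<Otimes>\<^sub>M lborel)"
    using S by (intro sets.finite_UN finite_subset[OF S fin] pair_measureI) auto
  also have "(\<Union>e\<in>S. {e} \<times> {0<..<l e}) = points G S" by (auto simp: points_def)
  finally show ?thesis .
qed

lemma emeasure_points:
  assumes S: "S \<subseteq> E"
  shows "emeasure (graph_measure G) (points G S) = ennreal (\<Sum>e\<in>S. l e)"
proof -
  have "emeasure (graph_measure G) (points G S) = emeasure (count_space E \<Otimes>\<^sub>M lborel) (points G S)"
    unfolding graph_measure_def
  proof (rule emeasure_restrict_space)
    show "points G E \<inter> space (count_space E \<Otimes>\<^sub>M lborel) \<in> sets (count_space E \<Otimes>\<^sub>M lborel)"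
      using points_sets by blast
  qed (use S in \<open>auto simp: points_def\<close>)
  also have "\<dots> = emeasure (count_space E \<Otimes>\<^sub>M lborel) (\<Union>e\<in>S. {e} \<times> {0<..<l e})"
    by (rule arg_cong[where f = "emeasure _"]) (auto simp: points_def)
  also have "\<dots> = (\<Sum>e\<in>S. emeasure (count_space E \<Otimes>\<^sub>M lborel) ({e} \<times> {0<..<l e}))"
  proof (rule sum_emeasure[symmetric])
    show "(\<lambda>e. {e} \<times> {0<..<l e}) ` S \<subseteq> sets (count_space E \<Otimes>\<^sub>M lborel)"
      using S by (auto intro!: pair_measureI)
    show "disjoint_family_on (\<lambda>e. {e} \<times> {0<..<l e}) S" by (auto simp: disjoint_family_on_def)
    show "finite S" using S fin by (rule finite_subset)
  qed
  also have "\<dots> = (\<Sum>e\<in>S. ennreal (l e))"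
  proof (rule sum.cong[OF refl])
    fix e assume "e \<in> S"
    then have "e \<in> E" using S by blast
    then show "emeasure (count_space E \<Otimes>\<^sub>M lborel) ({e} \<times> {0<..<l e}) = ennreal (l e)"
      using len[of e] by (subst lborel.emeasure_pair_measure_Times) auto
  qed
  also have "\<dots> = ennreal (\<Sum>e\<in>S. l e)" using S len by (intro sum_ennreal) (auto intro: less_imp_le)
  finally show ?thesis .
qed

lemma measure_points: "S \<subseteq> E \<Longrightarrow> measure (graph_measure G) (points G S) = (\<Sum>e\<in>S. l e)"
  using sum_nonneg[of S l] len
  by (simp add: measure_def emeasure_points subset_iff less_imp_le)

text \<open>Membership in the cover is constant along an edge, and an edge has positive measure, so
  the almost-everywhere condition holds on every edge.\<close>

lemma fold_coverD:
  assumes U: "fold_cover m G U" and e: "e \<in> E"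
  shows "card {i. e \<in> U i} = m"
proof (rule ccontr)
  assume ne: "card {i. e \<in> U i} \<noteq> m"
  have "AE p in graph_measure G. card {i. p \<in> points G (U i)} = m" using U by (simp add: fold_cover_def)
  then have "AE p in graph_measure G. p \<notin> points G {e}"
  proof eventually_elim
    fix p assume *: "card {i. p \<in> points G (U i)} = m"
    show "p \<notin> points G {e}"
    proof
      assume p: "p \<in> points G {e}"
      then have "{i. p \<in> points G (U i)} = {i. e \<in> U i}" by (auto simp: points_def)
      then show False using * ne by simp
    qed
  qed
  moreover have "points G {e} \<in> sets (graph_measure G)"
    unfolding graph_measure_def using e points_sets[of "{e}"] points_sets[of E]
    by (subst sets_restrict_space_iff) (auto simp: points_def)
  ultimately have "points G {e} \<in> null_sets (graph_measure G)" by (simp add: AE_iff_null_sets)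
  then show False using emeasure_points[of "{e}"] e len[OF e] by (auto simp: null_sets_def)
qed

end

section \<open>Comparison with the vicinity graph\<close>

locale metric_graph_cover = metric_graph G
  for G :: "('v, 'e) metric_graph" +
  fixes U :: "'i::finite \<Rightarrow> 'e set" and m :: nat
  assumes m: "2 \<le> m" and cover: "fold_cover m G U"
begin

lemma U: "U i \<subseteq> E" "U i \<noteq> {}"
  using cover by (auto simp: fold_cover_def)

text \<open>The indicator as a real number, so that sums over edges and over cover members can be
  exchanged.\<close>

definition covers :: "'e \<Rightarrow> 'i \<Rightarrow> real"
  where "covers e i = (if e \<in> U i then 1 else 0)"

lemma covers_mult_self: "covers e i * covers e i = covers e i"
  by (simp add: covers_def)

lemma sum_covers: "e \<in> E \<Longrightarrow> (\<Sum>i\<in>UNIV. covers e i) = real m"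
  using fold_coverD[OF cover] by (simp add: covers_def sum.If_cases)

lemma sum_U: "(\<Sum>e\<in>U i. h e) = (\<Sum>e\<in>E. covers e i * h e)"
proof -
  have "(\<Sum>e\<in>U i. h e) = (\<Sum>e\<in>E. if e \<in> U i then h e else 0)"
    using U(1)[of i] fin by (simp add: sum.If_cases Int_absorb1)
  also have "\<dots> = (\<Sum>e\<in>E. covers e i * h e)" by (intro sum.cong) (auto simp: covers_def)
  finally show ?thesis .
qed

text \<open>Double counting: every edge lies in exactly \<open>m\<close> members.\<close>

lemma sum_sum_U: "(\<Sum>i\<in>UNIV. \<Sum>e\<in>U i. h e) = real m * (\<Sum>e\<in>E. h e)"
proof -
  have "(\<Sum>i\<in>UNIV. \<Sum>e\<in>U i. h e) = (\<Sum>e\<in>E. (\<Sum>i\<in>UNIV. covers e i) * h e)"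
    unfolding sum_U sum_distrib_right by (rule sum.swap)
  then show ?thesis by (simp add: sum_covers sum_distrib_left)
qed

definition cover_length :: "'i \<Rightarrow> real"
  where "cover_length i = (\<Sum>e\<in>U i. l e)"

lemma cover_length_pos: "0 < cover_length i"
  unfolding cover_length_def using U[of i] len by (intro sum_pos finite_subset[OF _ fin]) auto

section \<open>Weights and forms of the vicinity graph\<close>

abbreviation "\<mu> \<equiv> vicinity_weight G U"

lemma vicinity_weight_eq:
  "\<mu> i j = (if i = j then 0 else (\<Sum>e\<in>E. l e * (covers e i * covers e j)))"
proof -
  have "measure (graph_measure G) (points G (U i) \<inter> points G (U j)) = (\<Sum>e\<in>U i \<inter> U j. l e)"
  proof -
    have "points G (U i) \<inter> points G (U j) = points G (U i \<inter> U j)" by (auto simp: points_def)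
    then show ?thesis using measure_points[of "U i \<inter> U j"] U(1)[of i] by auto
  qed
  also have "\<dots> = (\<Sum>e\<in>E. if e \<in> U i \<inter> U j then l e else 0)"
    using U(1)[of i] by (intro sum.mono_neutral_cong_left fin) auto
  also have "\<dots> = (\<Sum>e\<in>E. l e * (covers e i * covers e j))"
    by (intro sum.cong) (auto simp: covers_def)
  finally show ?thesis by (simp add: vicinity_weight_def)
qed

lemma vicinity_weight_sym: "\<mu> i j = \<mu> j i"
  by (simp add: vicinity_weight_eq mult.commute)

lemma vicinity_weight_nonneg: "0 \<le> \<mu> i j"
proof -
  have "0 \<le> l e * (covers e i * covers e j)" if "e \<in> E" for e
    using len[OF that] by (simp add: covers_def)
  then show ?thesis by (simp add: vicinity_weight_eq sum_nonneg)
qed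

text \<open>With the diagonal included, the overlaps sum edgewise over \<open>U i\<close>; the
  weight omits the diagonal, whose overlap is \<open>cover_length i\<close>.\<close>

lemma sum_vicinity_weight:
  "(\<Sum>j\<in>UNIV. \<mu> i j * x j) = (\<Sum>e\<in>E. l e * covers e i * (\<Sum>j\<in>UNIV. covers e j * x j)) - cover_length i * x i"
proof -
  have "(\<Sum>j\<in>UNIV. \<mu> i j * x j)
      = (\<Sum>j\<in>UNIV. (\<Sum>e\<in>E. l e * (covers e i * covers e j)) * x j - (if i = j then cover_length i * x i else 0))"
    by (rule sum.cong) (auto simp: vicinity_weight_eq cover_length_def sum_U covers_mult_self mult.commute)
  also have "\<dots> = (\<Sum>j\<in>UNIV. \<Sum>e\<in>E. l e * covers e i * (covers e j * x j)) - cover_length i * x i"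
    by (simp add: sum_subtractf sum_distrib_right mult.assoc)
  also have "(\<Sum>j\<in>UNIV. \<Sum>e\<in>E. l e * covers e i * (covers e j * x j))
      = (\<Sum>e\<in>E. l e * covers e i * (\<Sum>j\<in>UNIV. covers e j * x j))"
    unfolding sum_distrib_left by (rule sum.swap)
  finally show ?thesis .
qed

text \<open>Every edge of \<open>U i\<close> lies in \<open>m - 1\<close> further members, the
  source of the factor \<open>m - 1\<close>.\<close>

lemma weighted_degree_eq: "weighted_degree \<mu> i = (real m - 1) * cover_length i"
proof -
  have "(\<Sum>e\<in>E. l e * covers e i * (\<Sum>j\<in>UNIV. covers e j * 1)) = real m * cover_length i"
    unfolding cover_length_def sum_U sum_distrib_left[of "real m"]
    by (rule sum.cong) (simp_all add: sum_covers)
  then show ?thesis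
    using sum_vicinity_weight[of i "\<lambda>_. 1"] by (simp add: weighted_degree_def algebra_simps)
qed

text \<open>As \<open>m\<close> is at least 2, no vertex of the vicinity graph is isolated.\<close>

lemma weighted_degree_pos: "0 < weighted_degree \<mu> i"
  using m cover_length_pos[of i] by (simp add: weighted_degree_eq)

lemma degree_form_eq: "degree_form \<mu> F F = (real m - 1) * (\<Sum>i\<in>UNIV. cover_length i * (F $ i)\<^sup>2)"
  by (simp add: degree_form_def weighted_degree_eq power2_eq_square sum_distrib_left mult.assoc)

text \<open>The omitted diagonal raises the factor \<open>m - 1\<close> of the degree to
  \<open>m\<close>, and the remaining double sum is edgewise a perfect square.\<close>

lemma edge_form_vicinity:
  "edge_form \<mu> F F = real m * (\<Sum>i\<in>UNIV. cover_length i * (F $ i)\<^sup>2)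
    - (\<Sum>e\<in>E. l e * (\<Sum>i\<in>UNIV. covers e i * F $ i)\<^sup>2)"
proof -
  have inner: "(\<Sum>w\<in>UNIV. \<mu> v w * (F $ v - F $ w))
      = real m * cover_length v * F $ v - (\<Sum>e\<in>E. l e * covers e v * (\<Sum>w\<in>UNIV. covers e w * F $ w))" for v
  proof -
    have "(\<Sum>w\<in>UNIV. \<mu> v w * (F $ v - F $ w)) = weighted_degree \<mu> v * F $ v - (\<Sum>w\<in>UNIV. \<mu> v w * F $ w)"
      by (simp add: weighted_degree_def sum_distrib_right right_diff_distrib sum_subtractf)
    then show ?thesis
      unfolding weighted_degree_eq sum_vicinity_weight by (simp add: algebra_simps)
  qed
  have "(\<Sum>v\<in>UNIV. (\<Sum>e\<in>E. l e * covers e v * (\<Sum>w\<in>UNIV. covers e w * F $ w)) * F $ v)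
      = (\<Sum>e\<in>E. \<Sum>v\<in>UNIV. l e * covers e v * (\<Sum>w\<in>UNIV. covers e w * F $ w) * F $ v)"
    unfolding sum_distrib_right by (rule sum.swap)
  also have "\<dots> = (\<Sum>e\<in>E. l e * (\<Sum>i\<in>UNIV. covers e i * F $ i)\<^sup>2)"
  proof (rule sum.cong[OF refl])
    fix e
    have "(\<Sum>v\<in>UNIV. l e * covers e v * (\<Sum>w\<in>UNIV. covers e w * F $ w) * F $ v)
        = (\<Sum>v\<in>UNIV. l e * (\<Sum>w\<in>UNIV. covers e w * F $ w) * (covers e v * F $ v))"
      by (simp add: mult_ac)
    also have "\<dots> = l e * (\<Sum>w\<in>UNIV. covers e w * F $ w) * (\<Sum>v\<in>UNIV. covers e v * F $ v)"
      by (rule sum_distrib_left[symmetric])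
    finally show "(\<Sum>v\<in>UNIV. l e * covers e v * (\<Sum>w\<in>UNIV. covers e w * F $ w) * F $ v)
        = l e * (\<Sum>i\<in>UNIV. covers e i * F $ i)\<^sup>2" by (simp add: power2_eq_square mult.assoc)
  qed
  finally show ?thesis
    unfolding edge_form_eq[OF vicinity_weight_sym] inner
    by (simp add: left_diff_distrib sum_subtractf sum_distrib_left power2_eq_square mult.assoc)
qed

text \<open>Dropping the square in \<open>edge_form_vicinity\<close>. The bound holds on the whole
  space and hence for every eigenvalue.\<close>

lemma edge_form_le: "edge_form \<mu> F F \<le> real m / (real m - 1) * degree_form \<mu> F F"
proof -
  have "0 \<le> (\<Sum>e\<in>E. l e * (\<Sum>i\<in>UNIV. covers e i * F $ i)\<^sup>2)"
    using len by (intro sum_nonneg mult_nonneg_nonneg) (auto intro: less_imp_le)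
  then show ?thesis using m by (simp add: edge_form_vicinity degree_form_eq)
qed

sublocale vicinity: spectral_form UNIV "degree_form \<mu>" "edge_form \<mu>" "{(f, normalized_laplacian \<mu> f) |f. True}"
  by (intro spectral_form_normalized_laplacian vicinity_weight_sym vicinity_weight_nonneg weighted_degree_pos)

section \<open>Means over the members of the cover\<close>

definition means :: "('e \<Rightarrow> real \<Rightarrow> real) \<Rightarrow> real ^ 'i"
  where "means f = (\<chi> i. (\<Sum>e\<in>U i. integral {0..l e} (f e)) / cover_length i)"

lemma means_add:
  assumes "f \<in> C1_graph G" "g \<in> C1_graph G"
  shows "means (f + g) = means f + means g"
proof -
  have "integral {0..l e} ((f + g) e) = integral {0..l e} (f e) + integral {0..l e} (g e)" if "e \<in> E" for e
    using integral_continuous_add[OF continuous_on_edge(1)[OF assms(1) that] continuous_on_edge(1)[OF assms(2) that]]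
    by (simp add: plus_fun_def)
  then have "(\<Sum>e\<in>U i. integral {0..l e} ((f + g) e))
      = (\<Sum>e\<in>U i. integral {0..l e} (f e)) + (\<Sum>e\<in>U i. integral {0..l e} (g e))" for i
    unfolding sum.distrib[symmetric] using U(1) by (intro sum.cong) auto
  then show ?thesis by (simp add: means_def vec_eq_iff add_divide_distrib)
qed

lemma means_scale: "means (c *\<^sub>R f) = c *\<^sub>R means f"
  by (simp add: means_def vec_eq_iff scaleR_fun_def sum_distrib_left)

lemma Poincare_cover:
  assumes f: "f \<in> C1_graph G" and \<eta>: "\<And>i. \<eta> \<le> graph_eigenvalue (subgraph G (U i)) 2"
  shows "\<eta> * (real m * graph_inner G f f - (\<Sum>i\<in>UNIV. cover_length i * (means f $ i)\<^sup>2)) \<le> real m * graph_energy G f f"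
proof -
  have "(\<Sum>i\<in>UNIV. \<eta> * ((\<Sum>e\<in>U i. integral {0..l e} (\<lambda>x. f e x * f e x)) - cover_length i * (means f $ i)\<^sup>2))
      \<le> (\<Sum>i\<in>UNIV. \<Sum>e\<in>U i. integral {0..l e} (\<lambda>x. edge_deriv G f e x * edge_deriv G f e x))"
  proof (rule sum_mono)
    fix i
    have "(\<Sum>e\<in>U i. integral {0..l e} (f e))\<^sup>2 / (\<Sum>e\<in>U i. l e) = cover_length i * (means f $ i)\<^sup>2"
      using cover_length_pos[of i] by (simp add: means_def cover_length_def power2_eq_square)
    then show "\<eta> * ((\<Sum>e\<in>U i. integral {0..l e} (\<lambda>x. f e x * f e x)) - cover_length i * (means f $ i)\<^sup>2)
        \<le> (\<Sum>e\<in>U i. integral {0..l e} (\<lambda>x. edge_deriv G f e x * edge_deriv G f e x))"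
      using Poincare_subgraph[OF U(1) U(2) f \<eta>, of i] by simp
  qed
  then show ?thesis
    unfolding sum_distrib_left[symmetric] sum_subtractf sum_sum_U
    by (simp add: graph_energy_def graph_inner_def)
qed

text \<open>The left side is the square of the product of \<open>f\<close> with the step function
  \<open>p\<close>. As \<open>p\<close> is in general discontinuous at the vertices and thus outside
  \<open>C1_graph G\<close>, the inequality is derived anew from the square of
  \<open>f - c p\<close>, edge by edge.\<close>

lemma means_Cauchy_Schwarz:
  assumes f: "f \<in> C1_graph G"
  shows "(\<Sum>i\<in>UNIV. cover_length i * (means f $ i)\<^sup>2)\<^sup>2
    \<le> graph_inner G f f * (\<Sum>e\<in>E. l e * (\<Sum>i\<in>UNIV. covers e i * means f $ i)\<^sup>2)"
proof (rule quadratic_nonneg_imp)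
  define p where "p e = (\<Sum>i\<in>UNIV. covers e i * means f $ i)" for e
  define a where "a e = integral {0..l e} (f e)" for e
  have N: "(\<Sum>i\<in>UNIV. cover_length i * (means f $ i)\<^sup>2) = (\<Sum>e\<in>E. p e * a e)"
  proof -
    have "cover_length i * (means f $ i)\<^sup>2 = (\<Sum>e\<in>E. covers e i * means f $ i * a e)" for i
    proof -
      have "cover_length i * (means f $ i)\<^sup>2 = means f $ i * (\<Sum>e\<in>U i. a e)"
        using cover_length_pos[of i] by (simp add: means_def a_def power2_eq_square)
      then show ?thesis by (simp add: sum_U sum_distrib_left mult_ac)
    qed
    then have "(\<Sum>i\<in>UNIV. cover_length i * (means f $ i)\<^sup>2) = (\<Sum>i\<in>UNIV. \<Sum>e\<in>E. covers e i * means f $ i * a e)" by simp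
    also have "\<dots> = (\<Sum>e\<in>E. p e * a e)" unfolding p_def sum_distrib_right by (rule sum.swap)
    finally show ?thesis .
  qed
  fix c :: real
  have edge: "integral {0..l e} (\<lambda>x. f e x * f e x) - 2 * c * (p e * a e) + c\<^sup>2 * (l e * (p e)\<^sup>2) \<ge> 0"
    if e: "e \<in> E" for e
  proof -
    note cont = continuous_on_edge(1)[OF f e]
    have "0 \<le> integral {0..l e} (\<lambda>x. (f e x - c * p e)\<^sup>2)"
      by (intro integral_nonneg integrable_continuous_real continuous_intros cont) auto
    also have "\<dots> = integral {0..l e} (\<lambda>x. f e x * f e x + ((- 2 * c * p e) * f e x + (c * p e)\<^sup>2))"
      by (rule integral_cong) (simp add: power2_eq_square algebra_simps)
    also have "\<dots> = integral {0..l e} (\<lambda>x. f e x * f e x)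
        + (integral {0..l e} (\<lambda>x. (- 2 * c * p e) * f e x) + integral {0..l e} (\<lambda>x. (c * p e)\<^sup>2))"
      by (subst integral_continuous_add integral_continuous_add[of _ _ "\<lambda>x. (- 2 * c * p e) * f e x"];
          (intro continuous_intros cont)?)+ simp
    also have "integral {0..l e} (\<lambda>x. (- 2 * c * p e) * f e x) = (- 2 * c * p e) * a e"
      unfolding a_def by (rule integral_mult_right)
    finally show ?thesis using len[OF e] by (simp add: power2_eq_square algebra_simps)
  qed
  have "0 \<le> (\<Sum>e\<in>E. integral {0..l e} (\<lambda>x. f e x * f e x) - 2 * c * (p e * a e) + c\<^sup>2 * (l e * (p e)\<^sup>2))"
    by (rule sum_nonneg) (rule edge)
  also have "\<dots> = graph_inner G f f - 2 * c * (\<Sum>e\<in>E. p e * a e) + c\<^sup>2 * (\<Sum>e\<in>E. l e * (p e)\<^sup>2)"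
    by (simp add: sum.distrib sum_subtractf graph_inner_def sum_distrib_left)
  finally show "0 \<le> graph_inner G f f - 2 * c * (\<Sum>i\<in>UNIV. cover_length i * (means f $ i)\<^sup>2)
      + c\<^sup>2 * (\<Sum>e\<in>E. l e * (\<Sum>i\<in>UNIV. covers e i * means f $ i)\<^sup>2)"
    unfolding N p_def .
next
  show "0 \<le> (\<Sum>e\<in>E. l e * (\<Sum>i\<in>UNIV. covers e i * means f $ i)\<^sup>2)"
    using len by (intro sum_nonneg mult_nonneg_nonneg) (auto intro: less_imp_le)
qed

lemma edge_form_means_le:
  assumes f: "f \<in> C1_graph G" and \<eta>: "0 < \<eta>" "\<And>i. \<eta> \<le> graph_eigenvalue (subgraph G (U i)) 2"
    and t: "graph_energy G f f \<le> t * graph_inner G f f"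
  shows "edge_form \<mu> (means f) (means f)
    \<le> real m * t / ((real m - 1) * \<eta>) * degree_form \<mu> (means f) (means f)"
proof (cases "f = 0")
  case True
  then have "means f = 0" using means_scale[of 0 f] by simp
  then show ?thesis by (simp add: edge_form_def degree_form_def)
next
  case False
  define A where "A = graph_inner G f f"
  define N where "N = (\<Sum>i\<in>UNIV. cover_length i * (means f $ i)\<^sup>2)"
  define P where "P = (\<Sum>e\<in>E. l e * (\<Sum>i\<in>UNIV. covers e i * means f $ i)\<^sup>2)"
  have A: "0 < A" unfolding A_def by (rule pos[OF f False])
  have N: "0 \<le> N" unfolding N_def by (intro sum_nonneg mult_nonneg_nonneg) (auto intro: less_imp_le cover_length_pos)
  have NP: "N\<^sup>2 \<le> A * P" using means_Cauchy_Schwarz[OF f] by (simp add: A_def N_def P_def)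
  have "\<eta> * (real m * A - N) \<le> real m * graph_energy G f f"
    using Poincare_cover[OF f \<eta>(2)] by (simp add: A_def N_def)
  also have "\<dots> \<le> real m * (t * A)" using t by (intro mult_left_mono) (auto simp: A_def)
  finally have le: "\<eta> * (real m * A - N) \<le> real m * (t * A)" .
  \<comment> \<open>Multiplying by \<open>A\<close> brings in \<open>A * P\<close>, to which
    Cauchy--Schwarz applies; the positive factor \<open>A\<close> is cancelled at the end.\<close>
  have "A * (\<eta> * (real m * N - P)) = \<eta> * (real m * A * N - A * P)" by (simp add: algebra_simps)
  also have "\<dots> \<le> \<eta> * (real m * A * N - N\<^sup>2)" using NP \<eta>(1) by (intro mult_left_mono) auto
  also have "\<dots> = N * (\<eta> * (real m * A - N))" by (simp add: algebra_simps power2_eq_square)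
  also have "\<dots> \<le> N * (real m * (t * A))" using le N by (rule mult_left_mono)
  finally have "A * (\<eta> * (real m * N - P)) \<le> A * (real m * t * N)" by (simp add: mult_ac)
  then have "\<eta> * (real m * N - P) \<le> real m * t * N" using A by simp
  then have "real m * N - P \<le> real m * t / \<eta> * N" using \<eta>(1) by (simp add: field_simps)
  moreover have "real m * t / ((real m - 1) * \<eta>) * ((real m - 1) * N) = real m * t / \<eta> * N" using m by simp
  ultimately show ?thesis unfolding edge_form_vicinity degree_form_eq N_def[symmetric] P_def[symmetric] by simp
qed

lemma graph_eigenvalue_ge:
  assumes \<eta>: "0 \<le> \<eta>" "\<And>i. \<eta> \<le> graph_eigenvalue (subgraph G (U i)) 2" and i: "1 \<le> i" "i \<le> CARD('i)"
  shows "(real m - 1) / real m * \<eta> * normalized_eigenvalue \<mu> i \<le> graph_eigenvalue G i"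
\<comment> \<open>The comparison level for the vicinity graph divides by \<eta>; for \<eta> = 0
  nonnegativity of the eigenvalue suffices.\<close>
proof (cases "\<eta> = 0")
  case True
  then show ?thesis using graph_eigenvalue_nonneg[OF i(1)] by simp
next
  case False
  then have \<eta>0: "0 < \<eta>" using \<eta>(1) by simp
  have m1: "0 < real m - 1" "0 < real m" using m by simp_all
  obtain S where S: "independent S" "S \<subseteq> C1_graph G" "finite S" "card S = i" using exists_independent .
  have "(real m - 1) / real m * \<eta> * normalized_eigenvalue \<mu> i \<le> nth_eigenvalue (standard_laplacian G) (card S)"
  proof (rule nth_eigenvalue_ge[OF S(1-3)])
    fix t S' assume S': "independent S'" "S' \<subseteq> C1_graph G" "finite S'" "card S' = card S"
      and t: "\<And>f. f \<in> span S' \<Longrightarrow> graph_energy G f f \<le> t * graph_inner G f f"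
    have span: "span S' \<subseteq> C1_graph G" by (rule span_minimal[OF S'(2) subspace_C1_graph])
    consider (inj) "independent (means ` S')" "inj_on means S'" "span (means ` S') = means ` span S'"
      | (kernel) f where "f \<in> span S'" "f \<noteq> 0" "means f = 0"
      using independent_image_or_kernel[OF S'(1), of means] means_add means_scale span by blast
    then show "(real m - 1) / real m * \<eta> * normalized_eigenvalue \<mu> i \<le> t"
    proof cases
      case inj
      have card: "card (means ` S') = i" using card_image[OF inj(2)] S'(4) S(4) by simp
      have "nth_eigenvalue {(f, normalized_laplacian \<mu> f) |f. True} (card (means ` S'))
          \<le> real m * t / ((real m - 1) * \<eta>)"
      proof (rule vicinity.nth_eigenvalue_le[OF inj(1)])
        fix F assume "F \<in> span (means ` S')"
        then obtain f where f: "f \<in> span S'" "F = means f" using inj(3) by auto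
        then show "edge_form \<mu> F F \<le> real m * t / ((real m - 1) * \<eta>) * degree_form \<mu> F F"
          using edge_form_means_le[OF _ \<eta>0 \<eta>(2) t] span by auto
      qed (use S'(3) card i in auto)
      then have "normalized_eigenvalue \<mu> i \<le> real m * t / ((real m - 1) * \<eta>)"
        by (simp add: normalized_eigenvalue_def card)
      then have "(real m - 1) / real m * \<eta> * normalized_eigenvalue \<mu> i
          \<le> (real m - 1) / real m * \<eta> * (real m * t / ((real m - 1) * \<eta>))"
        using m1 \<eta>0 by (intro mult_left_mono) auto
      also have "\<dots> = t" using m1 \<eta>0 by simp
      finally show ?thesis .
    next
      case kernel
      then have f: "f \<in> C1_graph G" using span by blast
      have "\<eta> * (real m * graph_inner G f f) \<le> real m * graph_energy G f f"
        using Poincare_cover[OF f \<eta>(2)] kernel(3) by simp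
      also have "\<dots> \<le> real m * (t * graph_inner G f f)" using t[OF kernel(1)] by (intro mult_left_mono) auto
      finally have "(real m * graph_inner G f f) * \<eta> \<le> (real m * graph_inner G f f) * t" by (simp add: mult_ac)
      then have \<eta>t: "\<eta> \<le> t" using pos[OF f kernel(2)] m1 by simp
      \<comment> \<open>The bound by \<open>m / (m - 1)\<close> holds for all vectors, so any
        \<open>i\<close> coordinate vectors serve as test space.\<close>
      obtain B where B: "B \<subseteq> (Basis :: (real ^ 'i) set)" "card B = i"
        using obtain_subset_with_card_n[of i "Basis :: (real ^ 'i) set"] i by auto
      have "nth_eigenvalue {(f, normalized_laplacian \<mu> f) |f. True} (card B) \<le> real m / (real m - 1)"
      proof (rule vicinity.nth_eigenvalue_le)
        show "independent B" using independent_Basis B(1) by (rule independent_mono)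
      qed (use B i finite_subset[OF B(1)] edge_form_le in auto)
      then have "normalized_eigenvalue \<mu> i \<le> real m / (real m - 1)" by (simp add: normalized_eigenvalue_def B)
      then have "(real m - 1) / real m * \<eta> * normalized_eigenvalue \<mu> i
          \<le> (real m - 1) / real m * \<eta> * (real m / (real m - 1))"
        using m1 \<eta>0 by (intro mult_left_mono) auto
      also have "\<dots> = \<eta>" using m1 by simp
      finally show ?thesis using \<eta>t by simp
    qed
  qed
  then show ?thesis by (simp add: graph_eigenvalue_def S(4))
qed

end

theorem theorem2p3:
  fixes G :: "('v, 'e) metric_graph"
    and U :: "'i::finite \<Rightarrow> 'e set"
    and m :: nat
    and \<eta> :: real
  assumes "2 \<le> m"
    and "is_metric_graph G"
    and "fold_cover m G U"
    and "\<eta> = Min (range (\<lambda>j. graph_eigenvalue (subgraph G (U j)) 2))"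
  shows "\<forall>i\<in>{1..CARD('i)}.
    graph_eigenvalue G i \<ge> (real m - 1) / real m * \<eta> * normalized_eigenvalue (vicinity_weight G U) i"
proof
  fix i assume i: "i \<in> {1..CARD('i)}"
  interpret metric_graph_cover G U m by unfold_locales (use assms in auto)
  have le: "\<eta> \<le> graph_eigenvalue (subgraph G (U j)) 2" for j
    unfolding assms(4) by (rule Min_le) auto
  \<comment> \<open>The minimum is attained, so its nonnegativity is that of one spectral
    gap.\<close>
  have "\<eta> \<in> range (\<lambda>j. graph_eigenvalue (subgraph G (U j)) 2)"
    unfolding assms(4) by (rule Min_in) auto
  then obtain j where j: "\<eta> = graph_eigenvalue (subgraph G (U j)) 2" by blast
  interpret H: metric_graph "subgraph G (U j)" by (rule metric_graph_subgraph[OF U])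
  have "0 \<le> \<eta>" unfolding j by (rule H.graph_eigenvalue_nonneg) simp
  then show "graph_eigenvalue G i \<ge> (real m - 1) / real m * \<eta> * normalized_eigenvalue (vicinity_weight G U) i"
    using graph_eigenvalue_ge[of \<eta> i] le i by simp
qed

end
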